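(* Consider the inhomogeneous spiked Wigner matrix model with arbitrary variance profiles $\Delta^{(N)}$ (possibly non-block-structured and possibly having some infinite entries), with entrywise reciprocals $\Phi^{(N)}$, such that the limit $\widehat\mu_1:=\lim_{N\to\infty}\lambda_1(\Phi^{(N)})/N$ exists and is strictly positive; set $\beta_*:=1/\sqrt{\widehat\mu_1}$. Let $\nu$ be a probability measure on $\mathbb{R}$ (not depending on $N$), let $\mathcal{P}_N$ be the law of $x\in\mathbb{R}^N$ with i.i.d. entries drawn from $\nu$, and let the signal law $\mathcal{X}_N$ be the law of $X=\frac{\beta}{\sqrt N}xx^\top$ with $x\sim\mathcal{P}_N$, for some constant $\beta>0$. Then the following hold. 1. (Computational lower bound) Suppose that (a) $\mathbb{E}_{x\sim\nu}[x]=0$; (b) $\mathbb{E}_{x\sim\nu}[x^2]\le1$; (c) $\nu$ is symmetric (i.e., $x\sim\nu$ has the same law as $-x$); (d) if $x,x'\sim\nu$ are independent, then $xx'$ is $\sigma^2$-subgaussian for some $\sigma^2>0$. Suppose also that, for some $D(N)\in\mathbb{N}$, (e) there exists a constant $B>0$ such that $\Delta^{(N)}_{ij}\ge\frac1B$ for all $N\ge1$ and $1\le i,j\le N$; (f) $D(N)N^2/\lambda_1(\Phi^{(N)})^3\to0$ as $N\to\infty$. If $\beta<\beta_*$, then there is no sequence of polynomials $f_N\in\mathbb{R}[Y]$ with $\deg(f_N)\le D(N)$ that achieves strong separation. 2. (Statistical lower bound) Suppose that (a), (b), (c), and (e) hold, as well as (d$'$) when $x,x'\sim\nu$ are i.i.d.,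 then $xx'$ is $1$-moment-subgaussian. If $\beta<\beta_*$, then there is no sequence of functions $f_N$ that achieves strong separation, there is no sequence of tests $t_N$ that achieves strong detection, and $\chi^2(\mathbb{P}_N\mid\mathbb{Q}_N)=O(1)$ as $N\to\infty$.
   Context: Inhomogeneous spiked Wigner matrix model: for each $N\ge1$, let $\mathcal{X}_N$ be a probability measure on real symmetric $N\times N$ matrices and $\Delta=\Delta^{(N)}\in(\mathbb{R}_{>0}\cup\{+\infty\})^{N\times N}$ symmetric (the variance profile). Let $\mathcal J=\mathcal J^{(N)}=\{(i,j):1\le i\le j\le N,\ \Delta_{ij}\ne+\infty\}$. Two probability measures on $\mathbb{R}^{\mathcal J}$ are defined: under $\mathbb{Q}_N$, $Y_{ij}\sim\mathcal N(0,\Delta_{ij})$ independently for $(i,j)\in\mathcal J$; under $\mathbb{P}_N$, first draw $X\sim\mathcal{X}_N$, then draw $Y_{ij}\sim\mathcal N(X_{ij},\Delta_{ij})$ independently for $(i,j)\in\mathcal J$. $\mathbb{R}[Y]$ denotes polynomials in the variables $Y_{ij}$, $(i,j)\in\mathcal J$. $\Phi^{(N)}_{ij}=1/\Delta^{(N)}_{ij}$ with the convention $1/(+\infty)=0$. $\lambda_1$ is the largest eigenvalue of a symmetric matrix. Strong separation: measurable functions $f_N:\mathbb{R}^{\mathcal J}\to\mathbb{R}$ (square-integrable under $\mathbb{P}_N$ and $\mathbb{Q}_N$) achieve strong separation if $\mathbb{E}_{\mathbb{P}_N}f_N(Y)-\mathbb{E}_{\mathbb{Q}_N}f_N(Y)=\omega\big(\sqrt{\mathrm{Var}_{\mathbb{Q}_N}f_N(Y)}+\sqrt{\mathrm{Var}_{\mathbb{P}_N}f_N(Y)}\big)$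 as $N\to\infty$, i.e. for every $C>0$, for all sufficiently large $N$ the left side is strictly greater than $C$ times the expression inside $\omega(\cdot)$. Strong detection: measurable tests $t_N:\mathbb{R}^{\mathcal J}\to\{0,1\}$ achieve strong detection if $\mathbb{P}_N[t_N(Y)=0]+\mathbb{Q}_N[t_N(Y)=1]\to0$ as $N\to\infty$. $\chi^2(\mathbb{P}\mid\mathbb{Q})=\int(\frac{d\mathbb{P}}{d\mathbb{Q}}-1)^2d\mathbb{Q}$. Subgaussianity: a centered real random variable $X$ is $\sigma^2$-subgaussian if $\mathbb{E}\exp(tX)\le\exp(\frac{\sigma^2}{2}t^2)$ for all $t\in\mathbb{R}$. Moment-subgaussianity: a symmetric real random variable $X$ is $\sigma^2$-moment-subgaussian if $\mathbb{E}X^{2k}\le\sigma^{2k}(2k-1)!!$ for all integers $k\ge1$. *)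

theory Defs
  imports
    "HOL-Probability.Probability"
    "HOL-Library.Poly_Mapping"
    "Jordan_Normal_Form.Char_Poly"
begin

text \<open>Matrix indices run over \<open>{0..<N}\<close> instead of \<open>{1..N}\<close>. Variance profiles have
  entries in \<^typ>\<open>ennreal\<close>, so that \<open>\<infinity>\<close> is an admissible variance (an unobserved entry).\<close>

definition variance_profile :: "nat \<Rightarrow> ennreal mat \<Rightarrow> bool" where
  "variance_profile N \<Delta> \<longleftrightarrow>
     \<Delta> \<in> carrier_mat N N \<and> transpose_mat \<Delta> = \<Delta> \<and> (\<forall>i<N. \<forall>j<N. 0 < \<Delta> $$ (i, j))"

definition observed :: "ennreal mat \<Rightarrow> (nat \<times> nat) set" where
  "observed \<Delta> = {(i, j). i \<le> j \<and> j < dim_row \<Delta> \<and> \<Delta> $$ (i, j) \<noteq> \<infinity>}"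

text \<open>In \<^typ>\<open>ennreal\<close>, \<open>1 / \<infinity> = 0\<close>.\<close>

definition recip_profile :: "ennreal mat \<Rightarrow> real mat" where
  "recip_profile \<Delta> = map_mat (\<lambda>v. enn2real (1 / v)) \<Delta>"

definition largest_eigenvalue :: "real mat \<Rightarrow> real" where
  "largest_eigenvalue A = Max {k. eigenvalue A k}"

text \<open>Points of \<open>\<real>\<^sup>J\<close> are the extensional functions on \<open>J\<close>, as in \<^const>\<open>PiM\<close>. Note that
  \<^const>\<open>normal_density\<close> takes the standard deviation, not the variance.\<close>

definition gaussian_obs :: "ennreal mat \<Rightarrow> (nat \<times> nat \<Rightarrow> real) \<Rightarrow> (nat \<times> nat \<Rightarrow> real) measure" where
  "gaussian_obs \<Delta> X =
     (\<Pi>\<^sub>M p\<in>observed \<Delta>. density lborel (normal_density (X p) (sqrt (enn2real (\<Delta> $$ p)))))"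

definition null_model :: "ennreal mat \<Rightarrow> (nat \<times> nat \<Rightarrow> real) measure" where
  "null_model \<Delta> = gaussian_obs \<Delta> (\<lambda>_. 0)"

definition planted_model ::
    "(nat \<times> nat \<Rightarrow> real) measure \<Rightarrow> ennreal mat \<Rightarrow> (nat \<times> nat \<Rightarrow> real) measure" where
  "planted_model \<X> \<Delta> = \<X> \<bind> gaussian_obs \<Delta>"

text \<open>The law of \<open>(\<beta> / sqrt N) x x\<^sup>T\<close>, where \<open>x\<close> has \<open>N\<close> i.i.d. entries drawn from \<open>\<nu>\<close>;
  matrices are represented as extensional functions on pairs of indices.\<close>

definition spike_law :: "real measure \<Rightarrow> real \<Rightarrow> nat \<Rightarrow> (nat \<times> nat \<Rightarrow> real) measure" where
  "spike_law \<nu> \<beta> N =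
     distr (\<Pi>\<^sub>M i\<in>{..<N}. \<nu>) (\<Pi>\<^sub>M p\<in>{..<N} \<times> {..<N}. borel)
       (\<lambda>x. \<lambda>(i, j)\<in>{..<N} \<times> {..<N}. \<beta> / sqrt (real N) * (x i * x j))"

definition square_integrable :: "'a measure \<Rightarrow> ('a \<Rightarrow> real) \<Rightarrow> bool" where
  "square_integrable M f \<longleftrightarrow> f \<in> borel_measurable M \<and> integrable M (\<lambda>y. (f y)\<^sup>2)"

definition strong_separation ::
    "(nat \<Rightarrow> 'a measure) \<Rightarrow> (nat \<Rightarrow> 'a measure) \<Rightarrow> (nat \<Rightarrow> 'a \<Rightarrow> real) \<Rightarrow> bool" where
  "strong_separation P Q f \<longleftrightarrow>
     (\<forall>N\<ge>1. square_integrable (P N) (f N) \<and> square_integrable (Q N) (f N)) \<and>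
     (\<forall>C>0. \<forall>\<^sub>F N in sequentially.
        prob_space.expectation (P N) (f N) - prob_space.expectation (Q N) (f N) >
        C * (sqrt (prob_space.variance (Q N) (f N)) + sqrt (prob_space.variance (P N) (f N))))"

definition strong_detection ::
    "(nat \<Rightarrow> 'a measure) \<Rightarrow> (nat \<Rightarrow> 'a measure) \<Rightarrow> (nat \<Rightarrow> 'a \<Rightarrow> nat) \<Rightarrow> bool" where
  "strong_detection P Q t \<longleftrightarrow>
     (\<forall>N\<ge>1. t N \<in> measurable (P N) (count_space {0, 1}) \<and>
             t N \<in> measurable (Q N) (count_space {0, 1})) \<and>
     (\<lambda>N. measure (P N) {y \<in> space (P N). t N y = 0} + measure (Q N) {y \<in> space (Q N). t N y = 1})
       \<longlonglongrightarrow> 0"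

text \<open>With values in \<^typ>\<open>ennreal\<close>; as usual the divergence is \<open>\<infinity>\<close> if \<open>P\<close> has no density
  with respect to \<open>Q\<close>.\<close>

definition chi_square :: "'a measure \<Rightarrow> 'a measure \<Rightarrow> ennreal" where
  "chi_square P Q =
     (if absolutely_continuous Q P
      then \<integral>\<^sup>+ y. ennreal ((enn2real (RN_deriv Q P y) - 1)\<^sup>2) \<partial>Q else \<infinity>)"

text \<open>In the next two definitions \<open>s\<close> plays the role of \<open>\<sigma>\<^sup>2\<close>. The nonnegative integral makes the
  bounds fail when an exponential moment or a moment is infinite.\<close>

definition subgaussian :: "'a measure \<Rightarrow> ('a \<Rightarrow> real) \<Rightarrow> real \<Rightarrow> bool" where
  "subgaussian M X s \<longleftrightarrow>
     integrable M X \<and> prob_space.expectation M X = 0 \<and>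
     (\<forall>t. (\<integral>\<^sup>+ \<omega>. ennreal (exp (t * X \<omega>)) \<partial>M) \<le> ennreal (exp (s / 2 * t\<^sup>2)))"

text \<open>The product below is \<open>(2k - 1)!!\<close>.\<close>

definition moment_subgaussian :: "'a measure \<Rightarrow> ('a \<Rightarrow> real) \<Rightarrow> real \<Rightarrow> bool" where
  "moment_subgaussian M X s \<longleftrightarrow>
     X \<in> borel_measurable M \<and> distr M borel (\<lambda>\<omega>. - X \<omega>) = distr M borel X \<and>
     (\<forall>k\<ge>1. (\<integral>\<^sup>+ \<omega>. ennreal (X \<omega> ^ (2 * k)) \<partial>M)
              \<le> ennreal (s ^ k * (\<Prod>i\<in>{1..k}. 2 * real i - 1)))"

text \<open>Multivariate polynomials are finitely supported maps from monomials to coefficients, and a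
  monomial is a finitely supported map from variables to exponents.\<close>

type_synonym 'v mpolynomial = "('v \<Rightarrow>\<^sub>0 nat) \<Rightarrow>\<^sub>0 real"

definition mp_vars :: "'v mpolynomial \<Rightarrow> 'v set" where
  "mp_vars p = (\<Union>m\<in>Poly_Mapping.keys p. Poly_Mapping.keys m)"

definition mp_degree :: "'v mpolynomial \<Rightarrow> nat" where
  "mp_degree p =
     Max (insert 0 ((\<lambda>m. \<Sum>v\<in>Poly_Mapping.keys m. Poly_Mapping.lookup m v) ` Poly_Mapping.keys p))"

definition mp_eval :: "'v mpolynomial \<Rightarrow> ('v \<Rightarrow> real) \<Rightarrow> real" where
  "mp_eval p y =
     (\<Sum>m\<in>Poly_Mapping.keys p. Poly_Mapping.lookup p m *
        (\<Prod>v\<in>Poly_Mapping.keys m. y v ^ Poly_Mapping.lookup m v))"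

end

theory Submission
  imports Defs
begin

text \<open>
  With \<open>z\<^sub>i = x\<^sub>i x'\<^sub>i\<close> for two independent draws of the signal, both advantages are governed by the
  moments of the overlap \<open>(\<beta>\<^sup>2 / N) \<Sum>\<^bsub>i \<le> j\<^esub> \<Phi>\<^sub>i\<^sub>j z\<^sub>i z\<^sub>j = z\<^sup>T A z / 2\<close>: the second moment of the likelihood
  ratio is its exponential moment, and expanding in Hermite polynomials shows that the degree-\<open>D\<close>
  advantage is its exponential series truncated at \<open>D\<close>. Since \<open>A\<close> is entrywise nonnegative and
  the \<open>z\<^sub>i\<close> are symmetric, every moment of the overlap only grows when the moments of the \<open>z\<^sub>i\<close> are
  replaced by those of a Gaussian (statistical bound), or of \<open>\<surd>K b\<^sub>i g\<^sub>i\<close> with \<open>g\<^sub>i\<close> Gaussian and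
  \<open>b\<^sub>i\<close> Bernoulli of mean \<open>1 / K\<close> (computational bound; this mixture has variance one and
  dominates all higher moments of a subgaussian variable).

  For Gaussian \<open>g\<close>, the exponential moment of \<open>g\<^sup>T A g / 2\<close> is bounded by integrating out one coordinate
  at a time. The bound needs only a vector \<open>h\<close> with \<open>A h + s \<le> h\<close>; below the threshold
  \<open>h = (I - A)\<^sup>-\<^sup>1 1\<close> is such a vector with \<open>s = 1\<close>, and its entries are bounded because those of \<open>A\<close>
  are of order \<open>1 / N\<close>. For the mixture, a Chernoff bound shows that \<open>h\<close> still works with \<open>s = 1 / 2\<close>
  for the masked matrix, except on an event of probability \<open>exp (- c N)\<close>; there the truncated series
  is at most exponential in \<open>D\<close>, and \<open>D\<close> is sublinear in \<open>N\<close>.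
\<close>

subsection \<open>Quadratic forms and the largest eigenvalue\<close>

text \<open>Conditioned on the set where \<open>b\<close> is nonzero, the mixture replaces
  \<open>A\<close> by a masked matrix whose entries may be as large as \<open>K\<close> times those
  of \<open>A\<close>. An atypical mask, such as the full one, can therefore lie beyond the Gaussian
  threshold, where the exponential moment may be infinite. Truncation at degree \<open>D\<close> is
  what makes those masks affordable: scaling the form down by a fixed factor costs only that factor
  to the power \<open>D\<close>. A spectral gap alone would still allow Gaussian integrals
  exponential in \<open>N\<close>. Entries of order \<open>1 / N\<close> give \<open>N\<close>
  pivots, each costing \<open>exp (O(1 / N))\<close>, hence a bounded product. The masked row sum of
  \<open>A h\<close> has mean \<open>h - 1\<close>, by the equation for \<open>h\<close>; asking for
  \<open>s = 1 / 2\<close> instead of 1 leaves a slack of 1/2 for the Chernoff bound. The moments of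
  \<open>x x'\<close> are squares of moments of the prior, so assumptions on the product translate
  directly into comparisons with Gaussian moments. The sum over \<open>i \<le> j\<close> doubles the
  diagonal of \<open>A\<close>. This adds at most \<open>B\<close> to the largest eigenvalue of the
  reciprocal profile, which is of order \<open>N\<close>. By the same growth, condition (f) says
  that \<open>D\<close> is sublinear in \<open>N\<close>.\<close>

definition quad_form :: "'i set \<Rightarrow> ('i \<Rightarrow> 'i \<Rightarrow> real) \<Rightarrow> ('i \<Rightarrow> real) \<Rightarrow> real" where
  "quad_form I A x = (\<Sum>i\<in>I. \<Sum>j\<in>I. A i j * x i * x j)"

lemma quad_form_eq: "quad_form I A x = (\<Sum>i\<in>I. x i * (\<Sum>j\<in>I. A i j * x j))"
  by (simp add: quad_form_def sum_distrib_left mult_ac)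

lemma quad_form_le_sum_squares:
  assumes "finite I"
  shows "quad_form I A x \<le> (\<Sum>i\<in>I. \<Sum>j\<in>I. \<bar>A i j\<bar>) * (\<Sum>i\<in>I. (x i)\<^sup>2)"
proof -
  let ?S = "\<Sum>i\<in>I. (x i)\<^sup>2"
  have "A i j * x i * x j \<le> \<bar>A i j\<bar> * ?S" if "i \<in> I" "j \<in> I" for i j
  proof -
    have i: "(x i)\<^sup>2 \<le> ?S" and j: "(x j)\<^sup>2 \<le> ?S"
      using that assms by (auto intro!: member_le_sum)
    have "0 \<le> (\<bar>x i\<bar> - \<bar>x j\<bar>)\<^sup>2" by simp
    then have "\<bar>x i * x j\<bar> \<le> ?S"
      using i j by (simp add: power2_diff abs_mult)
    moreover have "A i j * x i * x j \<le> \<bar>A i j\<bar> * \<bar>x i * x j\<bar>"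
      by (metis abs_ge_self abs_mult mult.assoc)
    ultimately show ?thesis
      by (meson abs_ge_zero mult_left_mono order_trans)
  qed
  then have "quad_form I A x \<le> (\<Sum>i\<in>I. \<Sum>j\<in>I. \<bar>A i j\<bar> * ?S)"
    unfolding quad_form_def by (intro sum_mono) auto
  then show ?thesis by (simp add: sum_distrib_right)
qed

lemma quad_form_diff:
  assumes "\<And>i j. i \<in> I \<Longrightarrow> j \<in> I \<Longrightarrow> A i j = A j i"
  shows "quad_form I A (\<lambda>i. x i - r * y i) =
    quad_form I A x - 2 * r * (\<Sum>i\<in>I. y i * (\<Sum>j\<in>I. A i j * x j)) + r\<^sup>2 * quad_form I A y"
proof -
  let ?X = "\<Sum>i\<in>I. y i * (\<Sum>j\<in>I. A i j * x j)"
  have X: "(\<Sum>i\<in>I. \<Sum>j\<in>I. A i j * y i * x j) = ?X"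
    by (simp add: sum_distrib_left mult_ac)
  have "(\<Sum>i\<in>I. \<Sum>j\<in>I. A i j * x i * y j) = (\<Sum>i\<in>I. \<Sum>j\<in>I. A i j * y i * x j)"
    by (subst sum.swap) (auto intro!: sum.cong simp: assms mult_ac)
  with X have swap: "(\<Sum>i\<in>I. \<Sum>j\<in>I. A i j * x i * y j) = ?X" by simp
  have "quad_form I A (\<lambda>i. x i - r * y i) =
     quad_form I A x - r * (\<Sum>i\<in>I. \<Sum>j\<in>I. A i j * x i * y j)
       - r * (\<Sum>i\<in>I. \<Sum>j\<in>I. A i j * y i * x j) + r\<^sup>2 * quad_form I A y"
    unfolding quad_form_def sum_distrib_left
    by (simp flip: sum.distrib sum_subtractf add: algebra_simps power2_eq_square)
  then show ?thesis unfolding X swap by simp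
qed

text \<open>A gradient step takes the place of diagonalisation. Nonnegativity of the form at
  \<open>x - (1/m) M x\<close> bounds the squared norm of \<open>M x\<close> by \<open>m\<close>
  times the form at \<open>x\<close>, and the inverse \<open>R\<close> bounds the norm of
  \<open>x\<close> by that of \<open>M x\<close>.\<close>

lemma psd_invertible_imp_coercive:
  assumes fin: "finite I" and sym: "\<And>i j. i \<in> I \<Longrightarrow> j \<in> I \<Longrightarrow> M i j = M j i"
    and psd: "\<And>x. 0 \<le> quad_form I M x"
    and inv: "\<And>i j. i \<in> I \<Longrightarrow> j \<in> I \<Longrightarrow> (\<Sum>k\<in>I. R i k * M k j) = (if i = j then 1 else 0)"
  shows "\<exists>\<kappa>>0. \<forall>x. \<kappa> * (\<Sum>i\<in>I. (x i)\<^sup>2) \<le> quad_form I M x"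
proof -
  \<comment> \<open>\<open>m\<close> bounds the form relative to the squared norm, and
    \<open>r\<close> exceeds the squared Frobenius norm of \<open>R\<close>; the added 1 keeps both
    positive.\<close>
  define m where "m = 1 + (\<Sum>i\<in>I. \<Sum>j\<in>I. \<bar>M i j\<bar>)"
  define r where "r = 1 + (\<Sum>i\<in>I. \<Sum>j\<in>I. (R i j)\<^sup>2)"
  have m: "m > 0" and r: "r > 0"
    unfolding m_def r_def by (auto intro!: add_pos_nonneg sum_nonneg)
  have "1 / (m * r) * (\<Sum>i\<in>I. (x i)\<^sup>2) \<le> quad_form I M x" for x
  proof -
    define y where "y i = (\<Sum>j\<in>I. M i j * x j)" for i
    let ?Y = "\<Sum>i\<in>I. (y i)\<^sup>2"
    have Y: "?Y \<ge> 0" by (simp add: sum_nonneg)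
    have "quad_form I M y \<le> m * ?Y"
      using quad_form_le_sum_squares[OF fin, of M y] Y unfolding m_def by (simp add: algebra_simps)
    then have "(1/m)\<^sup>2 * quad_form I M y \<le> (1/m)\<^sup>2 * (m * ?Y)"
      by (intro mult_left_mono) auto
    also have "\<dots> = 1/m * ?Y" using m by (simp add: power2_eq_square)
    finally have "(1/m)\<^sup>2 * quad_form I M y \<le> 1/m * ?Y" .
    moreover have "0 \<le> quad_form I M x - 2 * (1/m) * ?Y + (1/m)\<^sup>2 * quad_form I M y"
      using psd[of "\<lambda>i. x i - 1/m * y i"] quad_form_diff[of I M x "1/m" y, OF sym]
      by (simp add: y_def power2_eq_square)
    ultimately have 1: "1/m * ?Y \<le> quad_form I M x" by simp
    have x: "x i = (\<Sum>k\<in>I. R i k * y k)" if "i \<in> I" for i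
    proof -
      have "(\<Sum>k\<in>I. R i k * y k) = (\<Sum>j\<in>I. (\<Sum>k\<in>I. R i k * M k j) * x j)"
        unfolding y_def sum_distrib_left sum_distrib_right
        by (subst sum.swap) (simp add: mult_ac)
      also have "\<dots> = (\<Sum>j\<in>I. if i = j then x j else 0)"
        using inv that by (intro sum.cong) auto
      finally show ?thesis using that fin by simp
    qed
    have "(\<Sum>i\<in>I. (x i)\<^sup>2) \<le> (\<Sum>i\<in>I. (\<Sum>k\<in>I. (R i k)\<^sup>2) * ?Y)"
      using x by (intro sum_mono) (simp add: Cauchy_Schwarz_ineq_sum)
    also have "\<dots> \<le> r * ?Y"
      unfolding r_def sum_distrib_right[symmetric] using Y by (intro mult_right_mono) auto
    finally have "(\<Sum>i\<in>I. (x i)\<^sup>2) \<le> r * ?Y" .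
    then have "1 / (m * r) * (\<Sum>i\<in>I. (x i)\<^sup>2) \<le> 1 / (m * r) * (r * ?Y)"
      using m r by (intro mult_left_mono) auto
    also have "\<dots> = 1/m * ?Y" using r by simp
    finally show ?thesis using 1 by simp
  qed
  then show ?thesis using m r by (intro exI[of _ "1/(m*r)"]) auto
qed

lemma sum_mult_delta:
  fixes t :: real assumes "finite I" "i \<in> I"
  shows "(\<Sum>j\<in>I. ((if i = j then t else 0) - A i j) * x j) = t * x i - (\<Sum>j\<in>I. A i j * x j)"
proof -
  have "(\<Sum>j\<in>I. ((if i = j then t else 0) - A i j) * x j) =
      (\<Sum>j\<in>I. (if i = j then t * x j else 0) - A i j * x j)"
    by (intro sum.cong) (auto simp: algebra_simps)
  then show ?thesis using assms by (simp add: sum_subtractf)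
qed

lemma quad_form_shift:
  fixes t :: real assumes "finite I"
  shows "quad_form I (\<lambda>i j. (if i = j then t else 0) - A i j) x = t * (\<Sum>i\<in>I. (x i)\<^sup>2) - quad_form I A x"
proof -
  have "quad_form I (\<lambda>i j. (if i = j then t else 0) - A i j) x =
      (\<Sum>i\<in>I. t * (x i)\<^sup>2 - x i * (\<Sum>j\<in>I. A i j * x j))"
    unfolding quad_form_eq using assms
    by (intro sum.cong) (simp_all add: sum_mult_delta right_diff_distrib power2_eq_square)
  then show ?thesis by (simp add: quad_form_eq sum_subtractf sum_distrib_left)
qed

text \<open>The Fredholm alternative in coordinates, decided by the determinant. The inverse is
  given on both sides: coercivity uses it from the left, the resolvent equation from the
  right.\<close>

lemma kernel_or_inverse:
  fixes M :: "nat \<Rightarrow> nat \<Rightarrow> real"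
  obtains v where "\<exists>i<n. v i \<noteq> 0" "\<And>i. i < n \<Longrightarrow> (\<Sum>j<n. M i j * v j) = 0"
  | R where "\<And>i j. i < n \<Longrightarrow> j < n \<Longrightarrow> (\<Sum>k<n. R i k * M k j) = (if i = j then 1 else 0)"
      "\<And>i j. i < n \<Longrightarrow> j < n \<Longrightarrow> (\<Sum>k<n. M i k * R k j) = (if i = j then 1 else 0)"
proof -
  let ?M = "mat n n (\<lambda>(i,j). M i j)"
  have M: "?M \<in> carrier_mat n n" by simp
  show thesis
  proof (cases "det ?M = 0")
    case True
    then obtain v where v: "v \<in> carrier_vec n" "v \<noteq> 0\<^sub>v n" "?M *\<^sub>v v = 0\<^sub>v n"
      using det_0_iff_vec_prod_zero_field[OF M] by auto
    show thesis
    proof (rule that(1))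
      show "\<exists>i<n. vec_index v i \<noteq> 0" using v(1,2) by (auto intro: eq_vecI)
      show "(\<Sum>j<n. M i j * vec_index v j) = 0" if "i < n" for i
        using arg_cong[OF v(3), of "\<lambda>u. vec_index u i"] that v(1)
        by (simp add: scalar_prod_def lessThan_atLeast0)
    qed
  next
    case False
    from det_non_zero_imp_unit[OF M this, of "()"]
    obtain R where R: "R \<in> carrier_mat n n" "R * ?M = 1\<^sub>m n" "?M * R = 1\<^sub>m n"
      unfolding Units_def ring_mat_def by auto
    show thesis
    proof (rule that(2))
      fix i j assume ij: "i < n" "j < n"
      show "(\<Sum>k<n. R $$ (i,k) * M k j) = (if i = j then 1 else 0)"
        using arg_cong[OF R(2), of "\<lambda>u. u $$ (i,j)"] ij R(1)
        by (simp add: scalar_prod_def lessThan_atLeast0)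
      show "(\<Sum>k<n. M i k * R $$ (k,j)) = (if i = j then 1 else 0)"
        using arg_cong[OF R(3), of "\<lambda>u. u $$ (i,j)"] ij R(1)
        by (simp add: scalar_prod_def lessThan_atLeast0)
    qed
  qed
qed

text \<open>The least \<open>s\<close> with \<open>s I - A\<close> positive semidefinite is an eigenvalue: otherwise \<open>s I - A\<close> is
  invertible, hence coercive, and \<open>s\<close> can be decreased.\<close>

lemma quad_form_le_largest_eigenvalue:
  assumes A: "A \<in> carrier_mat n n" and sym: "transpose_mat A = A" and n: "n > 0"
  shows "quad_form {..<n} (\<lambda>i j. A $$ (i, j)) x \<le> largest_eigenvalue A * (\<Sum>i<n. (x i)\<^sup>2)"
proof -
  let ?q = "quad_form {..<n} (\<lambda>i j. A $$ (i, j))"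
  let ?S = "\<lambda>x. \<Sum>i<n. (x i)\<^sup>2"
  have symA: "A $$ (i, j) = A $$ (j, i)" if "i < n" "j < n" for i j
    using arg_cong[OF sym, of "\<lambda>M. M $$ (i, j)"] A that by simp
  define T where "T = {t. \<forall>x. ?q x \<le> t * ?S x}"
  have ne: "T \<noteq> {}"
    unfolding T_def using quad_form_le_sum_squares[of "{..<n}" "\<lambda>i j. A $$ (i, j)"] by blast
  \<comment> \<open>A unit vector: the value of the form at \<open>e\<close> bounds \<open>T\<close>
    from below, so that the infimum of \<open>T\<close> is meaningful.\<close>
  define e where "e i = (if i = 0 then 1 else 0 :: real)" for i :: nat
  have e: "?S e = 1" using n by (simp add: e_def if_distrib[of "\<lambda>x. x\<^sup>2"] cong: if_cong)
  have low: "?q e \<le> t" if "t \<in> T" for t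
    using that e unfolding T_def by (auto dest: spec[of _ e])
  then have bdd: "bdd_below T" by (intro bdd_belowI)
  define s where "s = Inf T"
  \<comment> \<open>The infimum is attained, because for each \<open>x\<close> with
    \<open>?S x > 0\<close> the condition on \<open>t\<close> is the closed one
    \<open>?q x / ?S x \<le> t\<close>; for \<open>?S x = 0\<close> it does not depend on
    \<open>t\<close>.\<close>
  have sT: "s \<in> T"
    unfolding T_def
  proof (intro CollectI allI)
    fix x
    show "?q x \<le> s * ?S x"
    proof (rule ccontr)
      assume *: "\<not> ?q x \<le> s * ?S x"
      have S0: "?S x \<ge> 0" by (simp add: sum_nonneg)
      obtain t0 where "t0 \<in> T" using ne by auto
      have S: "?S x > 0"
      proof (rule ccontr)
        assume "\<not> ?S x > 0"
        then have "?S x = 0" using S0 by simp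
        then show False using * \<open>t0 \<in> T\<close> unfolding T_def by (auto dest: spec[of _ x])
      qed
      have "?q x / ?S x \<le> t" if "t \<in> T" for t
        using that S unfolding T_def by (auto simp: divide_le_eq)
      then have "?q x / ?S x \<le> s" unfolding s_def using ne by (intro cInf_greatest)
      then show False using * S by (simp add: divide_le_eq)
    qed
  qed
  define M where "M i j = (if i = j then s else 0) - A $$ (i, j)" for i j
  have qM: "quad_form {..<n} M x = s * ?S x - ?q x" for x
    unfolding M_def by (rule quad_form_shift) simp
  have "eigenvalue A s"
  proof (rule kernel_or_inverse[of n M])
    fix v assume v: "\<exists>i<n. v i \<noteq> 0" "\<And>i. i < n \<Longrightarrow> (\<Sum>j<n. M i j * v j) = 0"
    have "A *\<^sub>v vec n v = s \<cdot>\<^sub>v vec n v"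
    proof (intro eq_vecI)
      fix i assume "i < dim_vec (s \<cdot>\<^sub>v vec n v)"
      then have i: "i < n" by simp
      then have "s * v i = (\<Sum>j<n. A $$ (i,j) * v j)"
        using v(2)[OF i] sum_mult_delta[of "{..<n}" i s "\<lambda>i j. A $$ (i,j)" v] by (simp add: M_def)
      then show "vec_index (A *\<^sub>v vec n v) i = vec_index (s \<cdot>\<^sub>v vec n v) i"
        using i A by (simp add: scalar_prod_def lessThan_atLeast0)
    qed (use A in auto)
    moreover have "vec n v \<noteq> 0\<^sub>v n" using v(1) by (metis index_vec index_zero_vec(1))
    ultimately show "eigenvalue A s" unfolding eigenvalue_def eigenvector_def
      using A by (auto intro!: exI[of _ "vec n v"])
  next
    fix R assume R: "\<And>i j. i < n \<Longrightarrow> j < n \<Longrightarrow> (\<Sum>k<n. R i k * M k j) = (if i = j then 1 else 0)"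
    have "\<exists>\<kappa>>0. \<forall>x. \<kappa> * ?S x \<le> quad_form {..<n} M x"
    proof (rule psd_invertible_imp_coercive[of _ M R])
      show "0 \<le> quad_form {..<n} M x" for x using sT unfolding T_def by (simp add: qM)
      show "M i j = M j i" if "i \<in> {..<n}" "j \<in> {..<n}" for i j
        using symA that by (simp add: M_def)
    qed (use R in auto)
    then obtain \<kappa> where \<kappa>: "\<kappa> > 0" "\<And>x. \<kappa> * ?S x \<le> s * ?S x - ?q x" using qM by auto
    then have "s - \<kappa> \<in> T" unfolding T_def by (auto simp: algebra_simps)
    then have "s \<le> s - \<kappa>" unfolding s_def using bdd by (intro cInf_lower)
    then show ?thesis using \<kappa> by simp
  qed
  \<comment> \<open>\<open>Max\<close> dominates its elements only for a finite set; eigenvalues are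
    roots of the nonzero characteristic polynomial.\<close>
  moreover have "finite {k. eigenvalue A k}"
  proof -
    have "char_poly A \<noteq> 0" using degree_monic_char_poly[OF A] by auto
    then show ?thesis using eigenvalue_root_char_poly[OF A] by (simp add: poly_roots_finite)
  qed
  ultimately have "s \<le> largest_eigenvalue A" unfolding largest_eigenvalue_def by (intro Max_ge) auto
  then have "s * ?S x \<le> largest_eigenvalue A * ?S x" by (intro mult_right_mono) (auto simp: sum_nonneg)
  then show ?thesis using sT unfolding T_def by (auto intro: order_trans)
qed

text \<open>\<open>h = (I - A)\<^sup>-\<^sup>1 1\<close>, where \<open>I - A\<close> is an M-matrix.\<close>

lemma resolvent_vector:
  fixes A :: "nat \<Rightarrow> nat \<Rightarrow> real"
  assumes nonneg: "\<And>i j. i < n \<Longrightarrow> j < n \<Longrightarrow> 0 \<le> A i j"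
    and upper: "\<And>i j. i < n \<Longrightarrow> j < n \<Longrightarrow> A i j \<le> C / n"
    and form: "\<And>x. quad_form {..<n} A x \<le> (1 - \<epsilon>) * (\<Sum>i<n. (x i)\<^sup>2)"
    and eps: "\<epsilon> > 0" and C: "C \<ge> 0"
  obtains h where "\<And>i. i < n \<Longrightarrow> h i = 1 + (\<Sum>j<n. A i j * h j)"
    "\<And>i. i < n \<Longrightarrow> 1 \<le> h i" "\<And>i. i < n \<Longrightarrow> h i \<le> 1 + C / \<epsilon>"
proof -
  define M where "M i j = (if i = j then 1 else 0) - A i j" for i j
  have qM: "quad_form {..<n} M x = (\<Sum>i<n. (x i)\<^sup>2) - quad_form {..<n} A x" for x
    unfolding M_def using quad_form_shift[of "{..<n}" 1 A x] by simp
  have coer: "\<epsilon> * (\<Sum>i<n. (x i)\<^sup>2) \<le> quad_form {..<n} M x" for x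
    using form[of x] unfolding qM by (simp add: algebra_simps)
  have Mv: "(\<Sum>j<n. M i j * v j) = v i - (\<Sum>j<n. A i j * v j)" if "i < n" for i v
    unfolding M_def using sum_mult_delta[of "{..<n}" i 1 A v] that by simp
  obtain h where h: "\<And>i. i < n \<Longrightarrow> (\<Sum>j<n. M i j * h j) = 1"
  proof (rule kernel_or_inverse[of n M])
    fix v assume v: "\<exists>i<n. v i \<noteq> 0" "\<And>i. i < n \<Longrightarrow> (\<Sum>j<n. M i j * v j) = 0"
    have "quad_form {..<n} M v = 0" unfolding quad_form_eq using v(2) by simp
    then have "(\<Sum>i<n. (v i)\<^sup>2) \<le> 0" using coer[of v] eps by (simp add: mult_le_0_iff)
    moreover obtain i where i: "i < n" "v i \<noteq> 0" using v by auto
    moreover have "(v i)\<^sup>2 \<le> (\<Sum>i<n. (v i)\<^sup>2)" using i by (intro member_le_sum) auto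
    ultimately have False by (metis order_trans power2_less_eq_zero_iff)
    then show thesis ..
  next
    fix R assume R: "\<And>i j. i < n \<Longrightarrow> j < n \<Longrightarrow> (\<Sum>k<n. M i k * R k j) = (if i = j then 1 else 0)"
    have "(\<Sum>j<n. M i j * (\<Sum>k<n. R j k)) = 1" if "i < n" for i
    proof -
      have "(\<Sum>j<n. M i j * (\<Sum>k<n. R j k)) = (\<Sum>k<n. \<Sum>j<n. M i j * R j k)"
        unfolding sum_distrib_left by (rule sum.swap)
      also have "\<dots> = (\<Sum>k<n. if i = k then 1 else 0)" using R that by (intro sum.cong) auto
      finally show ?thesis using that by simp
    qed
    then show thesis by (rule that)
  qed
  have eq: "h i = 1 + (\<Sum>j<n. A i j * h j)" if "i < n" for i
    using h[OF that] Mv[OF that, of h] by simp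
  \<comment> \<open>The equation \<open>M h = 1\<close> is tested against the negative part
    \<open>m\<close> of \<open>h\<close>. Since \<open>A\<close> is nonnegative and
    \<open>m\<close>, \<open>p\<close> have disjoint supports, the term in \<open>p\<close> is at
    most 0, which forces the form at \<open>m\<close> to be at most 0; coercivity gives
    \<open>m = 0\<close>.\<close>
  have pos: "0 \<le> h i" if "i < n" for i
  proof -
    define m where "m i = max 0 (- h i)" for i
    define p where "p i = max 0 (h i)" for i
    have hpm: "h i = p i - m i" for i unfolding m_def p_def by auto
    have pm: "p i * m i = 0" for i unfolding m_def p_def by auto
    have m0: "m i \<ge> 0" and p0: "p i \<ge> 0" for i unfolding m_def p_def by auto
    have "(\<Sum>i<n. m i * (\<Sum>j<n. M i j * h j)) = (\<Sum>i<n. m i)" using h by simp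
    moreover have "(\<Sum>i<n. m i * (\<Sum>j<n. M i j * h j)) =
        (\<Sum>i<n. m i * (\<Sum>j<n. M i j * p j)) - quad_form {..<n} M m"
      unfolding quad_form_eq hpm
      by (simp add: sum_subtractf right_diff_distrib)
    moreover have "(\<Sum>i<n. m i * (\<Sum>j<n. M i j * p j)) \<le> 0"
    proof (rule sum_nonpos)
      fix i assume "i \<in> {..<n}"
      then have i: "i < n" by simp
      have "0 \<le> m i * (\<Sum>j<n. A i j * p j)"
        using nonneg i m0 p0 by (intro mult_nonneg_nonneg sum_nonneg) auto
      moreover have "m i * p i = 0" using pm[of i] by (simp add: mult.commute)
      ultimately show "m i * (\<Sum>j<n. M i j * p j) \<le> 0"
        unfolding Mv[OF i] right_diff_distrib by linarith
    qed
    moreover have "(\<Sum>i<n. m i) \<ge> 0" using m0 by (simp add: sum_nonneg)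
    ultimately have "quad_form {..<n} M m \<le> 0" by linarith
    then have "\<epsilon> * (\<Sum>i<n. (m i)\<^sup>2) \<le> 0" using coer[of m] by linarith
    then have "(\<Sum>i<n. (m i)\<^sup>2) \<le> 0" using eps by (simp add: mult_le_0_iff)
    moreover have "(m i)\<^sup>2 \<le> (\<Sum>i<n. (m i)\<^sup>2)" using that by (intro member_le_sum) auto
    ultimately have "m i = 0" by (metis order_trans power2_less_eq_zero_iff)
    then show ?thesis unfolding m_def by (auto simp: max_def split: if_splits)
  qed
  have ge1: "1 \<le> h i" if "i < n" for i
    using eq[OF that] nonneg pos that by (auto intro!: sum_nonneg)
  \<comment> \<open>Testing the equation against \<open>h\<close> itself and Cauchy-Schwarz give the
    averaged bound \<open>\<epsilon> * (\<Sum>i<n. h i) \<le> n\<close>. The entry bound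
    \<open>C / n\<close> then turns an average over \<open>h\<close> into a bound for each
    coordinate.\<close>
  have le: "h i \<le> 1 + C / \<epsilon>" if i: "i < n" for i
  proof -
    let ?S = "\<Sum>i<n. (h i)\<^sup>2"
    have n: "n > 0" using i by simp
    have "\<epsilon> * ?S \<le> (\<Sum>i<n. h i)"
      using coer[of h] h unfolding quad_form_eq by simp
    moreover have "(\<Sum>i<n. h i)\<^sup>2 \<le> n * ?S"
      using Cauchy_Schwarz_ineq_sum[of "\<lambda>_. 1" h "{..<n}"] by simp
    ultimately have "\<epsilon> * (\<Sum>i<n. h i)\<^sup>2 \<le> n * (\<Sum>i<n. h i)"
    proof -
      assume 1: "\<epsilon> * ?S \<le> (\<Sum>i<n. h i)" and "(\<Sum>i<n. h i)\<^sup>2 \<le> n * ?S"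
      then have "\<epsilon> * (\<Sum>i<n. h i)\<^sup>2 \<le> \<epsilon> * (n * ?S)" using eps by (intro mult_left_mono) auto
      also have "\<dots> = n * (\<epsilon> * ?S)" by simp
      also have "\<dots> \<le> n * (\<Sum>i<n. h i)" using 1 by (intro mult_left_mono) auto
      finally show ?thesis .
    qed
    moreover have "(\<Sum>i<n. h i) > 0"
    proof (intro sum_pos)
      show "0 < h i" if "i \<in> {..<n}" for i using ge1[of i] that by simp
    qed (use n in auto)
    ultimately have sum: "\<epsilon> * (\<Sum>i<n. h i) \<le> n"
      by (simp add: power2_eq_square mult.assoc[symmetric])
    have "(\<Sum>j<n. A i j * h j) \<le> (\<Sum>j<n. C / n * h j)"
      using upper i pos by (intro sum_mono mult_right_mono) auto
    also have "\<dots> = C / n * (\<Sum>j<n. h j)" by (simp add: sum_distrib_left)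
    also have "\<dots> \<le> C / n * (n / \<epsilon>)"
      using sum eps C by (intro mult_left_mono) (auto simp: field_simps)
    also have "\<dots> = C / \<epsilon>" using n by simp
    finally show ?thesis using eq[OF i] by simp
  qed
  show thesis using eq ge1 le by (rule that)
qed

subsection \<open>Gaussian integrals of quadratic forms\<close>

abbreviation std_gauss :: "real measure" where
  "std_gauss \<equiv> density lborel (normal_density 0 1)"

lemma prob_space_std_gauss: "prob_space std_gauss"
  by (rule prob_space_normal_density) simp

text \<open>Completing the square: the tilted density is a multiple of the normal density with mean
  \<open>b / (1 - a)\<close> and variance \<open>1 / (1 - a)\<close>.\<close>

lemma nn_integral_std_gauss_exp:
  assumes a: "a < 1"
  shows "(\<integral>\<^sup>+y. ennreal (exp (a * y\<^sup>2 / 2 + b * y)) \<partial>std_gauss) =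
    ennreal (exp (b\<^sup>2 / (2 * (1 - a))) / sqrt (1 - a))"
proof -
  let ?s = "1 / sqrt (1 - a)" and ?m = "b / (1 - a)"
  have pos: "1 - a > 0" using a by simp
  have eq: "normal_density 0 1 y * exp (a * y\<^sup>2 / 2 + b * y) =
      exp (b\<^sup>2 / (2 * (1 - a))) / sqrt (1 - a) * normal_density ?m ?s y" for y
  proof -
    define d where "d = 1 - a"
    have "d \<noteq> 0" using pos by (simp add: d_def)
    then have "- (y\<^sup>2 / 2) + ((1 - d) * y\<^sup>2 / 2 + b * y) = b\<^sup>2 / (2 * d) + - (y - b / d)\<^sup>2 * d / 2"
      by (simp add: field_simps power2_eq_square)
    then have "- (y\<^sup>2 / 2) + (a * y\<^sup>2 / 2 + b * y) = b\<^sup>2 / (2 * (1 - a)) + - (y - ?m)\<^sup>2 * (1 - a) / 2"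
      by (simp add: d_def)
    moreover have "?s\<^sup>2 = 1 / (1 - a)" using pos by (simp add: power_divide)
    ultimately show ?thesis using pos
      unfolding normal_density_def
      by (simp add: exp_add[symmetric] real_sqrt_divide real_sqrt_mult)
  qed
  have "(\<integral>\<^sup>+y. ennreal (exp (a * y\<^sup>2 / 2 + b * y)) \<partial>std_gauss) =
      (\<integral>\<^sup>+y. ennreal (exp (b\<^sup>2 / (2 * (1 - a))) / sqrt (1 - a)) * ennreal (normal_density ?m ?s y) \<partial>lborel)"
  proof (subst nn_integral_density, measurable, rule nn_integral_cong)
    fix y
    have "0 \<le> exp (b\<^sup>2 / (2 * (1 - a))) / sqrt (1 - a)" using pos by simp
    then show "ennreal (normal_density 0 1 y) * ennreal (exp (a * y\<^sup>2 / 2 + b * y)) =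
      ennreal (exp (b\<^sup>2 / (2 * (1 - a))) / sqrt (1 - a)) * ennreal (normal_density ?m ?s y)"
      by (metis ennreal_mult' eq normal_density_nonneg)
  qed
  also have "\<dots> = ennreal (exp (b\<^sup>2 / (2 * (1 - a))) / sqrt (1 - a)) * (\<integral>\<^sup>+y. ennreal (normal_density ?m ?s y) \<partial>lborel)"
    by (rule nn_integral_cmult) simp
  also have "(\<integral>\<^sup>+y. ennreal (normal_density ?m ?s y) \<partial>lborel) = 1"
  proof -
    interpret prob_space "density lborel (normal_density ?m ?s)"
      using pos by (intro prob_space_normal_density) simp
    show ?thesis using emeasure_space_1 by (simp add: emeasure_density)
  qed
  finally show ?thesis by simp
qed

lemma quad_form_insert:
  assumes "finite I" "n \<notin> I" and sym: "\<And>i. i \<in> I \<Longrightarrow> A i n = A n i"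
  shows "quad_form (insert n I) A (x(n := y)) =
    A n n * y\<^sup>2 + 2 * (\<Sum>j\<in>I. A n j * x j) * y + quad_form I A x"
proof -
  define z where "z = x(n := y)"
  have z: "z n = y" "\<And>i. i \<in> I \<Longrightarrow> z i = x i" using assms(2) by (auto simp: z_def)
  have "quad_form (insert n I) A z = A n n * (z n)\<^sup>2 + (\<Sum>j\<in>I. A n j * z n * z j) +
      (\<Sum>i\<in>I. A i n * z i * z n) + quad_form I A z"
    using assms(1,2) by (simp add: quad_form_def sum.distrib power2_eq_square)
  also have "quad_form I A z = quad_form I A x"
    unfolding quad_form_def using z by (intro sum.cong) auto
  also have "(\<Sum>j\<in>I. A n j * z n * z j) = (\<Sum>j\<in>I. A n j * x j) * y"
    unfolding sum_distrib_right using z by (intro sum.cong) auto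
  also have "(\<Sum>i\<in>I. A i n * z i * z n) = (\<Sum>j\<in>I. A n j * x j) * y"
    unfolding sum_distrib_right using z sym by (intro sum.cong) auto
  finally show ?thesis using z(1) by (simp add: z_def del: fun_upd_apply)
qed

lemma product_prob_space_std_gauss: "product_prob_space (\<lambda>_. std_gauss)"
  by (simp add: product_prob_spaceI prob_space_std_gauss)

text \<open>Integrating out the coordinate \<open>n\<close> replaces \<open>A\<close> by its Schur complement
  \<open>A i j + A n i * A n j / (1 - A n n)\<close>. The hypotheses say that \<open>h\<close> is a supersolution of
  \<open>(I - \<bar>A\<bar>) h = s\<close>; they persist under elimination with the same \<open>h\<close> and an updated \<open>s\<close>, and
  every pivot differs from 1 by at most \<open>\<delta> U\<close>.\<close>

lemma nn_integral_gauss_exp_quad_form: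
  fixes A :: "'i \<Rightarrow> 'i \<Rightarrow> real" and h s :: "'i \<Rightarrow> real" and \<delta> U :: real
  assumes "finite I"
    and "\<And>i j. i \<in> I \<Longrightarrow> j \<in> I \<Longrightarrow> A i j = A j i"
    and "\<And>i. i \<in> I \<Longrightarrow> (\<Sum>j\<in>I. \<bar>A i j\<bar> * h j) + s i \<le> h i"
    and "\<And>i j. i \<in> I \<Longrightarrow> j \<in> I \<Longrightarrow> \<bar>A i j\<bar> \<le> \<delta> * s i"
    and "\<And>i. i \<in> I \<Longrightarrow> 0 \<le> s i" "\<And>i. i \<in> I \<Longrightarrow> 0 \<le> h i" "\<And>i. i \<in> I \<Longrightarrow> h i \<le> U"
    and \<delta>: "\<delta> \<ge> 0" and U: "U \<ge> 0" "\<delta> * U \<le> 1 / 2"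
  shows "(\<integral>\<^sup>+g. ennreal (exp (quad_form I A g / 2)) \<partial>(\<Pi>\<^sub>M i\<in>I. std_gauss))
    \<le> ennreal (exp (card I * (\<delta> * U)))"
  using assms(1-7)
proof (induction I arbitrary: A s rule: finite_induct)
  case empty
  interpret prob_space "\<Pi>\<^sub>M i\<in>({} :: 'i set). std_gauss" by (intro prob_space_PiM prob_space_std_gauss)
  show ?case using emeasure_space_1 by (simp add: quad_form_def)
next
  case (insert n I)
  interpret product_prob_space "\<lambda>_::'i. std_gauss" by (rule product_prob_space_std_gauss)
  let ?a = "A n n" and ?b = "\<lambda>j. A n j"
  define A' where "A' i j = A i j + ?b i * ?b j / (1 - ?a)" for i j
  \<comment> \<open>Row \<open>n\<close> of the supersolution inequality, multiplied by
    \<open>\<bar>?b i\<bar> / (1 - \<bar>?a\<bar>)\<close> and added to row \<open>i\<close>,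
    cancels \<open>h n\<close>; the slack left over is \<open>s' i\<close>.\<close>
  define s' where "s' i = s i + \<bar>?b i\<bar> * s n / (1 - \<bar>?a\<bar>)" for i
  have fin: "finite I" and nI: "n \<notin> I" by fact+
  have hn: "(\<Sum>j\<in>I. \<bar>?b j\<bar> * h j) + s n \<le> (1 - \<bar>?a\<bar>) * h n" 
    using insert.prems(2)[of n] fin nI by (simp add: algebra_simps)
  have sn: "0 \<le> s n" using insert.prems by auto
  have snh: "s n \<le> h n"
  proof -
    have "0 \<le> (\<Sum>j\<in>insert n I. \<bar>A n j\<bar> * h j)"
      using insert.prems(5) by (intro sum_nonneg mult_nonneg_nonneg) auto
    then show ?thesis using insert.prems(2)[of n] by simp
  qed
  have a: "\<bar>?a\<bar> \<le> \<delta> * U"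
  proof -
    have "\<bar>?a\<bar> \<le> \<delta> * s n" using insert.prems by auto
    also have "\<dots> \<le> \<delta> * U" using snh insert.prems(6)[of n] \<delta> by (intro mult_left_mono) auto
    finally show ?thesis .
  qed
  have a1: "\<bar>?a\<bar> \<le> 1/2" using a U by simp
  have IH: "(\<integral>\<^sup>+g. ennreal (exp (quad_form I A' g / 2)) \<partial>(\<Pi>\<^sub>M i\<in>I. std_gauss))
    \<le> ennreal (exp (card I * (\<delta> * U)))"
  proof (rule insert.IH[of A' s'])
    fix i j assume i: "i \<in> I" and j: "j \<in> I"
    show "A' i j = A' j i" unfolding A'_def using i j insert.prems(1) by simp
    \<comment> \<open>Row \<open>n\<close> obeys the entry bound with \<open>s n\<close>, so the
      correction to \<open>A\<close> is at most \<open>\<delta>\<close> times the correction to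
      \<open>s\<close>. Hence \<open>\<delta>\<close> does not grow along the elimination.\<close>
    have "\<bar>?b i * ?b j / (1 - ?a)\<bar> \<le> \<bar>?b i\<bar> * (\<delta> * s n) / (1 - \<bar>?a\<bar>)"
      unfolding abs_divide abs_mult using a1 insert.prems(3)[of n j] j
      by (intro frac_le mult_left_mono) auto
    moreover have "\<bar>A i j\<bar> \<le> \<delta> * s i" using i j insert.prems by auto
    ultimately have "\<bar>A' i j\<bar> \<le> \<delta> * s i + \<bar>?b i\<bar> * (\<delta> * s n) / (1 - \<bar>?a\<bar>)"
      unfolding A'_def by linarith
    then show "\<bar>A' i j\<bar> \<le> \<delta> * s' i"
      unfolding s'_def by (simp add: algebra_simps)
  next
    fix i assume i: "i \<in> I"
    show "0 \<le> s' i" unfolding s'_def using i insert.prems(4) sn a1 by simp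
    have "(\<Sum>j\<in>I. \<bar>A' i j\<bar> * h j) \<le> (\<Sum>j\<in>I. \<bar>A i j\<bar> * h j + \<bar>?b i\<bar> / (1 - \<bar>?a\<bar>) * (\<bar>?b j\<bar> * h j))"
    proof (rule sum_mono)
      fix j assume j: "j \<in> I"
      have "\<bar>?b i * ?b j / (1 - ?a)\<bar> \<le> \<bar>?b i\<bar> * \<bar>?b j\<bar> / (1 - \<bar>?a\<bar>)"
        unfolding abs_divide abs_mult using a1 by (intro frac_le) auto
      then have "\<bar>A' i j\<bar> \<le> \<bar>A i j\<bar> + \<bar>?b i\<bar> * \<bar>?b j\<bar> / (1 - \<bar>?a\<bar>)"
        unfolding A'_def by linarith
      then have "\<bar>A' i j\<bar> * h j \<le> (\<bar>A i j\<bar> + \<bar>?b i\<bar> * \<bar>?b j\<bar> / (1 - \<bar>?a\<bar>)) * h j"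
        using insert.prems(5) j by (intro mult_right_mono) auto
      then show "\<bar>A' i j\<bar> * h j \<le> \<bar>A i j\<bar> * h j + \<bar>?b i\<bar> / (1 - \<bar>?a\<bar>) * (\<bar>?b j\<bar> * h j)"
        by (simp add: algebra_simps)
    qed
    also have "\<dots> = (\<Sum>j\<in>I. \<bar>A i j\<bar> * h j) + \<bar>?b i\<bar> / (1 - \<bar>?a\<bar>) * (\<Sum>j\<in>I. \<bar>?b j\<bar> * h j)"
      by (simp add: sum.distrib sum_distrib_left)
    finally have "(\<Sum>j\<in>I. \<bar>A' i j\<bar> * h j) + s' i \<le>
        (\<Sum>j\<in>I. \<bar>A i j\<bar> * h j) + s i + \<bar>?b i\<bar> / (1 - \<bar>?a\<bar>) * ((\<Sum>j\<in>I. \<bar>?b j\<bar> * h j) + s n)"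
      unfolding s'_def by (simp add: distrib_left)
    also have "\<bar>?b i\<bar> / (1 - \<bar>?a\<bar>) * ((\<Sum>j\<in>I. \<bar>?b j\<bar> * h j) + s n) \<le> 
        \<bar>?b i\<bar> / (1 - \<bar>?a\<bar>) * ((1 - \<bar>?a\<bar>) * h n)"
      using hn a1 by (intro mult_left_mono) auto
    also have "\<dots> = \<bar>A i n\<bar> * h n" using a1 insert.prems(1)[of i n] i by simp
    also have "(\<Sum>j\<in>I. \<bar>A i j\<bar> * h j) + s i + \<bar>A i n\<bar> * h n \<le> h i"
      using insert.prems(2)[of i] i fin nI by simp
    finally show "(\<Sum>j\<in>I. \<bar>A' i j\<bar> * h j) + s' i \<le> h i" by simp
  qed (use insert.prems in auto)
  \<comment> \<open>With \<open>u = \<delta> * U \<le> 1 / 2\<close> one has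
    \<open>1 / (1 - u) \<le> 1 + 2 * u \<le> exp (2 * u)\<close>, and the square root from the
    Gaussian integral halves the exponent.\<close>
  have pivot: "1 / sqrt (1 - ?a) \<le> exp (\<delta> * U)"
  proof -
    have "1 / (1 - ?a) \<le> 1 + 2 * (\<delta> * U)"
    proof -
      have "(1 + 2 * (\<delta> * U)) * (1 - ?a) \<ge> (1 + 2 * (\<delta> * U)) * (1 - \<delta> * U)"
        using a \<delta> U by (intro mult_left_mono) auto
      moreover have "(1 + 2 * (\<delta> * U)) * (1 - \<delta> * U) = 1 + \<delta> * U * (1 - 2 * (\<delta> * U))"
        by (simp add: algebra_simps)
      moreover have "\<delta> * U * (1 - 2 * (\<delta> * U)) \<ge> 0"
        using \<delta> U by (intro mult_nonneg_nonneg) auto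
      ultimately have "1 \<le> (1 + 2 * (\<delta> * U)) * (1 - ?a)" by linarith
      then show ?thesis using a1 by (subst pos_divide_le_eq) auto
    qed
    also have "\<dots> \<le> exp (2 * (\<delta> * U))" by (rule exp_ge_add_one_self)
    also have "\<dots> = (exp (\<delta> * U))\<^sup>2" by (simp add: exp_double)
    finally have "sqrt (1 / (1 - ?a)) \<le> exp (\<delta> * U)" by (simp add: real_le_lsqrt)
    then show ?thesis by (simp add: real_sqrt_divide)
  qed
  have meas: "(\<lambda>g. ennreal (exp (quad_form (insert n I) A g / 2))) \<in> borel_measurable (\<Pi>\<^sub>M i\<in>insert n I. std_gauss)"
    unfolding quad_form_def by measurable
  have measI: "(\<lambda>g. ennreal (exp (quad_form I A' g / 2))) \<in> borel_measurable (\<Pi>\<^sub>M i\<in>I. std_gauss)"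
    unfolding quad_form_def by measurable
  have inner: "(\<integral>\<^sup>+y. ennreal (exp (quad_form (insert n I) A (x(n := y)) / 2)) \<partial>std_gauss) =
      ennreal (1 / sqrt (1 - ?a)) * ennreal (exp (quad_form I A' x / 2))" for x
  proof -
    let ?B = "\<Sum>j\<in>I. ?b j * x j"
    have "(\<integral>\<^sup>+y. ennreal (exp (quad_form (insert n I) A (x(n := y)) / 2)) \<partial>std_gauss) =
        (\<integral>\<^sup>+y. ennreal (exp (quad_form I A x / 2)) * ennreal (exp (?a * y\<^sup>2 / 2 + ?B * y)) \<partial>std_gauss)"
      using insert.prems(1) fin nI
      by (intro nn_integral_cong) (simp add: quad_form_insert ennreal_mult'[symmetric] exp_add[symmetric] add_divide_distrib add_ac)
    also have "\<dots> = ennreal (exp (quad_form I A x / 2)) * ennreal (exp (?B\<^sup>2 / (2 * (1 - ?a))) / sqrt (1 - ?a))"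
      using a1 by (subst nn_integral_cmult) (auto simp: nn_integral_std_gauss_exp)
    also have "\<dots> = ennreal (1 / sqrt (1 - ?a)) * ennreal (exp (quad_form I A x / 2 + ?B\<^sup>2 / (2 * (1 - ?a))))"
      using a1 by (simp add: ennreal_mult'[symmetric] exp_add)
    also have "quad_form I A x / 2 + ?B\<^sup>2 / (2 * (1 - ?a)) = quad_form I A' x / 2"
    proof -
      have "?B\<^sup>2 / (1 - ?a) = (\<Sum>i\<in>I. \<Sum>j\<in>I. ?b i * ?b j / (1 - ?a) * x i * x j)"
        unfolding power2_eq_square sum_product sum_divide_distrib by (simp add: mult_ac)
      then have "quad_form I A' x = quad_form I A x + ?B\<^sup>2 / (1 - ?a)"
        unfolding quad_form_def A'_def by (simp add: distrib_right sum.distrib)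
      then show ?thesis by (simp add: add_divide_distrib)
    qed
    finally show ?thesis .
  qed
  have "(\<integral>\<^sup>+g. ennreal (exp (quad_form (insert n I) A g / 2)) \<partial>(\<Pi>\<^sub>M i\<in>insert n I. std_gauss)) =
      (\<integral>\<^sup>+x. ennreal (1 / sqrt (1 - ?a)) * ennreal (exp (quad_form I A' x / 2)) \<partial>(\<Pi>\<^sub>M i\<in>I. std_gauss))"
    by (subst product_nn_integral_insert[OF fin nI meas]) (simp add: inner)
  also have "\<dots> = ennreal (1 / sqrt (1 - ?a)) * (\<integral>\<^sup>+x. ennreal (exp (quad_form I A' x / 2)) \<partial>(\<Pi>\<^sub>M i\<in>I. std_gauss))"
    by (rule nn_integral_cmult[OF measI])
  also have "\<dots> \<le> ennreal (exp (\<delta> * U)) * ennreal (exp (card I * (\<delta> * U)))"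
    using pivot by (intro mult_mono IH ennreal_leI) auto
  also have "\<dots> = ennreal (exp (card (insert n I) * (\<delta> * U)))"
    using fin nI by (simp add: ennreal_mult'[symmetric] exp_add[symmetric] algebra_simps)
  finally show ?case .
qed

section \<open>Gaussians of arbitrary mean and standard deviation\<close>

abbreviation gauss :: "real \<Rightarrow> real \<Rightarrow> real measure" where
  "gauss \<mu> \<sigma> \<equiv> density lborel (normal_density \<mu> \<sigma>)"

lemma sigma_finite_gauss: "sigma_finite_measure (gauss \<mu> \<sigma>)"
  by (subst sigma_finite_measure.sigma_finite_iff_density_finite[OF lborel.sigma_finite_measure_axioms]) auto

lemma product_sigma_finite_gauss: "product_sigma_finite (\<lambda>i. gauss (\<mu> i) (\<sigma> i))"
  by (intro product_sigma_finite.intro sigma_finite_gauss)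

lemma gauss_eq_distr:
  assumes "\<sigma> > 0"
  shows "gauss \<mu> \<sigma> = distr std_gauss borel (\<lambda>g. \<mu> + \<sigma> * g)"
proof -
  interpret prob_space std_gauss by (rule prob_space_std_gauss)
  have "distributed std_gauss lborel (\<lambda>g. g) (normal_density 0 1)"
    unfolding distributed_def by (auto simp: distr_id2)
  then have "distributed std_gauss lborel (\<lambda>g. \<mu> + \<sigma> * g) (normal_density (\<mu> + \<sigma> * 0) (\<bar>\<sigma>\<bar> * 1))"
    by (rule normal_density_affine) (use assms in auto)
  then have "distr std_gauss lborel (\<lambda>g. \<mu> + \<sigma> * g) = gauss \<mu> \<sigma>"
    using assms by (simp add: distributed_distr_eq_density)
  then show ?thesis by (metis distr_cong sets_lborel)
qed

subsection \<open>Gaussian moments and Hermite polynomials\<close>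

lemma integrable_std_gauss_power [simp, intro]: "integrable std_gauss (\<lambda>x. x ^ k)"
  by (subst integrable_density) (auto simp: integrable_std_normal_moment)

lemma std_gauss_moment_even:
  "(\<integral>x. x ^ (2 * k) \<partial>std_gauss) = fact (2 * k) / (2 ^ k * fact k)"
  by (subst integral_density) (auto simp: integral_std_normal_moment_even)

lemma std_gauss_moment_odd: "odd k \<Longrightarrow> (\<integral>x. x ^ k \<partial>std_gauss) = 0"
  using integral_std_normal_moment_odd
  by (subst integral_density) (auto elim!: oddE)

lemma std_gauss_moment_nonneg: "0 \<le> (\<integral>x. x ^ k \<partial>std_gauss)"
proof (cases "even k")
  case True
  then show ?thesis by (auto simp: std_gauss_moment_even elim!: evenE)
qed (simp add: std_gauss_moment_odd)

text \<open>Stein's recursion. At \<open>k = 0\<close> the truncated \<open>k - 1\<close> is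
  harmless, since its factor is 0.\<close>

lemma std_gauss_moment_Suc:
  "(\<integral>x. x ^ Suc k \<partial>std_gauss) = k * (\<integral>x. x ^ (k - 1) \<partial>std_gauss)"
proof (cases "even k")
  case True
  then show ?thesis
    using std_gauss_moment_odd[of 1] by (cases "k = 0") (auto simp: std_gauss_moment_odd simp del: power_Suc)
next
  case False
  then obtain j where k: "k = 2 * j + 1" by (auto elim!: oddE)
  have eq: "Suc k = 2 * Suc j" "k - 1 = 2 * j" using k by auto
  have "fact (2 * Suc j) = (2 * real j + 2) * ((2 * real j + 1) * fact (2 * j))"
    by (simp add: algebra_simps)
  then show ?thesis unfolding eq std_gauss_moment_even by (simp add: k field_simps del: fact_Suc) (simp add: field_simps)
qed

lemma integrable_std_gauss_poly [simp, intro]: "integrable std_gauss (\<lambda>x. poly p x)"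
  unfolding poly_altdef by (intro Bochner_Integration.integrable_sum integrable_mult_right) simp

text \<open>Both sides are linear in \<open>p\<close>, and on monomials the identity is the moment
  recursion; no boundary terms have to be discussed.\<close>

lemma gaussian_integration_by_parts:
  "(\<integral>x. x * poly p x \<partial>std_gauss) = (\<integral>x. poly (pderiv p) x \<partial>std_gauss)"
proof -
  have "(\<integral>x. x * poly p x \<partial>std_gauss) = (\<integral>x. (\<Sum>k\<le>degree p. coeff p k * x ^ Suc k) \<partial>std_gauss)"
    by (simp add: poly_altdef sum_distrib_left mult_ac)
  also have "\<dots> = (\<Sum>k\<le>degree p. coeff p k * (\<integral>x. x ^ Suc k \<partial>std_gauss))"
    by (subst Bochner_Integration.integral_sum) (auto simp del: power_Suc)
  also have "\<dots> = (\<Sum>k\<le>degree p. coeff p k * (k * (\<integral>x. x ^ (k - 1) \<partial>std_gauss)))"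
    by (simp only: std_gauss_moment_Suc)
  also have "\<dots> = (\<Sum>k\<le>degree p. \<integral>x. coeff p k * (k * x ^ (k - 1)) \<partial>std_gauss)"
    by (intro sum.cong) auto
  also have "\<dots> = (\<integral>x. (\<Sum>k\<le>degree p. coeff p k * (k * x ^ (k - 1))) \<partial>std_gauss)"
    by (subst Bochner_Integration.integral_sum) auto
  also have "(\<lambda>x::real. \<Sum>k\<le>degree p. coeff p k * (k * x ^ (k - 1))) = poly (pderiv p)"
  proof
    fix x :: real
    have "poly p = (\<lambda>x. \<Sum>k\<le>degree p. coeff p k * x ^ k)" by (simp add: poly_altdef fun_eq_iff)
    moreover have "((\<lambda>x. \<Sum>k\<le>degree p. coeff p k * x ^ k) has_real_derivative
        (\<Sum>k\<le>degree p. coeff p k * (k * x ^ (k - 1)))) (at x)"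
      by (auto intro!: derivative_eq_intros sum.cong)
    ultimately show "(\<Sum>k\<le>degree p. coeff p k * (k * x ^ (k - 1))) = poly (pderiv p) x"
      using poly_DERIV[of p x] by (metis DERIV_unique)
  qed
  finally show ?thesis .
qed

text \<open>The probabilists' Hermite polynomials: monic, and generated by \<open>x - d/dx\<close>,
  the adjoint of \<open>d/dx\<close> under the standard Gaussian.\<close>

primrec hermite :: "nat \<Rightarrow> real poly" where
  "hermite 0 = 1"
| "hermite (Suc k) = pCons 0 (hermite k) - pderiv (hermite k)"

lemma pderiv_hermite: "pderiv (hermite (Suc k)) = Polynomial.smult (Suc k) (hermite k)"
proof (induction k)
  case (Suc k)
  have "pderiv (hermite (Suc (Suc k))) =
      hermite (Suc k) + pCons 0 (pderiv (hermite (Suc k))) - pderiv (pderiv (hermite (Suc k)))"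
    by (subst hermite.simps) (simp only: pderiv_diff pderiv_pCons)
  also have "\<dots> = hermite (Suc k) + Polynomial.smult (Suc k) (pCons 0 (hermite k) - pderiv (hermite k))"
    unfolding Suc.IH by (simp add: pderiv_smult smult_diff_right)
  also have "\<dots> = Polynomial.smult (1 + real (Suc k)) (hermite (Suc k))"
    by (simp only: smult_add_left hermite.simps smult_1_left)
  finally show ?case by simp
qed (simp add: pderiv_pCons)

lemma hermite_monic: "degree (hermite k) \<le> k \<and> coeff (hermite k) k = 1"
proof (induction k)
  case (Suc k)
  have "degree (pderiv (hermite k)) \<le> k" using Suc by (simp add: degree_pderiv le_diff_conv)
  then have "degree (hermite (Suc k)) \<le> Suc k" 
    using Suc by (auto intro!: degree_diff_le degree_pCons_le[THEN order_trans])
  moreover have "coeff (pderiv (hermite k)) (Suc k) = 0"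
    using \<open>degree (pderiv (hermite k)) \<le> k\<close> by (simp add: coeff_eq_0)
  ultimately show ?case using Suc by simp
qed simp

lemma hermite_expansion:
  assumes "degree p \<le> d"
  obtains a where "p = (\<Sum>j\<le>d. Polynomial.smult (a j) (hermite j))"
proof -
  have "\<exists>a. p = (\<Sum>j\<le>d. Polynomial.smult (a j) (hermite j))"
    using assms
  proof (induction d arbitrary: p)
    case 0
    then obtain c where "p = [:c:]" by (auto elim: degree_eq_zeroE)
    then show ?case by (intro exI[of _ "\<lambda>_. c"]) simp
  next
    case (Suc d)
    let ?c = "coeff p (Suc d)"
    let ?q = "p - Polynomial.smult ?c (hermite (Suc d))"
    have "degree ?q \<le> d"
    proof (intro degree_le allI impI)
      fix j assume j: "d < j"
      show "coeff ?q j = 0"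
      proof (cases "j = Suc d")
        case True
        then show ?thesis using hermite_monic[of "Suc d"] by (simp del: hermite.simps)
      next
        case False
        then have "degree p < j" "degree (hermite (Suc d)) < j"
          using j Suc.prems hermite_monic[of "Suc d"] by linarith+
        then show ?thesis by (simp add: coeff_eq_0 del: hermite.simps)
      qed
    qed
    then obtain a where a: "?q = (\<Sum>j\<le>d. Polynomial.smult (a j) (hermite j))" using Suc.IH by blast
    have "p = (\<Sum>j\<le>Suc d. Polynomial.smult ((a(Suc d := ?c)) j) (hermite j))"
      using a by (simp del: hermite.simps add: diff_eq_eq)
    then show ?case by blast
  qed
  then show thesis using that by (elim exE)
qed

text \<open>In the recursion the factor \<open>x + g\<close> splits; integration by parts trades
  \<open>g\<close> for a derivative that cancels the \<open>pderiv\<close> term, and only the factor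
  \<open>x\<close> remains. This makes the planted mean of a Hermite polynomial a pure monomial in
  the signal.\<close>

lemma integral_hermite_shift: "(\<integral>g. poly (hermite k) (x + g) \<partial>std_gauss) = x ^ k"
proof (induction k)
  case 0
  interpret prob_space std_gauss by (rule prob_space_std_gauss)
  show ?case using prob_space by simp
next
  case (Suc k)
  let ?s = "\<lambda>p. pcompose p [:x, 1:]"
  have s: "poly p (x + g) = poly (?s p) g" for p g by (simp add: poly_pcompose)
  have "(\<integral>g. poly (hermite (Suc k)) (x + g) \<partial>std_gauss) =
      (\<integral>g. x * poly (?s (hermite k)) g + g * poly (?s (hermite k)) g - poly (?s (pderiv (hermite k))) g \<partial>std_gauss)"
    by (simp add: poly_pcompose algebra_simps)
  also have "\<dots> = x * (\<integral>g. poly (?s (hermite k)) g \<partial>std_gauss)"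
  proof -
    have "integrable std_gauss (\<lambda>g. g * poly (?s (hermite k)) g)"
      using integrable_std_gauss_poly[of "pCons 0 (?s (hermite k))"] by simp
    then show ?thesis
      by (simp add: gaussian_integration_by_parts pderiv_pcompose pderiv_pCons)
  qed
  finally show ?case using Suc by (simp add: s)
qed

text \<open>Adjointness moves one raising operator off \<open>hermite j\<close> as a derivative of
  \<open>hermite k\<close>, which lowers \<open>k\<close> by one with factor \<open>k\<close>. The
  base case is the shift identity at 0.\<close>

lemma integral_hermite_orthogonal:
  "(\<integral>g. poly (hermite j) g * poly (hermite k) g \<partial>std_gauss) = (if j = k then fact k else 0)"
proof (induction j arbitrary: k)
  case 0
  show ?case using integral_hermite_shift[of k 0] by (cases k) auto
next
  case (Suc j)
  let ?p = "hermite j * hermite k"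
  have "(\<integral>g. poly (hermite (Suc j)) g * poly (hermite k) g \<partial>std_gauss) =
      (\<integral>g. g * poly ?p g - poly (pderiv (hermite j) * hermite k) g \<partial>std_gauss)"
    by (simp add: algebra_simps)
  also have "\<dots> = (\<integral>g. poly (pderiv ?p) g \<partial>std_gauss) - (\<integral>g. poly (pderiv (hermite j) * hermite k) g \<partial>std_gauss)"
  proof -
    have "integrable std_gauss (\<lambda>g. g * poly ?p g)"
      using integrable_std_gauss_poly[of "pCons 0 ?p"] by simp
    then show ?thesis
      by (subst Bochner_Integration.integral_diff) (simp_all only: gaussian_integration_by_parts integrable_std_gauss_poly)
  qed
  also have "\<dots> = (\<integral>g. poly (pderiv ?p) g - poly (pderiv (hermite j) * hermite k) g \<partial>std_gauss)"
    by (subst Bochner_Integration.integral_diff) (simp_all only: integrable_std_gauss_poly)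
  also have "\<dots> = (\<integral>g. poly (hermite j) g * poly (pderiv (hermite k)) g \<partial>std_gauss)"
    by (simp add: pderiv_mult algebra_simps)
  also have "\<dots> = (if Suc j = k then fact k else 0)"
  proof (cases k)
    case (Suc k')
    show ?thesis unfolding Suc pderiv_hermite
      using Suc.IH[of k'] by (simp add: mult.left_commute)
  qed simp
  finally show ?case .
qed

lemma borel_measurable_poly [measurable (raw)]:
  fixes p :: "real poly"
  assumes "f \<in> borel_measurable M"
  shows "(\<lambda>x. poly p (f x)) \<in> borel_measurable M"
  using measurable_compose[OF assms borel_measurable_continuous_onI[of "poly p"]]
  by (simp add: continuous_intros)

lemma gauss_hermite_integral:
  assumes "\<sigma> > 0"
  shows "integrable (gauss \<mu> \<sigma>) (\<lambda>y. poly p (y / \<sigma>))"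
    and "(\<integral>y. poly (hermite k) (y / \<sigma>) \<partial>gauss \<mu> \<sigma>) = (\<mu> / \<sigma>) ^ k"
    and "(\<integral>y. poly (hermite j) (y / \<sigma>) * poly (hermite k) (y / \<sigma>) \<partial>gauss 0 \<sigma>) = (if j = k then fact k else 0)"
proof -
  have div: "(\<mu> + \<sigma> * g) / \<sigma> = \<mu> / \<sigma> + g" for \<mu> g using assms by (simp add: field_simps)
  have "integrable std_gauss (\<lambda>g. poly (pcompose p [:\<mu> / \<sigma>, 1:]) g)" by (rule integrable_std_gauss_poly)
  then show "integrable (gauss \<mu> \<sigma>) (\<lambda>y. poly p (y / \<sigma>))"
    unfolding gauss_eq_distr[OF assms, of \<mu>]
    by (subst integrable_distr_eq) (simp_all add: div poly_pcompose)
  show "(\<integral>y. poly (hermite k) (y / \<sigma>) \<partial>gauss \<mu> \<sigma>) = (\<mu> / \<sigma>) ^ k"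
    unfolding gauss_eq_distr[OF assms, of \<mu>]
    by (subst integral_distr) (simp_all add: div integral_hermite_shift)
  show "(\<integral>y. poly (hermite j) (y / \<sigma>) * poly (hermite k) (y / \<sigma>) \<partial>gauss 0 \<sigma>) = (if j = k then fact k else 0)"
    unfolding gauss_eq_distr[OF assms, of 0]
    by (subst integral_distr) (use assms in \<open>simp_all add: integral_hermite_orthogonal\<close>)
qed

section \<open>Hermite products in several variables and the multinomial identity\<close>

definition multi_hermite :: "'i set \<Rightarrow> ('i \<Rightarrow> real) \<Rightarrow> ('i \<Rightarrow> nat) \<Rightarrow> ('i \<Rightarrow> real) \<Rightarrow> real" where
  "multi_hermite J \<sigma> \<alpha> y = (\<Prod>p\<in>J. poly (hermite (\<alpha> p)) (y p / \<sigma> p))"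

lemma multi_hermite_integral:
  assumes J: "finite J" and \<sigma>: "\<And>p. p \<in> J \<Longrightarrow> \<sigma> p > 0"
  shows "integrable (\<Pi>\<^sub>M p\<in>J. gauss (\<mu> p) (\<sigma> p)) (multi_hermite J \<sigma> \<alpha>)"
    and "(\<integral>y. multi_hermite J \<sigma> \<alpha> y \<partial>(\<Pi>\<^sub>M p\<in>J. gauss (\<mu> p) (\<sigma> p))) = (\<Prod>p\<in>J. (\<mu> p / \<sigma> p) ^ \<alpha> p)"
    and "integrable (\<Pi>\<^sub>M p\<in>J. gauss 0 (\<sigma> p)) (\<lambda>y. multi_hermite J \<sigma> \<alpha> y * multi_hermite J \<sigma> \<gamma> y)"
    and "(\<integral>y. multi_hermite J \<sigma> \<alpha> y * multi_hermite J \<sigma> \<gamma> y \<partial>(\<Pi>\<^sub>M p\<in>J. gauss 0 (\<sigma> p))) =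
      (if \<forall>p\<in>J. \<alpha> p = \<gamma> p then \<Prod>p\<in>J. fact (\<alpha> p) else 0)"
proof -
  interpret product_sigma_finite "\<lambda>p. gauss (\<mu> p) (\<sigma> p)" by (rule product_sigma_finite_gauss)
  show "integrable (\<Pi>\<^sub>M p\<in>J. gauss (\<mu> p) (\<sigma> p)) (multi_hermite J \<sigma> \<alpha>)"
    unfolding multi_hermite_def[abs_def] using J \<sigma>
    by (intro product_integrable_prod gauss_hermite_integral) auto
  show "(\<integral>y. multi_hermite J \<sigma> \<alpha> y \<partial>(\<Pi>\<^sub>M p\<in>J. gauss (\<mu> p) (\<sigma> p))) = (\<Prod>p\<in>J. (\<mu> p / \<sigma> p) ^ \<alpha> p)"
    unfolding multi_hermite_def using J \<sigma>
    by (subst product_integral_prod) (auto intro!: gauss_hermite_integral prod.cong)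
next
  interpret product_sigma_finite "\<lambda>p. gauss 0 (\<sigma> p)" by (rule product_sigma_finite_gauss)
  have int: "integrable (gauss 0 (\<sigma> p)) (\<lambda>y. poly (hermite j) (y / \<sigma> p) * poly (hermite k) (y / \<sigma> p))"
    if "p \<in> J" for p j k
    using gauss_hermite_integral(1)[OF \<sigma>[OF that], of 0 "hermite j * hermite k"] by simp
  show "integrable (\<Pi>\<^sub>M p\<in>J. gauss 0 (\<sigma> p)) (\<lambda>y. multi_hermite J \<sigma> \<alpha> y * multi_hermite J \<sigma> \<gamma> y)"
    unfolding multi_hermite_def prod.distrib[symmetric] using J int
    by (intro product_integrable_prod) auto
  have "(\<integral>y. multi_hermite J \<sigma> \<alpha> y * multi_hermite J \<sigma> \<gamma> y \<partial>(\<Pi>\<^sub>M p\<in>J. gauss 0 (\<sigma> p))) =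
      (\<Prod>p\<in>J. if \<alpha> p = \<gamma> p then fact (\<gamma> p) else 0)"
    unfolding multi_hermite_def prod.distrib[symmetric] using J int \<sigma>
    by (subst product_integral_prod) (auto intro!: prod.cong simp: gauss_hermite_integral)
  also have "\<dots> = (if \<forall>p\<in>J. \<alpha> p = \<gamma> p then \<Prod>p\<in>J. fact (\<alpha> p) else 0)"
    using J by (auto intro!: prod.cong simp: prod_zero_iff)
  finally show "(\<integral>y. multi_hermite J \<sigma> \<alpha> y * multi_hermite J \<sigma> \<gamma> y \<partial>(\<Pi>\<^sub>M p\<in>J. gauss 0 (\<sigma> p))) =
      (if \<forall>p\<in>J. \<alpha> p = \<gamma> p then \<Prod>p\<in>J. fact (\<alpha> p) else 0)" .
qed

text \<open>Indices are extensional on \<open>J\<close>, so that indices agreeing on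
  \<open>J\<close> are equal and a sum over this set meets every monomial once.\<close>

definition multi_indices :: "'i set \<Rightarrow> nat \<Rightarrow> ('i \<Rightarrow> nat) set" where
  "multi_indices J D = {\<alpha> \<in> J \<rightarrow>\<^sub>E UNIV. (\<Sum>p\<in>J. \<alpha> p) \<le> D}"

lemma finite_multi_indices:
  assumes "finite J" shows "finite (multi_indices J D)"
proof (rule finite_subset)
  show "multi_indices J D \<subseteq> J \<rightarrow>\<^sub>E {..D}"
  proof
    fix \<alpha> assume \<alpha>: "\<alpha> \<in> multi_indices J D"
    have "\<alpha> p \<le> D" if "p \<in> J" for p
      using member_le_sum[of p J \<alpha>] \<alpha> that assms by (auto simp: multi_indices_def)
    then show "\<alpha> \<in> J \<rightarrow>\<^sub>E {..D}" using \<alpha> by (auto simp: multi_indices_def PiE_iff)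
  qed
qed (use assms in \<open>auto intro: finite_PiE\<close>)

text \<open>A one-variable power expands without raising its degree, so the expanded product stays
  within total degree \<open>D\<close>.\<close>

lemma hermite_expansion_monomial:
  assumes J: "finite J" and \<sigma>: "\<And>p. p \<in> J \<Longrightarrow> \<sigma> p > 0" and deg: "(\<Sum>p\<in>J. m p) \<le> D"
  shows "\<exists>c. \<forall>y. (\<Prod>p\<in>J. y p ^ m p) = (\<Sum>\<alpha>\<in>multi_indices J D. c \<alpha> * multi_hermite J \<sigma> \<alpha> y)"
proof -
  \<comment> \<open>The coefficient \<open>\<sigma> p ^ m p\<close> compensates for passing to the
    normalised variable \<open>y p / \<sigma> p\<close>.\<close>
  have "\<forall>p. \<exists>a. monom (\<sigma> p ^ m p) (m p) = (\<Sum>j\<le>m p. Polynomial.smult (a j) (hermite j))"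
    using hermite_expansion[OF degree_monom_le] by blast
  from choice[OF this] obtain a where
    a: "\<And>p. monom (\<sigma> p ^ m p) (m p) = (\<Sum>j\<le>m p. Polynomial.smult (a p j) (hermite j))" by blast
  have pow: "y p ^ m p = (\<Sum>j\<le>m p. a p j * poly (hermite j) (y p / \<sigma> p))" if "p \<in> J" for y p
  proof -
    have "y p ^ m p = poly (monom (\<sigma> p ^ m p) (m p)) (y p / \<sigma> p)"
      using \<sigma>[OF that] by (simp add: poly_monom power_mult_distrib[symmetric])
    then show ?thesis unfolding a by (simp add: poly_sum)
  qed
  have sub: "(\<Pi>\<^sub>E p\<in>J. {..m p}) \<subseteq> multi_indices J D"
    using deg by (auto simp: multi_indices_def PiE_iff intro: order_trans[OF sum_mono])
  define c where "c \<alpha> = (if \<alpha> \<in> (\<Pi>\<^sub>E p\<in>J. {..m p}) then \<Prod>p\<in>J. a p (\<alpha> p) else 0)" for \<alpha>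
  have "(\<Prod>p\<in>J. y p ^ m p) = (\<Sum>\<alpha>\<in>multi_indices J D. c \<alpha> * multi_hermite J \<sigma> \<alpha> y)" for y
  proof -
    have "(\<Prod>p\<in>J. y p ^ m p) = (\<Prod>p\<in>J. \<Sum>j\<le>m p. a p j * poly (hermite j) (y p / \<sigma> p))"
      using pow by (intro prod.cong) auto
    also have "\<dots> = (\<Sum>\<alpha>\<in>(\<Pi>\<^sub>E p\<in>J. {..m p}). \<Prod>p\<in>J. a p (\<alpha> p) * poly (hermite (\<alpha> p)) (y p / \<sigma> p))"
      using J by (intro prod_sum_PiE) auto
    also have "\<dots> = (\<Sum>\<alpha>\<in>(\<Pi>\<^sub>E p\<in>J. {..m p}). c \<alpha> * multi_hermite J \<sigma> \<alpha> y)"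
      by (intro sum.cong) (auto simp: c_def multi_hermite_def prod.distrib)
    also have "\<dots> = (\<Sum>\<alpha>\<in>multi_indices J D. c \<alpha> * multi_hermite J \<sigma> \<alpha> y)"
      using sub finite_multi_indices[OF J] by (intro sum.mono_neutral_left) (auto simp: c_def)
    finally show ?thesis .
  qed
  then show ?thesis by blast
qed

lemma hermite_expansion_mpolynomial:
  assumes J: "finite J" and \<sigma>: "\<And>p. p \<in> J \<Longrightarrow> \<sigma> p > 0"
    and f: "mp_vars f \<subseteq> J" "mp_degree f \<le> D"
  shows "\<exists>c. \<forall>y. mp_eval f y = (\<Sum>\<alpha>\<in>multi_indices J D. c \<alpha> * multi_hermite J \<sigma> \<alpha> y)"
proof -
  have "\<forall>m\<in>Poly_Mapping.keys f. \<exists>c. \<forall>y.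
      (\<Prod>p\<in>J. y p ^ Poly_Mapping.lookup m p) = (\<Sum>\<alpha>\<in>multi_indices J D. c \<alpha> * multi_hermite J \<sigma> \<alpha> y)"
  proof (rule ballI, rule hermite_expansion_monomial[OF J \<sigma>])
    fix m assume m: "m \<in> Poly_Mapping.keys f"
    have sub: "Poly_Mapping.keys m \<subseteq> J" using m f(1) by (auto simp: mp_vars_def)
    have "(\<Sum>p\<in>J. Poly_Mapping.lookup m p) = (\<Sum>p\<in>Poly_Mapping.keys m. Poly_Mapping.lookup m p)"
      using sub J by (intro sum.mono_neutral_right) (auto simp: in_keys_iff)
    also have "\<dots> \<le> mp_degree f" unfolding mp_degree_def using m by (intro Max_ge) auto
    finally show "(\<Sum>p\<in>J. Poly_Mapping.lookup m p) \<le> D" using f(2) by simp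
  qed
  from bchoice[OF this] obtain c where c: "\<And>m y. m \<in> Poly_Mapping.keys f \<Longrightarrow>
      (\<Prod>p\<in>J. y p ^ Poly_Mapping.lookup m p) = (\<Sum>\<alpha>\<in>multi_indices J D. c m \<alpha> * multi_hermite J \<sigma> \<alpha> y)"
    by blast
  show ?thesis
  proof (intro exI allI)
    fix y
    have "mp_eval f y = (\<Sum>m\<in>Poly_Mapping.keys f. Poly_Mapping.lookup f m * (\<Prod>p\<in>J. y p ^ Poly_Mapping.lookup m p))"
      unfolding mp_eval_def
    proof (intro sum.cong arg_cong2[where f="(*)"] prod.mono_neutral_left refl)
      fix m assume "m \<in> Poly_Mapping.keys f"
      then show "Poly_Mapping.keys m \<subseteq> J" using f(1) by (auto simp: mp_vars_def)
    qed (use J in \<open>auto simp: in_keys_iff\<close>)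
    also have "\<dots> = (\<Sum>m\<in>Poly_Mapping.keys f. \<Sum>\<alpha>\<in>multi_indices J D. Poly_Mapping.lookup f m * c m \<alpha> * multi_hermite J \<sigma> \<alpha> y)"
      by (intro sum.cong) (auto simp: c sum_distrib_left mult_ac)
    also have "\<dots> = (\<Sum>\<alpha>\<in>multi_indices J D. (\<Sum>m\<in>Poly_Mapping.keys f. Poly_Mapping.lookup f m * c m \<alpha>) * multi_hermite J \<sigma> \<alpha> y)"
      by (subst sum.swap) (simp add: sum_distrib_right)
    finally show "mp_eval f y = (\<Sum>\<alpha>\<in>multi_indices J D. (\<Sum>m\<in>Poly_Mapping.keys f. Poly_Mapping.lookup f m * c m \<alpha>) * multi_hermite J \<sigma> \<alpha> y)" .
  qed
qed

lemma multi_indices_insert_sum: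
  assumes J: "finite J" "q \<notin> J"
  shows "(\<Sum>\<alpha>\<in>multi_indices (insert q J) D. F \<alpha>) =
    (\<Sum>k\<le>D. \<Sum>\<alpha>\<in>multi_indices J (D - k). F (\<alpha>(q := k)) :: real)"
proof -
  have fin: "finite (multi_indices J d)" for d using J by (simp add: finite_multi_indices)
  have cong: "(\<Sum>p\<in>J. (\<alpha>(q := k)) p) = (\<Sum>p\<in>J. \<alpha> p)" for \<alpha> :: "_ \<Rightarrow> nat" and k
    using J by (intro sum.cong) auto
  have "(\<Sum>k\<le>D. \<Sum>\<alpha>\<in>multi_indices J (D - k). F (\<alpha>(q := k))) =
      (\<Sum>(k, \<alpha>)\<in>(SIGMA k:{..D}. multi_indices J (D - k)). F (\<alpha>(q := k)))"
    using fin by (intro sum.Sigma) auto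
  also have "\<dots> = (\<Sum>\<alpha>\<in>multi_indices (insert q J) D. F \<alpha>)"
  proof (rule sum.reindex_bij_witness[where i="\<lambda>\<alpha>. (\<alpha> q, \<alpha>(q := undefined))" and j="\<lambda>(k, \<alpha>). \<alpha>(q := k)"], goal_cases)
    case (1 a)
    then show ?case using J by (auto simp: multi_indices_def PiE_iff extensional_def fun_eq_iff)
  next
    case (2 a)
    obtain k \<alpha> where a: "a = (k, \<alpha>)" by (cases a)
    have "\<alpha> \<in> extensional J" "(\<Sum>p\<in>J. \<alpha> p) \<le> D - k" "k \<le> D"
      using 2 by (auto simp: a multi_indices_def PiE_iff)
    then show ?case
      using J cong[of \<alpha> k] by (simp add: a multi_indices_def PiE_iff extensional_def)
  next
    case (4 \<alpha>)
    then have "\<alpha> \<in> extensional (insert q J)" "\<alpha> q + (\<Sum>p\<in>J. \<alpha> p) \<le> D"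
      using J by (auto simp: multi_indices_def PiE_iff)
    then show ?case
      using J cong[of \<alpha> undefined] by (simp add: multi_indices_def PiE_iff extensional_def)
  qed (auto split: prod.splits)
  finally show ?thesis by simp
qed

text \<open>Truncating a product of exponential series by total degree, rather than in each
  variable, yields the truncated exponential of the sum. The induction splits off one variable and
  regroups the triangle \<open>k + e \<le> D\<close> by total degree, where the binomial theorem
  applies.\<close>

lemma multinomial_sum:
  fixes w :: "'i \<Rightarrow> real"
  assumes "finite J"
  shows "(\<Sum>\<alpha>\<in>multi_indices J D. \<Prod>p\<in>J. w p ^ \<alpha> p / fact (\<alpha> p)) = (\<Sum>d\<le>D. (\<Sum>p\<in>J. w p) ^ d / fact d)"
  using assms
proof (induction J arbitrary: D rule: finite_induct)
  case empty
  have "multi_indices ({} :: 'i set) D = {\<lambda>_. undefined}" by (auto simp: multi_indices_def)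
  moreover have "(\<Sum>d\<le>D. 0 ^ d / fact d) = (\<Sum>d\<in>{0}. 0 ^ d / fact d :: real)"
    by (intro sum.mono_neutral_right) (auto simp: power_0_left)
  ultimately show ?case by simp
next
  case (insert q J)
  let ?S = "\<Sum>p\<in>J. w p"
  have cong: "(\<Prod>p\<in>J. w p ^ ((\<alpha>(q := k)) p) / fact ((\<alpha>(q := k)) p)) = (\<Prod>p\<in>J. w p ^ \<alpha> p / fact (\<alpha> p))" for \<alpha> k
    using insert.hyps by (intro prod.cong) auto
  have "(\<Sum>\<alpha>\<in>multi_indices (insert q J) D. \<Prod>p\<in>insert q J. w p ^ \<alpha> p / fact (\<alpha> p)) =
      (\<Sum>k\<le>D. \<Sum>\<alpha>\<in>multi_indices J (D - k). w q ^ k / fact k * (\<Prod>p\<in>J. w p ^ \<alpha> p / fact (\<alpha> p)))"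
  proof (subst multi_indices_insert_sum[OF insert.hyps], rule sum.cong[OF refl], rule sum.cong[OF refl])
    fix k \<alpha>
    show "(\<Prod>p\<in>insert q J. w p ^ (\<alpha>(q := k)) p / fact ((\<alpha>(q := k)) p)) =
        w q ^ k / fact k * (\<Prod>p\<in>J. w p ^ \<alpha> p / fact (\<alpha> p))"
      unfolding prod.insert[OF insert.hyps] cong by simp
  qed
  also have "\<dots> = (\<Sum>k\<le>D. \<Sum>e\<le>D - k. w q ^ k / fact k * (?S ^ e / fact e))"
  proof (rule sum.cong[OF refl])
    fix k
    have "(\<Sum>\<alpha>\<in>multi_indices J (D - k). w q ^ k / fact k * (\<Prod>p\<in>J. w p ^ \<alpha> p / fact (\<alpha> p))) =
        w q ^ k / fact k * (\<Sum>\<alpha>\<in>multi_indices J (D - k). \<Prod>p\<in>J. w p ^ \<alpha> p / fact (\<alpha> p))"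
      by (rule sum_distrib_left[symmetric])
    also have "\<dots> = w q ^ k / fact k * (\<Sum>e\<le>D - k. ?S ^ e / fact e)"
      unfolding insert.IH ..
    also have "\<dots> = (\<Sum>e\<le>D - k. w q ^ k / fact k * (?S ^ e / fact e))"
      by (rule sum_distrib_left)
    finally show "(\<Sum>\<alpha>\<in>multi_indices J (D - k). w q ^ k / fact k * (\<Prod>p\<in>J. w p ^ \<alpha> p / fact (\<alpha> p))) =
        (\<Sum>e\<le>D - k. w q ^ k / fact k * (?S ^ e / fact e))" .
  qed
  also have "\<dots> = (\<Sum>(k, e)\<in>(SIGMA k:{..D}. {..D - k}). w q ^ k / fact k * (?S ^ e / fact e))"
    by (intro sum.Sigma) auto
  also have "(SIGMA k:{..D}. {..D - k}) = {(k, e). k + e \<le> D}" by auto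
  also have "(\<Sum>(k, e)\<in>{(k, e). k + e \<le> D}. w q ^ k / fact k * (?S ^ e / fact e)) =
      (\<Sum>d\<le>D. \<Sum>k\<le>d. w q ^ k / fact k * (?S ^ (d - k) / fact (d - k)))"
    by (rule sum.triangle_reindex_eq)
  also have "\<dots> = (\<Sum>d\<le>D. (w q + ?S) ^ d / fact d)"
  proof (rule sum.cong[OF refl])
    fix d
    show "(\<Sum>k\<le>d. w q ^ k / fact k * (?S ^ (d - k) / fact (d - k))) = (w q + ?S) ^ d / fact d"
      using exp_series_add_commuting[OF mult.commute[of "w q" ?S], of d]
      by (simp add: divide_inverse mult_ac)
  qed
  finally show ?case unfolding sum.insert[OF insert.hyps] .
qed

subsection \<open>Moments of quadratic forms in independent variables\<close>

definition pair_form :: "('i \<times> 'i) set \<Rightarrow> ('i \<times> 'i \<Rightarrow> real) \<Rightarrow> ('i \<Rightarrow> real) \<Rightarrow> real" where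
  "pair_form J c z = (\<Sum>p\<in>J. c p * (z (fst p) * z (snd p)))"

text \<open>The exponent of \<open>z i\<close> in the monomial picked out by a word \<open>f\<close>
  of \<open>d\<close> pairs; a diagonal pair counts twice.\<close>

definition occurrences :: "nat \<Rightarrow> (nat \<Rightarrow> 'i \<times> 'i) \<Rightarrow> 'i \<Rightarrow> nat" where
  "occurrences d f i = (\<Sum>k<d. of_bool (fst (f k) = i) + of_bool (snd (f k) = i))"

lemma pair_form_power:
  assumes I: "finite I" and J: "J \<subseteq> I \<times> I"
  shows "pair_form J c z ^ d =
    (\<Sum>f\<in>{..<d} \<rightarrow>\<^sub>E J. (\<Prod>k<d. c (f k)) * (\<Prod>i\<in>I. z i ^ occurrences d f i))"
proof -
  have finJ: "finite J" using I J finite_subset by blast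
  have single: "(\<Prod>i\<in>I. z i ^ of_bool (a = i)) = z a" if "a \<in> I" for a
  proof -
    have "(\<Prod>i\<in>I. z i ^ of_bool (a = i)) = (\<Prod>i\<in>I. if a = i then z i else 1)"
      by (intro prod.cong) auto
    then show ?thesis using I that by simp
  qed
  have "pair_form J c z ^ d = (\<Prod>k\<in>{..<d}. \<Sum>p\<in>J. c p * (z (fst p) * z (snd p)))"
    by (simp add: pair_form_def)
  also have "\<dots> = (\<Sum>f\<in>{..<d} \<rightarrow>\<^sub>E J. \<Prod>k\<in>{..<d}. c (f k) * (z (fst (f k)) * z (snd (f k))))"
    using finJ by (intro prod_sum_PiE) auto
  also have "\<dots> = (\<Sum>f\<in>{..<d} \<rightarrow>\<^sub>E J. (\<Prod>k<d. c (f k)) * (\<Prod>i\<in>I. z i ^ occurrences d f i))"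
  proof (rule sum.cong[OF refl])
    fix f assume f: "f \<in> {..<d} \<rightarrow>\<^sub>E J"
    have "(\<Prod>k<d. z (fst (f k)) * z (snd (f k))) =
        (\<Prod>k<d. \<Prod>i\<in>I. z i ^ (of_bool (fst (f k) = i) + of_bool (snd (f k) = i)))"
    proof (rule prod.cong[OF refl])
      fix k assume "k \<in> {..<d}"
      then have "fst (f k) \<in> I" "snd (f k) \<in> I" using f J by (auto simp: PiE_iff)
      then show "z (fst (f k)) * z (snd (f k)) = (\<Prod>i\<in>I. z i ^ (of_bool (fst (f k) = i) + of_bool (snd (f k) = i)))"
        by (simp add: power_add prod.distrib single)
    qed
    also have "\<dots> = (\<Prod>i\<in>I. z i ^ occurrences d f i)"
      unfolding occurrences_def power_sum by (rule prod.swap)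
    finally show "(\<Prod>k\<in>{..<d}. c (f k) * (z (fst (f k)) * z (snd (f k)))) =
        (\<Prod>k<d. c (f k)) * (\<Prod>i\<in>I. z i ^ occurrences d f i)"
      by (simp add: prod.distrib)
  qed
  finally show ?thesis .
qed

text \<open>The deterministic scales \<open>\<tau>\<close> serve twice: as one replica held fixed
  while the other is integrated, and as the standard deviations of a Gaussian mixture.\<close>

lemma pair_form_moment:
  fixes \<nu> :: "real measure" and \<tau> :: "'i \<Rightarrow> real"
  assumes I: "finite I" and J: "J \<subseteq> I \<times> I"
    and \<nu>: "prob_space \<nu>" and int: "\<And>k. integrable \<nu> (\<lambda>x. x ^ k)"
  shows "integrable (\<Pi>\<^sub>M i\<in>I. \<nu>) (\<lambda>x. pair_form J c (\<lambda>i. \<tau> i * x i) ^ d)"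
    and "(\<integral>x. pair_form J c (\<lambda>i. \<tau> i * x i) ^ d \<partial>(\<Pi>\<^sub>M i\<in>I. \<nu>)) =
      (\<Sum>f\<in>{..<d} \<rightarrow>\<^sub>E J. (\<Prod>k<d. c (f k)) *
        (\<Prod>i\<in>I. \<tau> i ^ occurrences d f i * (\<integral>x. x ^ occurrences d f i \<partial>\<nu>)))"
proof -
  interpret product_prob_space "\<lambda>_. \<nu>" by (rule product_prob_spaceI) (rule \<nu>)
  have prod: "integrable (\<Pi>\<^sub>M i\<in>I. \<nu>) (\<lambda>x. \<Prod>i\<in>I. \<tau> i ^ m i * x i ^ m i)" for m
    using I int by (intro product_integrable_prod[where f="\<lambda>i x. \<tau> i ^ m i * x ^ m i"]) auto
  have prod_eq: "(\<integral>x. (\<Prod>i\<in>I. \<tau> i ^ m i * x i ^ m i) \<partial>(\<Pi>\<^sub>M i\<in>I. \<nu>)) =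
      (\<Prod>i\<in>I. \<tau> i ^ m i * (\<integral>x. x ^ m i \<partial>\<nu>))" for m
    using I int by (subst product_integral_prod[where f="\<lambda>i x. \<tau> i ^ m i * x ^ m i"]) auto
  show "integrable (\<Pi>\<^sub>M i\<in>I. \<nu>) (\<lambda>x. pair_form J c (\<lambda>i. \<tau> i * x i) ^ d)"
    unfolding pair_form_power[OF I J] power_mult_distrib
    by (intro Bochner_Integration.integrable_sum integrable_mult_right prod)
  show "(\<integral>x. pair_form J c (\<lambda>i. \<tau> i * x i) ^ d \<partial>(\<Pi>\<^sub>M i\<in>I. \<nu>)) =
      (\<Sum>f\<in>{..<d} \<rightarrow>\<^sub>E J. (\<Prod>k<d. c (f k)) *
        (\<Prod>i\<in>I. \<tau> i ^ occurrences d f i * (\<integral>x. x ^ occurrences d f i \<partial>\<nu>)))"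
    unfolding pair_form_power[OF I J] power_mult_distrib
    by (subst Bochner_Integration.integral_sum)
       (simp_all only: integrable_mult_right prod integral_mult_right_zero prod_eq)
qed

definition replica_moment :: "real measure \<Rightarrow> 'i set \<Rightarrow> ('i \<times> 'i) set \<Rightarrow> ('i \<times> 'i \<Rightarrow> real) \<Rightarrow> nat \<Rightarrow> real" where
  "replica_moment \<nu> I J c d =
    (\<integral>x. (\<integral>x'. pair_form J c (\<lambda>i. x i * x' i) ^ d \<partial>(\<Pi>\<^sub>M i\<in>I. \<nu>)) \<partial>(\<Pi>\<^sub>M i\<in>I. \<nu>))"

text \<open>Each replica contributes the same moment of \<open>\<nu>\<close>, so every coordinate
  enters through a square, which is nonnegative at odd orders as well.\<close>

lemma replica_moment_eq:
  assumes I: "finite I" and J: "J \<subseteq> I \<times> I"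
    and \<nu>: "prob_space \<nu>" and int: "\<And>k. integrable \<nu> (\<lambda>x. x ^ k)"
  shows "integrable (\<Pi>\<^sub>M i\<in>I. \<nu>) (\<lambda>x. \<integral>x'. pair_form J c (\<lambda>i. x i * x' i) ^ d \<partial>(\<Pi>\<^sub>M i\<in>I. \<nu>))"
    and "replica_moment \<nu> I J c d =
      (\<Sum>f\<in>{..<d} \<rightarrow>\<^sub>E J. (\<Prod>k<d. c (f k)) * (\<Prod>i\<in>I. (\<integral>x. x ^ occurrences d f i \<partial>\<nu>)\<^sup>2))"
proof -
  interpret product_prob_space "\<lambda>_. \<nu>" by (rule product_prob_spaceI) (rule \<nu>)
  let ?m = "\<lambda>k. \<integral>x. x ^ k \<partial>\<nu>"
  have prod: "integrable (\<Pi>\<^sub>M i\<in>I. \<nu>) (\<lambda>x. \<Prod>i\<in>I. x i ^ m i * ?m (m i))" for m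
    using I int by (intro product_integrable_prod[where f="\<lambda>i x. x ^ m i * ?m (m i)"]) auto
  have prod_eq: "(\<integral>x. (\<Prod>i\<in>I. x i ^ m i * ?m (m i)) \<partial>(\<Pi>\<^sub>M i\<in>I. \<nu>)) = (\<Prod>i\<in>I. (?m (m i))\<^sup>2)" for m
    using I int
    by (subst product_integral_prod[where f="\<lambda>i x. x ^ m i * ?m (m i)"]) (auto simp: power2_eq_square)
  show "integrable (\<Pi>\<^sub>M i\<in>I. \<nu>) (\<lambda>x. \<integral>x'. pair_form J c (\<lambda>i. x i * x' i) ^ d \<partial>(\<Pi>\<^sub>M i\<in>I. \<nu>))"
    unfolding pair_form_moment(2)[OF I J \<nu> int]
    by (intro Bochner_Integration.integrable_sum integrable_mult_right prod)
  show "replica_moment \<nu> I J c d =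
      (\<Sum>f\<in>{..<d} \<rightarrow>\<^sub>E J. (\<Prod>k<d. c (f k)) * (\<Prod>i\<in>I. (\<integral>x. x ^ occurrences d f i \<partial>\<nu>)\<^sup>2))"
    unfolding replica_moment_def pair_form_moment(2)[OF I J \<nu> int]
    by (subst Bochner_Integration.integral_sum)
       (simp_all only: integrable_mult_right prod integral_mult_right_zero prod_eq)
qed

text \<open>Each squared moment is dominated by a moment of a mixture of centered Gaussians with standard
  deviations \<open>t \<in> T\<close> and weights \<open>w t\<close>; all coefficients are nonnegative, so domination is inherited
  by the moments of the form.\<close>

lemma replica_moment_le_gaussian_mixture:
  assumes I: "finite I" and J: "J \<subseteq> I \<times> I" and c: "\<And>p. p \<in> J \<Longrightarrow> 0 \<le> c p"
    and \<nu>: "prob_space \<nu>" and int: "\<And>k. integrable \<nu> (\<lambda>x. x ^ k)"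
    and T: "finite T"
    and dom: "\<And>k. (\<integral>x. x ^ k \<partial>\<nu>)\<^sup>2 \<le> (\<Sum>t\<in>T. w t * t ^ k) * (\<integral>g. g ^ k \<partial>std_gauss)"
  shows "replica_moment \<nu> I J c d \<le> (\<Sum>\<tau>\<in>I \<rightarrow>\<^sub>E T. (\<Prod>i\<in>I. w (\<tau> i)) *
    (\<integral>g. pair_form J c (\<lambda>i. \<tau> i * g i) ^ d \<partial>(\<Pi>\<^sub>M i\<in>I. std_gauss)))"
proof -
  let ?m = "\<lambda>k. \<integral>x. x ^ k \<partial>std_gauss" and ?o = "occurrences d"
  have "replica_moment \<nu> I J c d \<le>
      (\<Sum>f\<in>{..<d} \<rightarrow>\<^sub>E J. (\<Prod>k<d. c (f k)) * (\<Prod>i\<in>I. (\<Sum>t\<in>T. w t * t ^ ?o f i) * ?m (?o f i)))"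
    unfolding replica_moment_eq(2)[OF I J \<nu> int]
    by (intro sum_mono mult_left_mono prod_mono conjI dom zero_le_power2 prod_nonneg c) (auto simp: PiE_iff)
  also have "\<dots> = (\<Sum>f\<in>{..<d} \<rightarrow>\<^sub>E J. \<Sum>\<tau>\<in>I \<rightarrow>\<^sub>E T. (\<Prod>i\<in>I. w (\<tau> i)) * 
      ((\<Prod>k<d. c (f k)) * (\<Prod>i\<in>I. \<tau> i ^ ?o f i * ?m (?o f i))))"
  proof (rule sum.cong[OF refl])
    fix f
    have "(\<Prod>i\<in>I. (\<Sum>t\<in>T. w t * t ^ ?o f i) * ?m (?o f i)) =
        (\<Prod>i\<in>I. \<Sum>t\<in>T. w t * (t ^ ?o f i * ?m (?o f i)))"
      by (simp add: sum_distrib_right mult.assoc)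
    also have "\<dots> = (\<Sum>\<tau>\<in>I \<rightarrow>\<^sub>E T. \<Prod>i\<in>I. w (\<tau> i) * (\<tau> i ^ ?o f i * ?m (?o f i)))"
      using I T by (intro prod_sum_PiE) auto
    finally show "(\<Prod>k<d. c (f k)) * (\<Prod>i\<in>I. (\<Sum>t\<in>T. w t * t ^ ?o f i) * ?m (?o f i)) =
        (\<Sum>\<tau>\<in>I \<rightarrow>\<^sub>E T. (\<Prod>i\<in>I. w (\<tau> i)) * 
          ((\<Prod>k<d. c (f k)) * (\<Prod>i\<in>I. \<tau> i ^ ?o f i * ?m (?o f i))))"
      by (simp add: prod.distrib sum_distrib_left mult.left_commute)
  qed
  also have "\<dots> = (\<Sum>\<tau>\<in>I \<rightarrow>\<^sub>E T. (\<Prod>i\<in>I. w (\<tau> i)) *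
      (\<integral>g. pair_form J c (\<lambda>i. \<tau> i * g i) ^ d \<partial>(\<Pi>\<^sub>M i\<in>I. std_gauss)))"
    unfolding pair_form_moment(2)[OF I J prob_space_std_gauss integrable_std_gauss_power]
    by (subst sum.swap) (simp only: sum_distrib_left)
  finally show ?thesis .
qed

text \<open>The series of \<open>exp\<close> truncated at \<open>D\<close> is bounded at
  \<open>w\<close> by \<open>(1 / r) ^ D * exp \<bar>r * w\<bar>\<close>. A small \<open>r\<close>
  thus handles a matrix beyond the threshold at a cost exponential in \<open>D\<close>, while
  \<open>r = 1\<close> costs nothing.\<close>

lemma gauss_exp_partial_sum_le:
  fixes A :: "'i \<Rightarrow> 'i \<Rightarrow> real" and h s :: "'i \<Rightarrow> real" and \<delta> U r :: real
  assumes I: "finite I"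
    and sym: "\<And>i j. i \<in> I \<Longrightarrow> j \<in> I \<Longrightarrow> A i j = A j i"
    and nonneg: "\<And>i j. i \<in> I \<Longrightarrow> j \<in> I \<Longrightarrow> 0 \<le> A i j"
    and r: "0 < r" "r \<le> 1"
    and super: "\<And>i. i \<in> I \<Longrightarrow> r * (\<Sum>j\<in>I. A i j * h j) + s i \<le> h i"
    and entry: "\<And>i j. i \<in> I \<Longrightarrow> j \<in> I \<Longrightarrow> r * A i j \<le> \<delta> * s i"
    and s: "\<And>i. i \<in> I \<Longrightarrow> 0 \<le> s i" and h: "\<And>i. i \<in> I \<Longrightarrow> 0 \<le> h i" "\<And>i. i \<in> I \<Longrightarrow> h i \<le> U"
    and \<delta>: "\<delta> \<ge> 0" and U: "U \<ge> 0" "\<delta> * U \<le> 1 / 2"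
    and int: "\<And>d. integrable (\<Pi>\<^sub>M i\<in>I. std_gauss) (\<lambda>g. (quad_form I A g / 2) ^ d)"
  shows "(\<Sum>d\<le>D. (\<integral>g. (quad_form I A g / 2) ^ d \<partial>(\<Pi>\<^sub>M i\<in>I. std_gauss)) / fact d)
    \<le> (1 / r) ^ D * (2 * exp (card I * (\<delta> * U)))"
proof -
  let ?M = "\<Pi>\<^sub>M i\<in>I. std_gauss" and ?q = "\<lambda>g. quad_form I A g / 2"
  let ?e = "exp (card I * (\<delta> * U))"
  have quad_scale: "quad_form I (\<lambda>i j. a * A i j) g = a * quad_form I A g" for a g
    by (simp add: quad_form_def sum_distrib_left mult.assoc)
  \<comment> \<open>Both signs of \<open>a\<close> are needed because
    \<open>exp \<bar>w\<bar>\<close> is split as \<open>exp w + exp (- w)\<close>. The elimination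
    bound is phrased with absolute values of the entries, so one certificate \<open>h\<close> serves
    both, which gives the factor 2.\<close>
  have bound: "(\<integral>\<^sup>+g. ennreal (exp (a * ?q g)) \<partial>?M) \<le> ennreal ?e" if "\<bar>a\<bar> = r" for a
  proof -
    have A: "\<bar>a * A i j\<bar> = r * A i j" if "i \<in> I" "j \<in> I" for i j
      using nonneg[OF that] \<open>\<bar>a\<bar> = r\<close> by (simp add: abs_mult)
    have "(\<integral>\<^sup>+g. ennreal (exp (quad_form I (\<lambda>i j. a * A i j) g / 2)) \<partial>?M) \<le> ennreal ?e"
    proof (rule nn_integral_gauss_exp_quad_form[where s=s and h=h])
      fix i assume i: "i \<in> I"
      have "(\<Sum>j\<in>I. \<bar>a * A i j\<bar> * h j) = r * (\<Sum>j\<in>I. A i j * h j)"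
        unfolding sum_distrib_left using A i by (intro sum.cong) auto
      then show "(\<Sum>j\<in>I. \<bar>a * A i j\<bar> * h j) + s i \<le> h i" using super[OF i] by simp
    qed (use A assms in auto)
    then show ?thesis by (simp add: quad_scale)
  qed
  have pt: "\<bar>\<Sum>d\<le>D. ?q g ^ d / fact d\<bar> \<le> (1 / r) ^ D * (exp (r * ?q g) + exp (- r * ?q g))" for g
  proof -
    have "\<bar>\<Sum>d\<le>D. ?q g ^ d / fact d\<bar> \<le> (\<Sum>d\<le>D. (1 / r) ^ D * (\<bar>r * ?q g\<bar> ^ d / fact d))"
    proof (rule order_trans[OF sum_abs], rule sum_mono)
      fix d assume "d \<in> {..D}"
      then have "(1 / r) ^ d \<le> (1 / r) ^ D" using r by (intro power_increasing) auto
      then have "(1 / r) ^ d * (\<bar>r * ?q g\<bar> ^ d / fact d) \<le> (1 / r) ^ D * (\<bar>r * ?q g\<bar> ^ d / fact d)"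
        by (intro mult_right_mono) auto
      moreover have "(1 / r) ^ d * (\<bar>r * ?q g\<bar> ^ d / fact d) = \<bar>?q g ^ d / fact d\<bar>"
        using r by (simp add: abs_mult power_abs power_mult_distrib power_divide)
      ultimately show "\<bar>?q g ^ d / fact d\<bar> \<le> (1 / r) ^ D * (\<bar>r * ?q g\<bar> ^ d / fact d)" by simp
    qed
    also have "\<dots> = (1 / r) ^ D * (\<Sum>d\<le>D. \<bar>r * ?q g\<bar> ^ d / fact d)" by (simp add: sum_distrib_left)
    also have "\<dots> \<le> (1 / r) ^ D * exp \<bar>r * ?q g\<bar>"
    proof (rule mult_left_mono)
      have "(\<Sum>d\<le>D. \<bar>r * ?q g\<bar> ^ d / fact d) = (\<Sum>d<Suc D. \<bar>r * ?q g\<bar> ^ d /\<^sub>R fact d)"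
        unfolding lessThan_Suc_atMost by (intro sum.cong refl) (simp add: field_simps)
      also have "\<dots> \<le> exp \<bar>r * ?q g\<bar>"
        unfolding exp_def using summable_exp_generic[of "\<bar>r * ?q g\<bar>"]
        by (intro sum_le_suminf) auto
      finally show "(\<Sum>d\<le>D. \<bar>r * ?q g\<bar> ^ d / fact d) \<le> exp \<bar>r * ?q g\<bar>" .
    qed (use r in auto)
    also have "\<dots> \<le> (1 / r) ^ D * (exp (r * ?q g) + exp (- r * ?q g))"
      using r by (intro mult_left_mono) (auto simp: abs_if)
    finally show ?thesis .
  qed
  have meas: "(\<lambda>g. ?q g) \<in> borel_measurable ?M" unfolding quad_form_def by measurable
  note [measurable] = meas
  let ?S = "\<lambda>g. \<Sum>d\<le>D. ?q g ^ d / fact d"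
  have intS: "integrable ?M ?S"
    by (intro Bochner_Integration.integrable_sum integrable_divide int)
  have "(\<Sum>d\<le>D. (\<integral>g. ?q g ^ d \<partial>?M) / fact d) = (\<integral>g. ?S g \<partial>?M)"
    by (subst Bochner_Integration.integral_sum) (simp_all only: integrable_divide int integral_divide_zero)
  also have "\<dots> \<le> (\<integral>g. \<bar>?S g\<bar> \<partial>?M)" by (rule order_trans[OF abs_ge_self integral_abs_bound])
  also have "\<dots> \<le> (1 / r) ^ D * (2 * ?e)"
  proof -
    have "ennreal (\<integral>g. \<bar>?S g\<bar> \<partial>?M) = (\<integral>\<^sup>+g. ennreal \<bar>?S g\<bar> \<partial>?M)"
      using intS by (intro nn_integral_eq_integral[symmetric]) auto
    also have "\<dots> \<le> (\<integral>\<^sup>+g. ennreal ((1 / r) ^ D) * (ennreal (exp (r * ?q g)) + ennreal (exp (- r * ?q g))) \<partial>?M)"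
      using pt r by (intro nn_integral_mono) (simp add: ennreal_mult'[symmetric] ennreal_plus[symmetric] del: ennreal_plus)
    also have "\<dots> = ennreal ((1 / r) ^ D) * ((\<integral>\<^sup>+g. ennreal (exp (r * ?q g)) \<partial>?M) + (\<integral>\<^sup>+g. ennreal (exp (- r * ?q g)) \<partial>?M))"
      by (subst nn_integral_cmult, measurable, subst nn_integral_add, measurable)
    also have "\<dots> \<le> ennreal ((1 / r) ^ D) * (ennreal ?e + ennreal ?e)"
      using r by (intro mult_left_mono add_mono bound) auto
    also have "\<dots> = ennreal ((1 / r) ^ D * (2 * ?e))"
      using r by (simp add: ennreal_mult'[symmetric] ennreal_plus[symmetric] del: ennreal_plus)
    finally show ?thesis by (rule ennreal_le_iff[THEN iffD1, rotated]) (use r in auto)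
  qed
  finally show ?thesis .
qed

text \<open>The symmetric matrix whose quadratic form is twice \<open>pair_form\<close>; a diagonal
  pair in \<open>J\<close> enters with both summands.\<close>

definition sym_coeff :: "('i \<times> 'i) set \<Rightarrow> ('i \<times> 'i \<Rightarrow> real) \<Rightarrow> 'i \<Rightarrow> 'i \<Rightarrow> real" where
  "sym_coeff J c i j = (if (i, j) \<in> J then c (i, j) else 0) + (if (j, i) \<in> J then c (j, i) else 0)"

lemma pair_form_eq_quad_form:
  assumes I: "finite I" and J: "J \<subseteq> I \<times> I"
  shows "pair_form J c (\<lambda>i. \<tau> i * z i) = quad_form I (\<lambda>i j. \<tau> i * \<tau> j * sym_coeff J c i j) z / 2"
proof -
  let ?c = "\<lambda>i j. if (i, j) \<in> J then c (i, j) else 0"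
  let ?z = "\<lambda>i. \<tau> i * z i"
  have "pair_form J c ?z = (\<Sum>p\<in>I \<times> I. (if p \<in> J then c p else 0) * (?z (fst p) * ?z (snd p)))"
    unfolding pair_form_def using I J by (intro sum.mono_neutral_cong_left) auto
  also have "\<dots> = (\<Sum>i\<in>I. \<Sum>j\<in>I. ?c i j * (?z i * ?z j))"
    unfolding sum.cartesian_product by (intro sum.cong refl) auto
  finally have 1: "pair_form J c ?z = (\<Sum>i\<in>I. \<Sum>j\<in>I. ?c i j * (?z i * ?z j))" .
  then have "pair_form J c ?z = (\<Sum>i\<in>I. \<Sum>j\<in>I. ?c j i * (?z i * ?z j))"
    by (subst (asm) sum.swap) (simp add: mult.commute[of "?z _" "?z _"])
  with 1 have "2 * pair_form J c ?z = (\<Sum>i\<in>I. \<Sum>j\<in>I. ?c i j * (?z i * ?z j) + ?c j i * (?z i * ?z j))"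
    by (simp only: sum.distrib)
  also have "\<dots> = quad_form I (\<lambda>i j. \<tau> i * \<tau> j * sym_coeff J c i j) z"
    unfolding quad_form_def sym_coeff_def by (intro sum.cong refl) (simp add: algebra_simps)
  finally show ?thesis by simp
qed

subsection \<open>Truncated exponential moments of the replica overlap\<close>

text \<open>The moment generating function of a linear form in independent variables equal to
  \<open>sqrt K\<close> with probability \<open>1 / K\<close> and to 0 otherwise. On
  \<open>0 \<le> x \<le> \<theta> \<le> 1\<close> one has
  \<open>exp x \<le> 1 + (1 + \<theta>) * x\<close>, so the exponent exceeds the mean by a factor of
  at most \<open>1 + \<theta>\<close>.\<close>

lemma sum_two_point_weights_exp_le:
  fixes l :: "'i \<Rightarrow> real"
  assumes I: "finite I" and K: "K \<ge> 1" and \<theta>: "\<theta> \<le> 1"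
    and l: "\<And>j. j \<in> I \<Longrightarrow> 0 \<le> l j" "\<And>j. j \<in> I \<Longrightarrow> l j * sqrt K \<le> \<theta>"
    and w: "w 0 = 1 - 1 / K" "w (sqrt K) = 1 / K"
  shows "(\<Sum>\<tau>\<in>I \<rightarrow>\<^sub>E {0, sqrt K}. (\<Prod>j\<in>I. w (\<tau> j)) * exp (\<Sum>j\<in>I. l j * \<tau> j))
    \<le> exp ((1 + \<theta>) / K * (\<Sum>j\<in>I. l j * sqrt K))"
proof -
  have "(\<Sum>\<tau>\<in>I \<rightarrow>\<^sub>E {0, sqrt K}. (\<Prod>j\<in>I. w (\<tau> j)) * exp (\<Sum>j\<in>I. l j * \<tau> j)) =
      (\<Sum>\<tau>\<in>I \<rightarrow>\<^sub>E {0, sqrt K}. \<Prod>j\<in>I. w (\<tau> j) * exp (l j * \<tau> j))"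
    using I by (simp add: exp_sum prod.distrib)
  also have "\<dots> = (\<Prod>j\<in>I. \<Sum>t\<in>{0, sqrt K}. w t * exp (l j * t))"
    by (rule prod_sum_PiE[where f="\<lambda>j t. w t * exp (l j * t)", symmetric]) (simp_all add: I)
  also have "\<dots> \<le> (\<Prod>j\<in>I. exp ((1 + \<theta>) / K * (l j * sqrt K)))"
  proof (rule prod_mono)
    fix j assume j: "j \<in> I"
    define x where "x = l j * sqrt K"
    have x: "0 \<le> x" "x \<le> \<theta>" using l[OF j] K by (auto simp: x_def)
    have "exp x \<le> 1 + x + x\<^sup>2" using x \<theta> by (intro exp_bound) auto
    moreover have "x\<^sup>2 \<le> \<theta> * x" using x by (simp add: power2_eq_square mult_right_mono)
    ultimately have "1 / K * exp x \<le> 1 / K * (1 + (1 + \<theta>) * x)"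
      using K by (intro mult_left_mono) (auto simp: algebra_simps)
    then have "1 - 1 / K + 1 / K * exp x \<le> 1 + (1 + \<theta>) / K * x"
      by (simp add: algebra_simps add_divide_distrib)
    also have "\<dots> \<le> exp ((1 + \<theta>) / K * x)" by (rule exp_ge_add_one_self)
    finally have le: "1 - 1 / K + 1 / K * exp x \<le> exp ((1 + \<theta>) / K * x)" .
    have eq: "(\<Sum>t\<in>{0, sqrt K}. w t * exp (l j * t)) = 1 - 1 / K + 1 / K * exp x"
      using K w by (simp add: x_def)
    show "0 \<le> (\<Sum>t\<in>{0, sqrt K}. w t * exp (l j * t)) \<and>
        (\<Sum>t\<in>{0, sqrt K}. w t * exp (l j * t)) \<le> exp ((1 + \<theta>) / K * (l j * sqrt K))"
      unfolding eq using le K by (simp add: x_def)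
  qed
  also have "\<dots> = exp ((1 + \<theta>) / K * (\<Sum>j\<in>I. l j * sqrt K))"
    using I by (simp add: exp_sum sum_distrib_left)
  finally show ?thesis .
qed

section \<open>Partial sums for a fixed coefficient matrix below the threshold\<close>

context
  fixes n :: nat and J :: "(nat \<times> nat) set" and c :: "nat \<times> nat \<Rightarrow> real" and \<nu> :: "real measure"
    and A :: "nat \<Rightarrow> nat \<Rightarrow> real" and C \<epsilon> U :: real
  defines "A \<equiv> sym_coeff J c" and "U \<equiv> 1 + C / \<epsilon>"
  assumes n: "n > 0" and J: "J \<subseteq> {..<n} \<times> {..<n}" and c: "\<And>p. p \<in> J \<Longrightarrow> 0 \<le> c p"
    and upper: "\<And>i j. i < n \<Longrightarrow> j < n \<Longrightarrow> A i j \<le> C / n"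
    and form: "\<And>x. quad_form {..<n} A x \<le> (1 - \<epsilon>) * (\<Sum>i<n. (x i)\<^sup>2)"
    and C: "C > 0" and \<epsilon>: "\<epsilon> > 0"
    and \<nu>: "prob_space \<nu>" and int: "\<And>k. integrable \<nu> (\<lambda>x. x ^ k)"
begin

private lemma U_ge_1: "U \<ge> 1"
  using C \<epsilon> by (simp add: U_def)

private lemma A_nonneg: "0 \<le> A i j"
  using c by (auto simp: A_def sym_coeff_def)

private lemma A_sym: "A i j = A j i"
  by (simp add: A_def sym_coeff_def)

definition gauss_partial_sum :: "nat \<Rightarrow> (nat \<Rightarrow> real) \<Rightarrow> real" where
  "gauss_partial_sum D \<tau> =
    (\<Sum>d\<le>D. (\<integral>g. pair_form J c (\<lambda>i. \<tau> i * g i) ^ d \<partial>(\<Pi>\<^sub>M i\<in>{..<n}. std_gauss)) / fact d)"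

text \<open>The scales are absorbed into the matrix \<open>\<tau> i * \<tau> j * A i j\<close>. The
  parameter \<open>r\<close> is 1 where a certificate for the scaled matrix is at hand, and small
  for an arbitrary mask.\<close>

lemma gauss_partial_sum_le:
  fixes h :: "nat \<Rightarrow> real" and r s \<delta> V :: real
  assumes \<tau>: "\<And>i. i < n \<Longrightarrow> 0 \<le> \<tau> i" and r: "0 < r" "r \<le> 1"
    and super: "\<And>i. i < n \<Longrightarrow> r * (\<tau> i * (\<Sum>j<n. A i j * \<tau> j * h j)) + s \<le> h i"
    and entry: "\<And>i j. i < n \<Longrightarrow> j < n \<Longrightarrow> r * (\<tau> i * \<tau> j * A i j) \<le> \<delta> * s"
    and s: "0 \<le> s" and h: "\<And>i. i < n \<Longrightarrow> 0 \<le> h i" "\<And>i. i < n \<Longrightarrow> h i \<le> V"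
    and \<delta>: "\<delta> \<ge> 0" and V: "V \<ge> 0" "\<delta> * V \<le> 1 / 2"
  shows "gauss_partial_sum D \<tau> \<le> (1 / r) ^ D * (2 * exp (n * (\<delta> * V)))"
proof -
  let ?A = "\<lambda>i j. \<tau> i * \<tau> j * A i j"
  have eq: "pair_form J c (\<lambda>i. \<tau> i * g i) = quad_form {..<n} ?A g / 2" for g
    unfolding A_def by (rule pair_form_eq_quad_form) (use J in auto)
  have "(\<Sum>d\<le>D. (\<integral>g. (quad_form {..<n} ?A g / 2) ^ d \<partial>(\<Pi>\<^sub>M i\<in>{..<n}. std_gauss)) / fact d)
    \<le> (1 / r) ^ D * (2 * exp (card {..<n} * (\<delta> * V)))"
  proof (rule gauss_exp_partial_sum_le[where h=h and s="\<lambda>_. s"])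
    fix i assume i: "i \<in> {..<n}"
    have "(\<Sum>j<n. ?A i j * h j) = \<tau> i * (\<Sum>j<n. A i j * \<tau> j * h j)"
      by (simp add: sum_distrib_left mult_ac)
    then show "r * (\<Sum>j<n. ?A i j * h j) + s \<le> h i" using super[of i] i by simp
  next
    fix d
    show "integrable (\<Pi>\<^sub>M i\<in>{..<n}. std_gauss) (\<lambda>g. (quad_form {..<n} ?A g / 2) ^ d)"
      using pair_form_moment(1)[OF _ J prob_space_std_gauss integrable_std_gauss_power, of c \<tau> d]
      by (simp add: eq)
  qed (use assms A_nonneg A_sym in \<open>auto simp: mult.commute\<close>)
  then show ?thesis unfolding gauss_partial_sum_def eq by simp
qed

lemma replica_partial_sum_le_mixture:
  assumes T: "finite T"
    and dom: "\<And>k. (\<integral>x. x ^ k \<partial>\<nu>)\<^sup>2 \<le> (\<Sum>t\<in>T. w t * t ^ k) * (\<integral>g. g ^ k \<partial>std_gauss)"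
  shows "(\<Sum>d\<le>D. replica_moment \<nu> {..<n} J c d / fact d) \<le>
    (\<Sum>\<tau>\<in>{..<n} \<rightarrow>\<^sub>E T. (\<Prod>i<n. w (\<tau> i)) * gauss_partial_sum D \<tau>)"
proof -
  let ?E = "\<lambda>\<tau> d. \<integral>g. pair_form J c (\<lambda>i. \<tau> i * g i) ^ d \<partial>(\<Pi>\<^sub>M i\<in>{..<n}. std_gauss)"
  have "(\<Sum>d\<le>D. replica_moment \<nu> {..<n} J c d / fact d) \<le>
      (\<Sum>d\<le>D. (\<Sum>\<tau>\<in>{..<n} \<rightarrow>\<^sub>E T. (\<Prod>i<n. w (\<tau> i)) * ?E \<tau> d) / fact d)"
    by (intro sum_mono divide_right_mono replica_moment_le_gaussian_mixture J c \<nu> int T dom) auto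
  also have "\<dots> = (\<Sum>d\<le>D. \<Sum>\<tau>\<in>{..<n} \<rightarrow>\<^sub>E T. (\<Prod>i<n. w (\<tau> i)) * (?E \<tau> d / fact d))"
    by (simp add: sum_divide_distrib)
  also have "\<dots> = (\<Sum>\<tau>\<in>{..<n} \<rightarrow>\<^sub>E T. \<Sum>d\<le>D. (\<Prod>i<n. w (\<tau> i)) * (?E \<tau> d / fact d))"
    by (rule sum.swap)
  finally show ?thesis by (simp add: gauss_partial_sum_def sum_distrib_left)
qed

private lemma certificate:
  "\<exists>h. \<forall>i<n. h i = 1 + (\<Sum>j<n. A i j * h j) \<and> 1 \<le> h i \<and> h i \<le> U"
proof (rule resolvent_vector[of n A C \<epsilon>])
  fix h assume "\<And>i. i < n \<Longrightarrow> h i = 1 + (\<Sum>j<n. A i j * h j)"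
    "\<And>i. i < n \<Longrightarrow> 1 \<le> h i" "\<And>i. i < n \<Longrightarrow> h i \<le> 1 + C / \<epsilon>"
  then show ?thesis unfolding U_def by (intro exI[of _ h] allI impI conjI)
qed (use A_nonneg upper form \<epsilon> C in auto)

text \<open>One Gaussian of scale 1 dominates, so the resolvent vector is used with
  \<open>r = 1\<close>, \<open>s = 1\<close> and \<open>\<delta> = C / n\<close>: the
  \<open>n\<close> pivots cost \<open>exp (C * U)\<close> altogether, uniformly in
  \<open>D\<close>.\<close>

lemma replica_partial_sum_le_moment_subgaussian:
  assumes dom: "\<And>k. (\<integral>x. x ^ k \<partial>\<nu>)\<^sup>2 \<le> (\<integral>g. g ^ k \<partial>std_gauss)"
    and large: "2 * C * U \<le> n"
  shows "(\<Sum>d\<le>D. replica_moment \<nu> {..<n} J c d / fact d) \<le> 2 * exp (C * U)"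
proof -
  obtain h where H: "\<forall>i<n. h i = 1 + (\<Sum>j<n. A i j * h j) \<and> 1 \<le> h i \<and> h i \<le> U"
    using certificate by (elim exE)
  have h: "h i = 1 + (\<Sum>j<n. A i j * h j)" "1 \<le> h i" "h i \<le> U" if "i < n" for i
    by (rule H[rule_format, OF that, THEN conjunct1],
        rule H[rule_format, OF that, THEN conjunct2, THEN conjunct1],
        rule H[rule_format, OF that, THEN conjunct2, THEN conjunct2])
  let ?one = "\<lambda>i\<in>{..<n}. 1 :: real"
  have "{..<n} \<rightarrow>\<^sub>E {1 :: real} = {?one}"
    using PiE_singleton[of ?one "{..<n}"] by (simp cong: PiE_cong)
  then have "(\<Sum>d\<le>D. replica_moment \<nu> {..<n} J c d / fact d) \<le> gauss_partial_sum D ?one"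
    using replica_partial_sum_le_mixture[of "{1}" "\<lambda>_. 1" D] dom by simp
  also have "\<dots> \<le> (1 / 1) ^ D * (2 * exp (n * ((C / n) * U)))"
  proof (rule gauss_partial_sum_le[where h=h and s=1])
    fix i assume i: "i < n"
    show "1 * (?one i * (\<Sum>j<n. A i j * ?one j * h j)) + 1 \<le> h i" using h(1)[OF i] i by simp
    show "0 \<le> h i" using h(2)[OF i] by simp
  next
    show "C / real n * U \<le> 1 / 2" using large n by (simp add: field_simps)
  qed (use upper h(3) U_ge_1 C in auto)
  finally show ?thesis using n by simp
qed

text \<open>The summands belong to typical and exceptional masks. The factor \<open>n\<close> is a
  union bound over rows, and \<open>4 * K * C + 1\<close> is the inverse of a scaling that brings
  every mask below the threshold.\<close>

lemma replica_partial_sum_le_subgaussian: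
  assumes K: "K \<ge> 1"
    and dom: "\<And>k. (\<integral>x. x ^ k \<partial>\<nu>)\<^sup>2 \<le> ((1 - 1 / K) * 0 ^ k + 1 / K * sqrt K ^ k) * (\<integral>g. g ^ k \<partial>std_gauss)"
    and large: "4 * K * C * U \<le> n"
  shows "(\<Sum>d\<le>D. replica_moment \<nu> {..<n} J c d / fact d) \<le>
    2 * exp (2 * K * C * U) + (4 * K * C + 1) ^ D * (2 * exp 1) * (n * exp (- (n / (16 * K * C * U\<^sup>2))))"
proof -
  obtain h where H: "\<forall>i<n. h i = 1 + (\<Sum>j<n. A i j * h j) \<and> 1 \<le> h i \<and> h i \<le> U"
    using certificate by (elim exE)
  have h: "h i = 1 + (\<Sum>j<n. A i j * h j)" "1 \<le> h i" "h i \<le> U" if "i < n" for i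
    by (rule H[rule_format, OF that, THEN conjunct1],
        rule H[rule_format, OF that, THEN conjunct2, THEN conjunct1],
        rule H[rule_format, OF that, THEN conjunct2, THEN conjunct2])
  let ?T = "{0, sqrt K}"
  define w where "w t = (if t = 0 then 1 - 1 / K else 1 / K)" for t :: real
  have K0: "K > 0" "sqrt K \<noteq> 0" using K by auto
  have sK: "sqrt K * sqrt K = K" using K0 by simp
  have w: "w 0 = 1 - 1 / K" "w (sqrt K) = 1 / K" using K0 by (auto simp: w_def)
  have w_nonneg: "0 \<le> w t" for t using K by (auto simp: w_def divide_le_eq)
  let ?W = "\<lambda>\<tau>. \<Prod>i<n. w (\<tau> i)"
  let ?\<Omega> = "{..<n} \<rightarrow>\<^sub>E ?T"
  let ?b = "\<lambda>\<tau> i. \<Sum>j<n. A i j * sqrt K * h j * \<tau> j"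
  let ?good = "2 * exp (2 * K * C * U)" and ?bad = "(4 * K * C + 1) ^ D * (2 * exp 1)"
  \<comment> \<open>Chosen so that each coefficient \<open>t * K * (A i j * h j)\<close> is at most
    \<open>1 / (4 * U)\<close>, the value of \<open>\<theta>\<close> in the two-point bound.\<close>
  define t where "t = n / (4 * K * C * U\<^sup>2)"
  have U: "U > 0" using U_ge_1 by simp
  have t: "t > 0" using n K0 C U by (simp add: t_def)
  have total: "(\<Sum>\<tau>\<in>?\<Omega>. ?W \<tau>) = 1"
  proof -
    have "(\<Sum>\<tau>\<in>?\<Omega>. ?W \<tau>) = (\<Prod>i<n. \<Sum>t\<in>?T. w t)"       by (rule prod_sum_PiE[where f="\<lambda>_. w", symmetric]) simp_all
    then show ?thesis using K0 w by simp
  qed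
  have \<tau>: "0 \<le> \<tau> i \<and> \<tau> i \<le> sqrt K" if "\<tau> \<in> ?\<Omega>" "i < n" for \<tau> i
  proof -
    have "\<tau> i = 0 \<or> \<tau> i = sqrt K" using that by auto
    then show ?thesis using K0 by auto
  qed
  have \<tau>\<tau>: "\<tau> i * \<tau> j * A i j \<le> K * C / n" if "\<tau> \<in> ?\<Omega>" "i < n" "j < n" for \<tau> i j
  proof -
    have "\<tau> i * \<tau> j \<le> sqrt K * sqrt K"
      using \<tau>[OF that(1,2)] \<tau>[OF that(1,3)] K0(1) by (intro mult_mono) simp_all
    then have "\<tau> i * \<tau> j * A i j \<le> K * (C / n)"
      unfolding sK using upper[OF that(2,3)] A_nonneg[of i j] K0(1) by (intro mult_mono) simp_all
    then show ?thesis by simp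
  qed
  have bad: "gauss_partial_sum D \<tau> \<le> ?bad" if "\<tau> \<in> ?\<Omega>" for \<tau>
  proof -
    \<comment> \<open>Row sums of a masked matrix are at most \<open>K * C\<close>; scaled by
      \<open>?r\<close> they are at most 1/4, so the constant vector 1 is a certificate with
      \<open>s = 1 / 2\<close>.\<close>
    let ?r = "1 / (4 * K * C + 1)"
    have r: "0 < ?r" "?r \<le> 1" "?r * (K * C) \<le> 1 / 4" 
    proof -
      have "0 < K * C" using K0 C by simp
      then show "0 < ?r" "?r \<le> 1" "?r * (K * C) \<le> 1 / 4" by (simp_all add: field_simps)
    qed
    have "gauss_partial_sum D \<tau> \<le> (1 / ?r) ^ D * (2 * exp (n * (1 / (2 * n) * 1)))"
    proof (rule gauss_partial_sum_le[where h="\<lambda>_. 1" and s="1 / 2"])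
      fix i assume i: "i < n"
      have "?r * (\<tau> i * (\<Sum>j<n. A i j * \<tau> j * 1)) = ?r * (\<Sum>j<n. \<tau> i * \<tau> j * A i j)"
        by (simp add: sum_distrib_left mult_ac)
      also have "\<dots> \<le> ?r * (\<Sum>j<n. K * C / n)"
        using \<tau>\<tau>[OF that i] r by (intro mult_left_mono sum_mono) auto
      also have "\<dots> = ?r * (K * C)" using n by simp
      finally show "?r * (\<tau> i * (\<Sum>j<n. A i j * \<tau> j * 1)) + 1 / 2 \<le> 1" using r(3) by linarith
      fix j assume j: "j < n"
      have "?r * (\<tau> i * \<tau> j * A i j) \<le> ?r * (K * C / n)"
        using \<tau>\<tau>[OF that i j] r by (intro mult_left_mono) auto
      also have "\<dots> = ?r * (K * C) / n" by simp
      also have "\<dots> \<le> (1 / 4) / n" using r(3) by (intro divide_right_mono) auto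
      finally show "?r * (\<tau> i * \<tau> j * A i j) \<le> 1 / (2 * n) * (1 / 2)" by simp
    qed (use \<tau>[OF that] r n in auto)
    also have "\<dots> = (4 * K * C + 1) ^ D * (2 * exp (1 / 2))" using n by simp
    also have "\<dots> \<le> ?bad" using K0 C by (intro mult_left_mono) auto
    finally show ?thesis .
  qed
  have good: "gauss_partial_sum D \<tau> \<le> ?good" if "\<tau> \<in> ?\<Omega>" "\<And>i. i < n \<Longrightarrow> ?b \<tau> i \<le> h i - 1 / 2" for \<tau>
  proof -
    have "gauss_partial_sum D \<tau> \<le> (1 / 1) ^ D * (2 * exp (n * (2 * K * C / n * U)))"
    proof (rule gauss_partial_sum_le[where h=h and s="1 / 2"])
      fix i assume i: "i < n"
      have "?b \<tau> i = sqrt K * (\<Sum>j<n. A i j * \<tau> j * h j)" by (simp add: sum_distrib_left mult_ac)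
      then have b: "sqrt K * (\<Sum>j<n. A i j * \<tau> j * h j) \<le> h i - 1 / 2" using that(2)[OF i] by simp
      \<comment> \<open>A masked row vanishes and only needs \<open>1 / 2 \<le> h i\<close>; in a
        surviving row the outer factor \<open>sqrt K\<close> produces exactly the tested quantity
        \<open>?b \<tau> i\<close>.\<close>
      have "\<tau> i = 0 \<or> \<tau> i = sqrt K" using that(1) i by (auto simp: PiE_iff)
      then show "1 * (\<tau> i * (\<Sum>j<n. A i j * \<tau> j * h j)) + 1 / 2 \<le> h i"
      proof
        assume "\<tau> i = 0"
        then show ?thesis using h(2)[OF i] by simp
      next
        assume "\<tau> i = sqrt K"
        then show ?thesis using b by simp
      qed
      show "0 \<le> h i" using h(2)[OF i] by simp
      fix j assume j: "j < n"
      show "1 * (\<tau> i * \<tau> j * A i j) \<le> 2 * K * C / n * (1 / 2)" using \<tau>\<tau>[OF that(1) i j] by simp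
    next
      show "2 * K * C / n * U \<le> 1 / 2" using large n by (simp add: field_simps)
    qed (use \<tau>[OF that(1)] h(3) U K0 C in auto)
    then show ?thesis using n by simp
  qed
  \<comment> \<open>The mean of \<open>?b \<tau> i\<close> under the mask weights is
    \<open>h i - 1\<close>. Of the gain \<open>t / 2\<close> from the slack, the two-point bound
    loses \<open>t * ((h i - 1) / (4 * U))\<close>, which is at most \<open>t / 4\<close> because
    \<open>h i \<le> U\<close>.\<close>
  have tail: "(\<Sum>\<tau>\<in>?\<Omega>. ?W \<tau> * exp (t * (?b \<tau> i - (h i - 1 / 2)))) \<le> exp (- t / 4)" if i: "i < n" for i
  proof -
    let ?l = "\<lambda>j. t * (A i j * sqrt K * h j)"
    have lK: "?l j * sqrt K = t * K * (A i j * h j)" for j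
    proof -
      have "?l j * sqrt K = t * (sqrt K * sqrt K) * (A i j * h j)" by (simp only: mult_ac)
      then show ?thesis unfolding sK .
    qed
    have "(\<Sum>\<tau>\<in>?\<Omega>. ?W \<tau> * exp (\<Sum>j<n. ?l j * \<tau> j)) \<le> exp ((1 + 1 / (4 * U)) / K * (\<Sum>j<n. ?l j * sqrt K))"
    proof (rule sum_two_point_weights_exp_le[OF _ K _ _ _ w])
      fix j assume j: "j \<in> {..<n}"
      show "0 \<le> ?l j" using t A_nonneg K0 h(2)[of j] j by simp
      have "A i j * h j \<le> C / n * U" using upper[OF i] h(2,3)[of j] j A_nonneg C by (intro mult_mono) auto
      then have "t * K * (A i j * h j) \<le> t * K * (C / n * U)" using t K0 by (intro mult_left_mono) auto
      also have "\<dots> = 1 / (4 * U)" using n K0 C U by (simp add: t_def power2_eq_square)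
      finally show "?l j * sqrt K \<le> 1 / (4 * U)" unfolding lK .
    qed (use U_ge_1 in auto)
    also have "(\<Sum>j<n. ?l j * sqrt K) = K * (t * (\<Sum>j<n. A i j * h j))"
      unfolding lK by (simp add: sum_distrib_left mult_ac)
    also have "(1 + 1 / (4 * U)) / K * (K * (t * (\<Sum>j<n. A i j * h j))) = (1 + 1 / (4 * U)) * (t * (h i - 1))"
      using K0 h(1)[OF i] by simp
    finally have 1: "(\<Sum>\<tau>\<in>?\<Omega>. ?W \<tau> * exp (\<Sum>j<n. ?l j * \<tau> j)) \<le> exp ((1 + 1 / (4 * U)) * (t * (h i - 1)))" .
    have "(\<Sum>\<tau>\<in>?\<Omega>. ?W \<tau> * exp (t * (?b \<tau> i - (h i - 1 / 2)))) =
        exp (- t * (h i - 1 / 2)) * (\<Sum>\<tau>\<in>?\<Omega>. ?W \<tau> * exp (\<Sum>j<n. ?l j * \<tau> j))"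
      unfolding sum_distrib_left
    proof (rule sum.cong[OF refl])
      fix \<tau>
      have "(\<Sum>j<n. ?l j * \<tau> j) = t * ?b \<tau> i" by (simp add: sum_distrib_left mult.assoc)
      then have "exp (t * (?b \<tau> i - (h i - 1 / 2))) = exp (- t * (h i - 1 / 2)) * exp (\<Sum>j<n. ?l j * \<tau> j)"
        by (simp add: exp_add[symmetric] algebra_simps)
      then show "?W \<tau> * exp (t * (?b \<tau> i - (h i - 1 / 2))) = exp (- t * (h i - 1 / 2)) * (?W \<tau> * exp (\<Sum>j<n. ?l j * \<tau> j))"
        by simp
    qed
    also have "\<dots> \<le> exp (- t * (h i - 1 / 2)) * exp ((1 + 1 / (4 * U)) * (t * (h i - 1)))"
      by (intro mult_left_mono 1) auto
    also have "\<dots> = exp (t * ((h i - 1) / (4 * U)) - t / 2)"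
      using U by (simp add: exp_add[symmetric] field_simps)
    also have "\<dots> \<le> exp (- t / 4)"
    proof -
      have "(h i - 1) / (4 * U) \<le> 1 / 4" using h(3)[OF i] U by (simp add: field_simps)
      then have "t * ((h i - 1) / (4 * U)) \<le> t * (1 / 4)" using t by (intro mult_left_mono) auto
      then have "t * ((h i - 1) / (4 * U)) - t / 2 \<le> - t / 4" by linarith
      then show ?thesis by (simp only: exp_le_cancel_iff)
    qed
    finally show ?thesis .
  qed
  let ?X = "\<lambda>\<tau>. \<Sum>i<n. exp (t * (?b \<tau> i - (h i - 1 / 2)))"
  have bad0: "?bad \<ge> 0" using K0 C by simp
  \<comment> \<open>On a mask with a failing row \<open>?X \<tau>\<close> is at least 1, so it
    replaces the indicator of the exceptional masks and can be averaged term by term.\<close>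
  have step: "gauss_partial_sum D \<tau> \<le> ?good + ?bad * ?X \<tau>" if \<tau>\<Omega>: "\<tau> \<in> ?\<Omega>" for \<tau>
  proof (cases "\<forall>i<n. ?b \<tau> i \<le> h i - 1 / 2")
    case True
    then have "gauss_partial_sum D \<tau> \<le> ?good" using good[OF \<tau>\<Omega>] by auto
    moreover have "0 \<le> ?X \<tau>" by (intro sum_nonneg) auto
    ultimately show ?thesis using mult_nonneg_nonneg[OF bad0, of "?X \<tau>"] by linarith
  next
    case False
    then obtain i where i: "i < n" "?b \<tau> i > h i - 1 / 2" by auto
    have "1 \<le> exp (t * (?b \<tau> i - (h i - 1 / 2)))" using i t by simp
    also have "\<dots> \<le> ?X \<tau>" using i(1) by (intro member_le_sum) auto
    finally have "?bad * 1 \<le> ?bad * ?X \<tau>" using bad0 by (rule mult_left_mono)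
    then show ?thesis using bad[OF \<tau>\<Omega>] exp_gt_zero[of "2 * K * C * U"] by linarith
  qed
  have mixture: "(\<Sum>d\<le>D. replica_moment \<nu> {..<n} J c d / fact d) \<le> (\<Sum>\<tau>\<in>?\<Omega>. ?W \<tau> * gauss_partial_sum D \<tau>)"
  proof (rule replica_partial_sum_le_mixture)
    fix k
    have "(\<Sum>t\<in>?T. w t * t ^ k) = (1 - 1 / K) * 0 ^ k + 1 / K * sqrt K ^ k"
      using K0(2) by (simp add: w)
    then show "(\<integral>x. x ^ k \<partial>\<nu>)\<^sup>2 \<le> (\<Sum>t\<in>?T. w t * t ^ k) * (\<integral>g. g ^ k \<partial>std_gauss)"
      using dom[of k] by (simp only:)
  qed simp
  have "(\<Sum>\<tau>\<in>?\<Omega>. ?W \<tau> * ?X \<tau>) = (\<Sum>i<n. \<Sum>\<tau>\<in>?\<Omega>. ?W \<tau> * exp (t * (?b \<tau> i - (h i - 1 / 2))))"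
    unfolding sum_distrib_left by (rule sum.swap)
  moreover have "\<dots> \<le> (\<Sum>i<n. exp (- t / 4))"
    by (rule sum_mono) (rule tail, simp)
  ultimately have X: "(\<Sum>\<tau>\<in>?\<Omega>. ?W \<tau> * ?X \<tau>) \<le> n * exp (- t / 4)" by simp
  have 1: "(\<Sum>\<tau>\<in>?\<Omega>. ?W \<tau> * gauss_partial_sum D \<tau>) \<le> (\<Sum>\<tau>\<in>?\<Omega>. ?W \<tau> * (?good + ?bad * ?X \<tau>))"
    by (rule sum_mono, rule mult_left_mono, rule step) (simp_all add: prod_nonneg w_nonneg)
  have 2: "?W \<tau> * (?good + ?bad * ?X \<tau>) = ?W \<tau> * ?good + ?bad * (?W \<tau> * ?X \<tau>)" for \<tau>
    by (simp only: distrib_left mult.left_commute)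
  have 3: "(\<Sum>\<tau>\<in>?\<Omega>. ?W \<tau> * (?good + ?bad * ?X \<tau>)) = ?good + ?bad * (\<Sum>\<tau>\<in>?\<Omega>. ?W \<tau> * ?X \<tau>)"
    unfolding 2 sum.distrib sum_distrib_left[of ?bad, symmetric] sum_distrib_right[of _ _ ?good, symmetric] total
    by (simp only: mult_1_left)
  have 4: "?bad * (\<Sum>\<tau>\<in>?\<Omega>. ?W \<tau> * ?X \<tau>) \<le> ?bad * (n * exp (- t / 4))"
    using X bad0 by (rule mult_left_mono)
  have 5: "- t / 4 = - (n / (16 * K * C * U\<^sup>2))" by (simp add: t_def)
  show ?thesis using mixture 1[unfolded 3] 4[unfolded 5] by linarith
qed

end

lemma (in prob_space) integrable_of_square_integrable:
  fixes f :: "'a \<Rightarrow> real"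
  shows "square_integrable M f \<Longrightarrow> integrable M f"
  by (auto simp: square_integrable_def intro: square_integrable_imp_integrable)

subsection \<open>The likelihood ratio\<close>

text \<open>The Cameron-Martin density of independent Gaussians with means \<open>\<mu>\<close>
  relative to the centered ones.\<close>

definition likelihood :: "'i set \<Rightarrow> ('i \<Rightarrow> real) \<Rightarrow> ('i \<Rightarrow> real) \<Rightarrow> ('i \<Rightarrow> real) \<Rightarrow> real" where
  "likelihood J \<sigma> \<mu> y = (\<Prod>p\<in>J. exp ((\<mu> p * y p - (\<mu> p)\<^sup>2 / 2) / (\<sigma> p)\<^sup>2))"

text \<open>Exponential tilting shifts the mean. The base mean \<open>m\<close> is kept general:
  \<open>m = 0\<close> identifies the density, and a second signal in place of \<open>m\<close>
  produces the overlap in the prefactor.\<close>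

lemma normal_density_shift:
  assumes "\<sigma> > 0"
  shows "normal_density m \<sigma> y * exp ((\<mu> * y - \<mu>\<^sup>2 / 2) / \<sigma>\<^sup>2) = exp (m * \<mu> / \<sigma>\<^sup>2) * normal_density (m + \<mu>) \<sigma> y"
proof -
  have "- (y - m)\<^sup>2 / (2 * \<sigma>\<^sup>2) + (\<mu> * y - \<mu>\<^sup>2 / 2) / \<sigma>\<^sup>2 = m * \<mu> / \<sigma>\<^sup>2 + - (y - (m + \<mu>))\<^sup>2 / (2 * \<sigma>\<^sup>2)"
    using assms by (simp add: divide_simps) (simp add: power2_eq_square algebra_simps)
  then have "exp (- (y - m)\<^sup>2 / (2 * \<sigma>\<^sup>2)) * exp ((\<mu> * y - \<mu>\<^sup>2 / 2) / \<sigma>\<^sup>2) =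
      exp (m * \<mu> / \<sigma>\<^sup>2) * exp (- (y - (m + \<mu>))\<^sup>2 / (2 * \<sigma>\<^sup>2))"
    by (simp only: exp_add[symmetric])
  then show ?thesis unfolding normal_density_def by (simp only: mult.assoc mult.left_commute)
qed

lemma nn_integral_gauss_exp_shift:
  assumes "\<sigma> > 0" and A [measurable]: "A \<in> sets borel"
  shows "(\<integral>\<^sup>+y. ennreal (exp ((\<mu> * y - \<mu>\<^sup>2 / 2) / \<sigma>\<^sup>2)) * indicator A y \<partial>gauss m \<sigma>) =
    ennreal (exp (m * \<mu> / \<sigma>\<^sup>2)) * emeasure (gauss (m + \<mu>) \<sigma>) A"
proof -
  have "(\<integral>\<^sup>+y. ennreal (exp ((\<mu> * y - \<mu>\<^sup>2 / 2) / \<sigma>\<^sup>2)) * indicator A y \<partial>gauss m \<sigma>) =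
      (\<integral>\<^sup>+y. ennreal (normal_density m \<sigma> y) * (ennreal (exp ((\<mu> * y - \<mu>\<^sup>2 / 2) / \<sigma>\<^sup>2)) * indicator A y) \<partial>lborel)"
    by (rule nn_integral_density) measurable
  also have "\<dots> = (\<integral>\<^sup>+y. ennreal (exp (m * \<mu> / \<sigma>\<^sup>2)) * (ennreal (normal_density (m + \<mu>) \<sigma> y) * indicator A y) \<partial>lborel)"
    unfolding mult.assoc[symmetric]
    by (simp add: ennreal_mult'[symmetric] normal_density_shift[OF assms(1)])
  also have "\<dots> = ennreal (exp (m * \<mu> / \<sigma>\<^sup>2)) * (\<integral>\<^sup>+y. ennreal (normal_density (m + \<mu>) \<sigma> y) * indicator A y \<partial>lborel)"
    by (rule nn_integral_cmult) measurable
  also have "(\<integral>\<^sup>+y. ennreal (normal_density (m + \<mu>) \<sigma> y) * indicator A y \<partial>lborel) = emeasure (gauss (m + \<mu>) \<sigma>) A"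
    by (rule emeasure_density[symmetric]) (use A in auto)
  finally show ?thesis .
qed

lemma prob_space_gauss: "\<sigma> > 0 \<Longrightarrow> prob_space (gauss \<mu> \<sigma>)"
  by (rule prob_space_normal_density)

context
  fixes J :: "'i set" and \<sigma> :: "'i \<Rightarrow> real"
  assumes J: "finite J" and \<sigma>: "\<And>p. p \<in> J \<Longrightarrow> \<sigma> p > 0"
begin

private abbreviation (input) gauss_law :: "('i \<Rightarrow> real) \<Rightarrow> ('i \<Rightarrow> real) measure" where
  "gauss_law \<mu> \<equiv> \<Pi>\<^sub>M p\<in>J. gauss (\<mu> p) (\<sigma> p)"

private abbreviation (input) null_law :: "('i \<Rightarrow> real) measure" where
  "null_law \<equiv> gauss_law (\<lambda>_. 0)"


lemma sets_gauss_PiM: "sets (gauss_law \<mu>) = sets (\<Pi>\<^sub>M p\<in>J. borel)"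
  by (rule sets_PiM_cong) simp_all

lemma likelihood_measurable_snd [measurable]:
  "likelihood J \<sigma> \<mu> \<in> borel_measurable (gauss_law \<mu>')"
  unfolding likelihood_def by measurable

lemma prob_space_gauss_PiM: "prob_space (gauss_law \<mu>)"
proof -
  have "gauss_law \<mu> = (\<Pi>\<^sub>M p\<in>J. gauss (\<mu> p) (if p \<in> J then \<sigma> p else 1))"
    by (rule PiM_cong) auto
  also have "prob_space \<dots>" by (rule prob_space_PiM) (auto intro!: prob_space_gauss \<sigma>)
  finally show ?thesis .
qed

lemma nn_integral_likelihood_box:
  assumes A: "\<And>p. p \<in> J \<Longrightarrow> A p \<in> sets borel"
  shows "(\<integral>\<^sup>+y. ennreal (likelihood J \<sigma> \<mu> y) * indicator (Pi\<^sub>E J A) y \<partial>(gauss_law m)) =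
    ennreal (exp (\<Sum>p\<in>J. m p * \<mu> p / (\<sigma> p)\<^sup>2)) * (\<Prod>p\<in>J. emeasure (gauss (m p + \<mu> p) (\<sigma> p)) (A p))"
proof -
  interpret product_sigma_finite "\<lambda>p. gauss (m p) (\<sigma> p)" by (rule product_sigma_finite_gauss)
  let ?f = "\<lambda>p y. ennreal (exp ((\<mu> p * y - (\<mu> p)\<^sup>2 / 2) / (\<sigma> p)\<^sup>2)) * indicator (A p) y"
  have "(\<integral>\<^sup>+y. ennreal (likelihood J \<sigma> \<mu> y) * indicator (Pi\<^sub>E J A) y \<partial>(gauss_law m)) =
      (\<integral>\<^sup>+y. (\<Prod>p\<in>J. ?f p (y p)) \<partial>(gauss_law m))"
  proof (rule nn_integral_cong)
    fix y assume "y \<in> space (gauss_law m)"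
    then have y: "y \<in> extensional J" by (simp add: space_PiM PiE_iff)
    have "(indicator (Pi\<^sub>E J A) y :: ennreal) = (\<Prod>p\<in>J. indicator (A p) (y p))"
      using y J by (auto simp: indicator_def PiE_iff prod_zero_iff)
    then show "ennreal (likelihood J \<sigma> \<mu> y) * indicator (Pi\<^sub>E J A) y = (\<Prod>p\<in>J. ?f p (y p))"
      by (simp add: likelihood_def prod_ennreal[symmetric] prod.distrib)
  qed
  also have "\<dots> = (\<Prod>p\<in>J. \<integral>\<^sup>+y. ?f p y \<partial>gauss (m p) (\<sigma> p))"
  proof (rule product_nn_integral_prod[OF J])
    fix p assume "p \<in> J"
    note [measurable] = A[OF this]
    show "?f p \<in> borel_measurable (gauss (m p) (\<sigma> p))" by measurable
  qed
  also have "\<dots> = (\<Prod>p\<in>J. ennreal (exp (m p * \<mu> p / (\<sigma> p)\<^sup>2)) * emeasure (gauss (m p + \<mu> p) (\<sigma> p)) (A p))"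
    by (rule prod.cong[OF refl]) (rule nn_integral_gauss_exp_shift, auto intro: \<sigma> A)
  also have "\<dots> = ennreal (exp (\<Sum>p\<in>J. m p * \<mu> p / (\<sigma> p)\<^sup>2)) * (\<Prod>p\<in>J. emeasure (gauss (m p + \<mu> p) (\<sigma> p)) (A p))"
    using J by (simp add: prod.distrib prod_ennreal exp_sum)
  finally show ?thesis .
qed

lemma density_likelihood:
  "density null_law (\<lambda>y. ennreal (likelihood J \<sigma> \<mu> y)) = gauss_law \<mu>"
proof -
  interpret product_sigma_finite "\<lambda>p. gauss (\<mu> p) (\<sigma> p)" by (rule product_sigma_finite_gauss)
  show ?thesis
  proof (rule PiM_eqI[OF J])
    show "sets (density null_law (\<lambda>y. ennreal (likelihood J \<sigma> \<mu> y))) = sets (gauss_law \<mu>)"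
      by (simp add: sets_gauss_PiM)
    fix A assume "\<And>p. p \<in> J \<Longrightarrow> A p \<in> sets (gauss (\<mu> p) (\<sigma> p))"
    then have A: "\<And>p. p \<in> J \<Longrightarrow> A p \<in> sets borel" by simp
    have box: "Pi\<^sub>E J A \<in> sets null_law"
      using A J by (intro sets_PiM_I_finite) auto
    have "emeasure (density null_law (\<lambda>y. ennreal (likelihood J \<sigma> \<mu> y))) (Pi\<^sub>E J A) =
        (\<integral>\<^sup>+y. ennreal (likelihood J \<sigma> \<mu> y) * indicator (Pi\<^sub>E J A) y \<partial>null_law)"
      by (rule emeasure_density[OF _ box]) measurable
    then show "emeasure (density null_law (\<lambda>y. ennreal (likelihood J \<sigma> \<mu> y))) (Pi\<^sub>E J A) =
        (\<Prod>p\<in>J. emeasure (gauss (\<mu> p) (\<sigma> p)) (A p))"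
      using nn_integral_likelihood_box[where A=A and \<mu>=\<mu> and m="\<lambda>_. 0", OF A] by simp
  qed
qed

text \<open>The first likelihood turns the null law into the Gaussian law with means
  \<open>\<mu>\<close>. The box formula with that base mean and the whole space as box leaves only
  the exponential of the overlap.\<close>

lemma nn_integral_likelihood_product:
  "(\<integral>\<^sup>+y. ennreal (likelihood J \<sigma> \<mu> y) * ennreal (likelihood J \<sigma> \<mu>' y) \<partial>null_law) =
    ennreal (exp (\<Sum>p\<in>J. \<mu> p * \<mu>' p / (\<sigma> p)\<^sup>2))"
proof -
  have "(\<integral>\<^sup>+y. ennreal (likelihood J \<sigma> \<mu> y) * ennreal (likelihood J \<sigma> \<mu>' y) \<partial>null_law) =
      (\<integral>\<^sup>+y. ennreal (likelihood J \<sigma> \<mu>' y) \<partial>density null_law (\<lambda>y. ennreal (likelihood J \<sigma> \<mu> y)))"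
    by (rule nn_integral_density[symmetric]) measurable
  also have "\<dots> = (\<integral>\<^sup>+y. ennreal (likelihood J \<sigma> \<mu>' y) * indicator (\<Pi>\<^sub>E p\<in>J. UNIV) y \<partial>(gauss_law \<mu>))"
    unfolding density_likelihood by (rule nn_integral_cong) (simp add: space_PiM)
  also have "\<dots> = ennreal (exp (\<Sum>p\<in>J. \<mu> p * \<mu>' p / (\<sigma> p)\<^sup>2)) * (\<Prod>p\<in>J. emeasure (gauss (\<mu> p + \<mu>' p) (\<sigma> p)) UNIV)"
    by (rule nn_integral_likelihood_box) simp
  also have "(\<Prod>p\<in>J. emeasure (gauss (\<mu> p + \<mu>' p) (\<sigma> p)) UNIV) = 1"
  proof (rule prod.neutral, rule ballI)
    fix p assume "p \<in> J"
    then interpret prob_space "gauss (\<mu> p + \<mu>' p) (\<sigma> p)" by (intro prob_space_gauss \<sigma>)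
    show "emeasure (gauss (\<mu> p + \<mu>' p) (\<sigma> p)) UNIV = 1" using emeasure_space_1 by simp
  qed
  finally show ?thesis by simp
qed

text \<open>Below, \<open>X x\<close> is the signal drawn with the latent variable \<open>x\<close> of law \<open>M\<close>.\<close>

context
  fixes M :: "'a measure" and X :: "'a \<Rightarrow> 'i \<Rightarrow> real"
  assumes M: "prob_space M" and X [measurable]: "\<And>p. p \<in> J \<Longrightarrow> (\<lambda>x. X x p) \<in> borel_measurable M"
begin

private abbreviation (input) obs_kernel :: "'a \<Rightarrow> ('i \<Rightarrow> real) measure" where
  "obs_kernel x \<equiv> gauss_law (X x)"

private abbreviation (input) planted_law :: "('i \<Rightarrow> real) measure" where
  "planted_law \<equiv> M \<bind> obs_kernel"

text \<open>Valued in \<open>ennreal\<close>, so that integrals over signal and observation may be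
  exchanged by Tonelli before any finiteness is known.\<close>

definition likelihood_ratio :: "('i \<Rightarrow> real) \<Rightarrow> ennreal" where
  "likelihood_ratio y = (\<integral>\<^sup>+x. ennreal (likelihood J \<sigma> (X x) y) \<partial>M)"

lemma likelihood_signal_measurable [measurable]:
  "(\<lambda>(x, y). likelihood J \<sigma> (X x) y) \<in> borel_measurable (M \<Otimes>\<^sub>M null_law)"
proof -
  have [measurable]: "(\<lambda>z. X (fst z) p) \<in> borel_measurable (M \<Otimes>\<^sub>M null_law)" if "p \<in> J" for p
    using measurable_compose[OF measurable_fst X[OF that]] .
  have [measurable]: "(\<lambda>z. (snd z) p) \<in> borel_measurable (M \<Otimes>\<^sub>M null_law)" if "p \<in> J" for p
    using measurable_compose[OF measurable_snd[of M null_law]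
      measurable_component_singleton[OF that, of "\<lambda>p. gauss 0 (\<sigma> p)"]] by simp
  show ?thesis unfolding likelihood_def split_beta by measurable
qed

lemma likelihood_signal_measurable_fst [measurable]:
  "(\<lambda>x. likelihood J \<sigma> (X x) y) \<in> borel_measurable M"
  unfolding likelihood_def by measurable

lemma likelihood_signal_measurable_swap [measurable]:
  "(\<lambda>(y, x). likelihood J \<sigma> (X x) y) \<in> borel_measurable (null_law \<Otimes>\<^sub>M M)"
  using measurable_compose[OF measurable_pair_swap' likelihood_signal_measurable]
  by (simp add: split_beta)

lemma sigma_finite_M: "sigma_finite_measure M"
  using M by (rule prob_space_imp_sigma_finite)

lemma sigma_finite_null: "sigma_finite_measure null_law"
  using prob_space_gauss_PiM[of "\<lambda>_. 0"] by (rule prob_space_imp_sigma_finite)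

lemma likelihood_ratio_measurable [measurable]: "likelihood_ratio \<in> borel_measurable null_law"
proof -
  interpret sigma_finite_measure M by (rule sigma_finite_M)
  show ?thesis unfolding likelihood_ratio_def by measurable
qed

text \<open>All kernels have densities with respect to the one null law, so measurability in the
  signal follows from joint measurability of the likelihood.\<close>

lemma obs_kernel_measurable: "obs_kernel \<in> measurable M (subprob_algebra null_law)"
proof (rule measurable_subprob_algebra)
  show "subprob_space (obs_kernel x)" for x
    by (intro prob_space_imp_subprob_space prob_space_gauss_PiM)
  show "sets (obs_kernel x) = sets null_law" for x
    using sets_gauss_PiM[of "X x"] sets_gauss_PiM[of "\<lambda>_. 0"] by simp
  fix A assume [measurable]: "A \<in> sets null_law"
  interpret sigma_finite_measure null_law by (rule sigma_finite_null)
  have "emeasure (obs_kernel x) A = (\<integral>\<^sup>+y. ennreal (likelihood J \<sigma> (X x) y) * indicator A y \<partial>null_law)" for x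
    unfolding density_likelihood[symmetric, of "X x"] by (rule emeasure_density) measurable
  then show "(\<lambda>x. emeasure (obs_kernel x) A) \<in> borel_measurable M" by simp
qed

lemma planted_eq_density: "planted_law = density null_law likelihood_ratio"
proof (rule measure_eqI)
  have ne: "space M \<noteq> {}" using M by (rule prob_space.not_empty)
  have sets: "sets planted_law = sets null_law"
    by (rule sets_bind[OF _ ne]) (simp add: sets_gauss_PiM)
  then show "sets planted_law = sets (density null_law likelihood_ratio)" by simp
  fix A assume "A \<in> sets planted_law"
  then have A [measurable]: "A \<in> sets null_law" by (simp add: sets)
  interpret pair_sigma_finite null_law M
    by (intro pair_sigma_finite.intro sigma_finite_null sigma_finite_M)
  have "emeasure planted_law A = (\<integral>\<^sup>+x. emeasure (obs_kernel x) A \<partial>M)"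
    by (rule emeasure_bind[OF ne obs_kernel_measurable A])
  also have "\<dots> = (\<integral>\<^sup>+x. \<integral>\<^sup>+y. ennreal (likelihood J \<sigma> (X x) y) * indicator A y \<partial>null_law \<partial>M)"
    unfolding density_likelihood[symmetric, of "X _"]
    by (intro nn_integral_cong emeasure_density) measurable
  also have "\<dots> = (\<integral>\<^sup>+y. \<integral>\<^sup>+x. ennreal (likelihood J \<sigma> (X x) y) * indicator A y \<partial>M \<partial>null_law)"
    by (rule Fubini') measurable
  also have "\<dots> = (\<integral>\<^sup>+y. likelihood_ratio y * indicator A y \<partial>null_law)"
    unfolding likelihood_ratio_def by (intro nn_integral_cong nn_integral_multc) measurable
  also have "\<dots> = emeasure (density null_law likelihood_ratio) A"
    by (rule emeasure_density[symmetric]) measurable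
  finally show "emeasure planted_law A = emeasure (density null_law likelihood_ratio) A" .
qed

text \<open>The two factors of the square are opened with independent signals \<open>x\<close> and
  \<open>x'\<close>, and the observation is moved to the innermost integral, where it is
  explicit.\<close>

lemma nn_integral_likelihood_ratio_square:
  "(\<integral>\<^sup>+y. likelihood_ratio y ^ 2 \<partial>null_law) =
    (\<integral>\<^sup>+x. \<integral>\<^sup>+x'. ennreal (exp (\<Sum>p\<in>J. X x p * X x' p / (\<sigma> p)\<^sup>2)) \<partial>M \<partial>M)"
proof -
  interpret M: sigma_finite_measure M by (rule sigma_finite_M)
  interpret pair_sigma_finite null_law M
    by (intro pair_sigma_finite.intro sigma_finite_null sigma_finite_M)
  let ?l = "\<lambda>x y. ennreal (likelihood J \<sigma> (X x) y)"
  have "(\<integral>\<^sup>+y. likelihood_ratio y ^ 2 \<partial>null_law) = (\<integral>\<^sup>+y. \<integral>\<^sup>+x. ?l x y * likelihood_ratio y \<partial>M \<partial>null_law)"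
    unfolding power2_eq_square
    by (subst (1) likelihood_ratio_def) (simp add: nn_integral_multc)
  also have "\<dots> = (\<integral>\<^sup>+x. \<integral>\<^sup>+y. ?l x y * likelihood_ratio y \<partial>null_law \<partial>M)"
    by (rule Fubini'[symmetric]) measurable
  also have "\<dots> = (\<integral>\<^sup>+x. \<integral>\<^sup>+y. \<integral>\<^sup>+x'. ?l x y * ?l x' y \<partial>M \<partial>null_law \<partial>M)"
    unfolding likelihood_ratio_def by (simp add: nn_integral_cmult)
  also have "\<dots> = (\<integral>\<^sup>+x. \<integral>\<^sup>+x'. \<integral>\<^sup>+y. ?l x y * ?l x' y \<partial>null_law \<partial>M \<partial>M)"
    by (intro nn_integral_cong Fubini'[symmetric]) measurable
  finally show ?thesis by (simp only: nn_integral_likelihood_product)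
qed

text \<open>For nonnegative functions this is integration against a bind; a signed \<open>f\<close>
  is split into positive and negative parts. Integrability under each kernel makes every inner
  integral finite.\<close>

lemma integral_planted:
  fixes f :: "('i \<Rightarrow> real) \<Rightarrow> real"
  assumes f [measurable]: "f \<in> borel_measurable null_law" and int: "integrable planted_law f"
    and intK: "\<And>x. integrable (obs_kernel x) f"
  shows "(\<integral>y. f y \<partial>planted_law) = (\<integral>x. (\<integral>y. f y \<partial>obs_kernel x) \<partial>M)"
proof -
  have nonneg: "integrable M (\<lambda>x. \<integral>y. g y \<partial>obs_kernel x) \<and>
      (\<integral>y. g y \<partial>planted_law) = (\<integral>x. (\<integral>y. g y \<partial>obs_kernel x) \<partial>M)"
    if g [measurable]: "g \<in> borel_measurable null_law" and g0: "\<And>y. 0 \<le> g y"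
      and int: "integrable planted_law g" and intK: "\<And>x. integrable (obs_kernel x) g"
    for g :: "('i \<Rightarrow> real) \<Rightarrow> real"
  proof -
    have inner: "(\<integral>\<^sup>+y. ennreal (g y) \<partial>obs_kernel x) = ennreal (\<integral>y. g y \<partial>obs_kernel x)" for x
      using intK[of x] g0 by (intro nn_integral_eq_integral) auto
    have "(\<lambda>x. \<integral>\<^sup>+y. ennreal (g y) \<partial>obs_kernel x) \<in> borel_measurable M"
      using measurable_compose[OF obs_kernel_measurable nn_integral_measurable_subprob_algebra[of "\<lambda>y. ennreal (g y)"]]
      by simp
    then have "(\<lambda>x. enn2real (\<integral>\<^sup>+y. ennreal (g y) \<partial>obs_kernel x)) \<in> borel_measurable M" by measurable
    then have meas: "(\<lambda>x. \<integral>y. g y \<partial>obs_kernel x) \<in> borel_measurable M"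
      unfolding inner using g0 by (simp add: integral_nonneg)
    have "ennreal (\<integral>y. g y \<partial>planted_law) = (\<integral>\<^sup>+y. ennreal (g y) \<partial>planted_law)"
      using int g0 by (intro nn_integral_eq_integral[symmetric]) auto
    also have "\<dots> = (\<integral>\<^sup>+x. \<integral>\<^sup>+y. ennreal (g y) \<partial>obs_kernel x \<partial>M)"
      by (rule nn_integral_bind[OF _ obs_kernel_measurable]) measurable
    finally have eq: "(\<integral>\<^sup>+x. ennreal (\<integral>y. g y \<partial>obs_kernel x) \<partial>M) = ennreal (\<integral>y. g y \<partial>planted_law)"
      unfolding inner by simp
    show ?thesis
      using nn_integral_eq_integrable[THEN iffD1, OF _ _ _ eq] meas g0
      by (auto simp: integral_nonneg)
  qed
  have p: "f y = max 0 (f y) - max 0 (- f y)" for y by simp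
  have P: "integrable M (\<lambda>x. \<integral>y. max 0 (f y) \<partial>obs_kernel x) \<and>
      (\<integral>y. max 0 (f y) \<partial>planted_law) = (\<integral>x. (\<integral>y. max 0 (f y) \<partial>obs_kernel x) \<partial>M)"
    by (rule nonneg) (use int intK in \<open>auto intro!: integrable_max\<close>)
  have N: "integrable M (\<lambda>x. \<integral>y. max 0 (- f y) \<partial>obs_kernel x) \<and>
      (\<integral>y. max 0 (- f y) \<partial>planted_law) = (\<integral>x. (\<integral>y. max 0 (- f y) \<partial>obs_kernel x) \<partial>M)"
    by (rule nonneg) (use int intK in \<open>auto intro!: integrable_max\<close>)
  have "(\<integral>y. f y \<partial>planted_law) =
      (\<integral>y. max 0 (f y) \<partial>planted_law) - (\<integral>y. max 0 (- f y) \<partial>planted_law)"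
    using int by (subst Bochner_Integration.integral_diff[symmetric]) (auto simp: p[symmetric])
  also have "\<dots> = (\<integral>x. (\<integral>y. max 0 (f y) \<partial>obs_kernel x) - (\<integral>y. max 0 (- f y) \<partial>obs_kernel x) \<partial>M)"
    using P N by simp
  also have "\<dots> = (\<integral>x. (\<integral>y. f y \<partial>obs_kernel x) \<partial>M)"
  proof (rule Bochner_Integration.integral_cong[OF refl])
    fix x
    show "(\<integral>y. max 0 (f y) \<partial>obs_kernel x) - (\<integral>y. max 0 (- f y) \<partial>obs_kernel x) = (\<integral>y. f y \<partial>obs_kernel x)"
      using intK[of x] by (subst Bochner_Integration.integral_diff[symmetric]) (auto simp: p[symmetric])
  qed
  finally show ?thesis .
qed

lemma prob_space_planted: "prob_space planted_law"
  by (rule prob_space.prob_space_bind[OF M AE_I2 obs_kernel_measurable]) (rule prob_space_gauss_PiM)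

lemma sets_planted: "sets planted_law = sets null_law"
  unfolding planted_eq_density by simp

lemma null_law_prob: "prob_space null_law"
  by (rule prob_space_gauss_PiM)

subsection \<open>Consequences of a bounded second moment\<close>

text \<open>Cauchy-Schwarz under the null law, with the likelihood ratio as weight; applied below to
  \<open>\<bar>f y - m\<bar>\<close> and to indicators.\<close>

lemma nn_integral_planted_square_le:
  assumes g [measurable]: "g \<in> borel_measurable null_law"
  shows "(\<integral>\<^sup>+y. g y \<partial>planted_law)\<^sup>2 \<le>
    (\<integral>\<^sup>+y. likelihood_ratio y ^ 2 \<partial>null_law) * (\<integral>\<^sup>+y. g y ^ 2 \<partial>null_law)"
proof -
  have "(\<integral>\<^sup>+y. g y \<partial>planted_law) = (\<integral>\<^sup>+y. likelihood_ratio y * g y \<partial>null_law)"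
    unfolding planted_eq_density by (rule nn_integral_density) measurable
  then show ?thesis by (simp add: Cauchy_Schwarz_nn_integral)
qed

context
  fixes K :: real
  assumes K: "K \<ge> 0" and second_moment: "(\<integral>\<^sup>+y. likelihood_ratio y ^ 2 \<partial>null_law) \<le> ennreal K"
begin

text \<open>Centering \<open>f\<close> at its null mean before Cauchy-Schwarz makes the second
  factor the null variance.\<close>

lemma expectation_gap_le:
  fixes f :: "('i \<Rightarrow> real) \<Rightarrow> real"
  assumes fQ: "square_integrable null_law f" and fP: "square_integrable planted_law f"
  shows "prob_space.expectation planted_law f - prob_space.expectation null_law f \<le>
    sqrt K * sqrt (prob_space.variance null_law f)"
proof -
  interpret P: prob_space "planted_law" by (rule prob_space_planted)
  interpret Q: prob_space null_law by (rule null_law_prob)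
  define m where "m = Q.expectation f"
  have f [measurable]: "f \<in> borel_measurable null_law" using fQ by (simp add: square_integrable_def)
  have intP: "integrable planted_law f"
    using fP by (rule P.integrable_of_square_integrable)
  have intQ: "integrable null_law f"
    using fQ by (rule Q.integrable_of_square_integrable)
  have intQ2: "integrable null_law (\<lambda>y. (f y - m)\<^sup>2)"
    unfolding power2_diff using fQ intQ by (auto simp: square_integrable_def)
  have 1: "P.expectation f - m \<le> P.expectation (\<lambda>y. \<bar>f y - m\<bar>)"
  proof -
    have "P.expectation f - m = P.expectation (\<lambda>y. f y - m)" using intP by (simp add: P.prob_space)
    also have "\<dots> \<le> P.expectation (\<lambda>y. \<bar>f y - m\<bar>)" using intP by (intro integral_mono) auto
    finally show ?thesis .
  qed
  have eq: "(\<integral>\<^sup>+y. ennreal \<bar>f y - m\<bar> \<partial>planted_law) = ennreal (P.expectation (\<lambda>y. \<bar>f y - m\<bar>))"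
    using intP by (intro nn_integral_eq_integral) auto
  have "ennreal ((P.expectation (\<lambda>y. \<bar>f y - m\<bar>))\<^sup>2) = (\<integral>\<^sup>+y. ennreal \<bar>f y - m\<bar> \<partial>planted_law)\<^sup>2"
    unfolding eq by (simp add: ennreal_power)
  also have "\<dots> \<le> (\<integral>\<^sup>+y. likelihood_ratio y ^ 2 \<partial>null_law) * (\<integral>\<^sup>+y. ennreal \<bar>f y - m\<bar> ^ 2 \<partial>null_law)"
    by (rule nn_integral_planted_square_le) measurable
  also have "(\<integral>\<^sup>+y. ennreal \<bar>f y - m\<bar> ^ 2 \<partial>null_law) = ennreal (Q.variance f)"
    using intQ2 by (simp add: ennreal_power nn_integral_eq_integral m_def)
  also have "(\<integral>\<^sup>+y. likelihood_ratio y ^ 2 \<partial>null_law) * ennreal (Q.variance f) \<le> ennreal K * ennreal (Q.variance f)"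
    by (intro mult_right_mono second_moment) simp
  finally have "(P.expectation (\<lambda>y. \<bar>f y - m\<bar>))\<^sup>2 \<le> K * Q.variance f"
    using K by (simp add: ennreal_mult'[symmetric] integral_nonneg)
  then have "P.expectation (\<lambda>y. \<bar>f y - m\<bar>) \<le> sqrt (K * Q.variance f)" by (rule real_le_rsqrt)
  then show ?thesis using 1 by (simp add: m_def real_sqrt_mult)
qed

lemma measure_planted_square_le:
  assumes A [measurable]: "A \<in> sets null_law"
  shows "(measure planted_law A)\<^sup>2 \<le> K * measure null_law A"
proof -
  interpret P: prob_space "planted_law" by (rule prob_space_planted)
  interpret Q: prob_space null_law by (rule null_law_prob)
  have AP: "A \<in> sets planted_law" using A sets_planted by simp
  have "ennreal ((measure planted_law A)\<^sup>2) = (\<integral>\<^sup>+y. indicator A y \<partial>planted_law)\<^sup>2"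
    using AP by (simp add: P.emeasure_eq_measure ennreal_power)
  also have "\<dots> \<le> (\<integral>\<^sup>+y. likelihood_ratio y ^ 2 \<partial>null_law) * (\<integral>\<^sup>+y. (indicator A y :: ennreal) ^ 2 \<partial>null_law)"
    by (rule nn_integral_planted_square_le) measurable
  also have "(\<integral>\<^sup>+y. (indicator A y :: ennreal) ^ 2 \<partial>null_law) = (\<integral>\<^sup>+y. indicator A y \<partial>null_law)"
    by (intro nn_integral_cong) (auto simp: indicator_def)
  also have "\<dots> = ennreal (measure null_law A)" using A by (simp add: Q.emeasure_eq_measure)
  also have "(\<integral>\<^sup>+y. likelihood_ratio y ^ 2 \<partial>null_law) * ennreal (measure null_law A) \<le> ennreal K * ennreal (measure null_law A)"
    by (intro mult_right_mono second_moment) simp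
  finally show ?thesis using K by (simp add: ennreal_mult'[symmetric])
qed

lemma chi_square_le: "chi_square planted_law null_law \<le> ennreal (K + 1)"
proof -
  interpret Q: prob_space null_law by (rule null_law_prob)
  have ac: "absolutely_continuous null_law planted_law"
    unfolding planted_eq_density by (rule absolutely_continuousI_density) measurable
  have AE: "AE y in null_law. likelihood_ratio y = RN_deriv null_law planted_law y"
    by (rule Q.RN_deriv_unique) (simp_all add: planted_eq_density)
  \<comment> \<open>At infinity the left side is 1, because \<open>enn2real\<close> sends infinity
    to 0, and the right side is infinite.\<close>
  have pt: "ennreal ((enn2real l - 1)\<^sup>2) \<le> l ^ 2 + 1" for l :: ennreal
  proof (cases l)
    case (real r)
    then have "(r - 1)\<^sup>2 \<le> r\<^sup>2 + 1" by (simp add: power2_diff)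
    then have "ennreal ((r - 1)\<^sup>2) \<le> ennreal (r\<^sup>2 + 1)" by (rule ennreal_leI)
    then show ?thesis using real by (simp add: ennreal_power)
  qed simp
  have "chi_square planted_law null_law =
      (\<integral>\<^sup>+y. ennreal ((enn2real (RN_deriv null_law planted_law y) - 1)\<^sup>2) \<partial>null_law)"
    using ac by (simp add: chi_square_def)
  also have "\<dots> \<le> (\<integral>\<^sup>+y. likelihood_ratio y ^ 2 + 1 \<partial>null_law)"
    by (rule nn_integral_mono_AE) (use AE pt in \<open>auto elim!: eventually_mono\<close>)
  also have "\<dots> = (\<integral>\<^sup>+y. likelihood_ratio y ^ 2 \<partial>null_law) + 1"
    using Q.emeasure_space_1 by (subst nn_integral_add) auto
  also have "\<dots> \<le> ennreal K + 1" by (intro add_right_mono second_moment)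
  finally show ?thesis using K by simp
qed

end

subsection \<open>The low-degree advantage\<close>

text \<open>In the Hermite basis the null variance is a weighted sum of squares of the coefficients,
  and the expectation gap is linear in the same coefficients. Cauchy-Schwarz bounds the gap through
  the dual weights, and opening the squares \<open>(m \<alpha>)\<^sup>2\<close> with two replicas
  gives a multinomial sum.\<close>

lemma low_degree_gap_le:
  assumes mono: "\<And>\<alpha>. integrable M (\<lambda>x. \<Prod>p\<in>J. (X x p / \<sigma> p) ^ \<alpha> p)"
    and f: "mp_vars f \<subseteq> J" "mp_degree f \<le> D"
    and fP: "square_integrable planted_law (mp_eval f)"
  shows "(prob_space.expectation planted_law (mp_eval f) - prob_space.expectation null_law (mp_eval f))\<^sup>2 \<le>
    prob_space.variance null_law (mp_eval f) *
      (\<integral>x. (\<integral>x'. (\<Sum>d\<le>D. (\<Sum>p\<in>J. X x p * X x' p / (\<sigma> p)\<^sup>2) ^ d / fact d) \<partial>M) \<partial>M)"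
proof -
  interpret M: prob_space M by (rule M)
  interpret P: prob_space "planted_law" by (rule prob_space_planted)
  interpret Q: prob_space null_law by (rule null_law_prob)
  let ?S = "multi_indices J D" and ?H = "multi_hermite J \<sigma>"
  define \<alpha>0 :: "'i \<Rightarrow> nat" where "\<alpha>0 = (\<lambda>p\<in>J. 0)"
  define F :: "('i \<Rightarrow> nat) \<Rightarrow> real" where "F \<alpha> = (\<Prod>p\<in>J. fact (\<alpha> p))" for \<alpha>
  define u where "u \<alpha> x = (\<Prod>p\<in>J. (X x p / \<sigma> p) ^ \<alpha> p)" for \<alpha> x
  define m where "m \<alpha> = (\<integral>x. u \<alpha> x \<partial>M)" for \<alpha>
  have F: "F \<alpha> > 0" for \<alpha> by (simp add: F_def prod_pos)
  have fin: "finite ?S" using J by (rule finite_multi_indices)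
  have u: "integrable M (u \<alpha>)" for \<alpha> unfolding u_def by (rule mono)
  have "\<exists>c. \<forall>y. mp_eval f y = (\<Sum>\<alpha>\<in>?S. c \<alpha> * ?H \<alpha> y)"
    by (rule hermite_expansion_mpolynomial[OF J _ f]) (rule \<sigma>)
  then obtain c where "\<forall>y. mp_eval f y = (\<Sum>\<alpha>\<in>?S. c \<alpha> * ?H \<alpha> y)" ..
  then have c: "mp_eval f y = (\<Sum>\<alpha>\<in>?S. c \<alpha> * ?H \<alpha> y)" for y by (rule spec)
  have f_eq: "mp_eval f = (\<lambda>y. \<Sum>\<alpha>\<in>?S. c \<alpha> * ?H \<alpha> y)" by (rule ext) (rule c)
  note H = multi_hermite_integral[where \<sigma>=\<sigma>, OF J \<sigma>]
  have H1 [simp]: "integrable (gauss_law \<mu>) (?H \<alpha>)" for \<mu> \<alpha> by (rule H(1)) simp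
  have H3 [simp]: "integrable null_law (\<lambda>y. ?H \<alpha> y * ?H \<gamma> y)" for \<alpha> \<gamma> by (rule H(3)) simp
  have intP: "integrable planted_law (mp_eval f)"
    using fP by (rule P.integrable_of_square_integrable)
  have index_eq: "(\<forall>p\<in>J. \<alpha> p = \<gamma> p) \<longleftrightarrow> \<alpha> = \<gamma>" if "\<alpha> \<in> ?S" "\<gamma> \<in> ?S" for \<alpha> \<gamma>
    using that by (auto simp: multi_indices_def intro: PiE_ext)
  have \<alpha>0: "\<alpha>0 \<in> ?S" by (auto simp: \<alpha>0_def multi_indices_def)
  have EP: "P.expectation (mp_eval f) = (\<Sum>\<alpha>\<in>?S. c \<alpha> * m \<alpha>)"
  proof -
    have "P.expectation (mp_eval f) = (\<integral>x. (\<integral>y. mp_eval f y \<partial>obs_kernel x) \<partial>M)"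
    proof (rule integral_planted)
      have "integrable null_law (mp_eval f)" unfolding f_eq by simp
      then show "mp_eval f \<in> borel_measurable null_law" by (rule borel_measurable_integrable)
      show "integrable (obs_kernel x) (mp_eval f)" for x unfolding f_eq by simp
    qed (rule intP)
    also have "\<dots> = (\<integral>x. (\<Sum>\<alpha>\<in>?S. c \<alpha> * u \<alpha> x) \<partial>M)"
    proof (rule Bochner_Integration.integral_cong[OF refl])
      fix x
      have "(\<integral>y. mp_eval f y \<partial>obs_kernel x) = (\<Sum>\<alpha>\<in>?S. c \<alpha> * (\<integral>y. ?H \<alpha> y \<partial>obs_kernel x))"
        unfolding c by (subst Bochner_Integration.integral_sum) simp_all
      then show "(\<integral>y. mp_eval f y \<partial>obs_kernel x) = (\<Sum>\<alpha>\<in>?S. c \<alpha> * u \<alpha> x)"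
        by (simp only: H(2) u_def)
    qed
    also have "\<dots> = (\<Sum>\<alpha>\<in>?S. c \<alpha> * m \<alpha>)"
      unfolding m_def by (subst Bochner_Integration.integral_sum) (simp_all add: u)
    finally show ?thesis .
  qed
  \<comment> \<open>At zero signal only the constant Hermite product has a nonzero mean, by
    \<open>0 ^ 0 = 1\<close>.\<close>
  have zero: "(\<Prod>p\<in>J. (0 / \<sigma> p) ^ \<alpha> p) = of_bool (\<alpha> = \<alpha>0)" if \<alpha>: "\<alpha> \<in> ?S" for \<alpha>
  proof (cases "\<alpha> = \<alpha>0")
    case False
    then have "\<exists>p\<in>J. \<alpha> p \<noteq> 0" using index_eq[OF \<alpha> \<alpha>0] by (auto simp: \<alpha>0_def)
    then show ?thesis using False J by (auto simp: prod_zero_iff)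
  qed (simp add: \<alpha>0_def)
  have EQ: "Q.expectation (mp_eval f) = c \<alpha>0"
  proof -
    have "Q.expectation (mp_eval f) = (\<Sum>\<alpha>\<in>?S. c \<alpha> * (\<integral>y. ?H \<alpha> y \<partial>null_law))"
      unfolding f_eq by (subst Bochner_Integration.integral_sum) simp_all
    also have "\<dots> = (\<Sum>\<alpha>\<in>?S. if \<alpha> = \<alpha>0 then c \<alpha> else 0)"
      by (rule sum.cong[OF refl]) (simp add: H(2)[where \<mu>="\<lambda>_. 0"] zero[simplified])
    finally show ?thesis using \<alpha>0 fin by simp
  qed
  let ?S' = "?S - {\<alpha>0}"
  have var: "Q.variance (mp_eval f) = (\<Sum>\<alpha>\<in>?S'. (c \<alpha>)\<^sup>2 * F \<alpha>)"
  proof -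
    have H0: "?H \<alpha>0 y = 1" for y by (simp add: multi_hermite_def \<alpha>0_def)
    have "mp_eval f y - c \<alpha>0 = (\<Sum>\<alpha>\<in>?S'. c \<alpha> * ?H \<alpha> y)" for y
      unfolding c using fin \<alpha>0 by (simp add: sum.remove[of ?S \<alpha>0] H0)
    then have "Q.variance (mp_eval f) = (\<integral>y. (\<Sum>\<alpha>\<in>?S'. \<Sum>\<gamma>\<in>?S'. c \<alpha> * c \<gamma> * (?H \<alpha> y * ?H \<gamma> y)) \<partial>null_law)"
      unfolding EQ by (simp add: power2_eq_square sum_product mult_ac)
    also have "\<dots> = (\<Sum>\<alpha>\<in>?S'. \<Sum>\<gamma>\<in>?S'. c \<alpha> * c \<gamma> * (\<integral>y. ?H \<alpha> y * ?H \<gamma> y \<partial>null_law))"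
      by (simp add: Bochner_Integration.integral_sum)
    also have "\<dots> = (\<Sum>\<alpha>\<in>?S'. \<Sum>\<gamma>\<in>?S'. if \<alpha> = \<gamma> then (c \<alpha>)\<^sup>2 * F \<alpha> else 0)"
      by (intro sum.cong refl) (auto simp: H(4) index_eq F_def power2_eq_square)
    finally show ?thesis using fin by simp
  qed
  have m0: "m \<alpha>0 = 1" by (simp add: m_def u_def \<alpha>0_def M.prob_space)
  have "P.expectation (mp_eval f) - Q.expectation (mp_eval f) = (\<Sum>\<alpha>\<in>?S'. c \<alpha> * m \<alpha>)"
    unfolding EP EQ using fin \<alpha>0 by (simp add: sum.remove[of ?S \<alpha>0] m0)
  also have "\<dots> = (\<Sum>\<alpha>\<in>?S'. (c \<alpha> * sqrt (F \<alpha>)) * (m \<alpha> / sqrt (F \<alpha>)))"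
    using F by (intro sum.cong refl) (simp add: less_imp_neq[OF F, symmetric])
  finally have "(P.expectation (mp_eval f) - Q.expectation (mp_eval f))\<^sup>2 \<le>
      (\<Sum>\<alpha>\<in>?S'. (c \<alpha> * sqrt (F \<alpha>))\<^sup>2) * (\<Sum>\<alpha>\<in>?S'. (m \<alpha> / sqrt (F \<alpha>))\<^sup>2)"
    by (simp only: Cauchy_Schwarz_ineq_sum)
  also have "(\<Sum>\<alpha>\<in>?S'. (c \<alpha> * sqrt (F \<alpha>))\<^sup>2) = Q.variance (mp_eval f)"
    unfolding var using F by (intro sum.cong refl) (simp add: power_mult_distrib less_imp_le[OF F])
  also have "(\<Sum>\<alpha>\<in>?S'. (m \<alpha> / sqrt (F \<alpha>))\<^sup>2) = (\<Sum>\<alpha>\<in>?S'. (m \<alpha>)\<^sup>2 / F \<alpha>)"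
    by (intro sum.cong refl) (simp add: power_divide less_imp_le[OF F])
  finally have 1: "(P.expectation (mp_eval f) - Q.expectation (mp_eval f))\<^sup>2 \<le>
      Q.variance (mp_eval f) * (\<Sum>\<alpha>\<in>?S'. (m \<alpha>)\<^sup>2 / F \<alpha>)" .
  have overlap: "(\<Sum>\<alpha>\<in>?S. u \<alpha> x * u \<alpha> x' / F \<alpha>) = (\<Sum>d\<le>D. (\<Sum>p\<in>J. X x p * X x' p / (\<sigma> p)\<^sup>2) ^ d / fact d)" for x x'
  proof -
    have "u \<alpha> x * u \<alpha> x' / F \<alpha> = (\<Prod>p\<in>J. (X x p * X x' p / (\<sigma> p)\<^sup>2) ^ \<alpha> p / fact (\<alpha> p))" for \<alpha>
      unfolding u_def F_def prod.distrib[symmetric] prod_dividef[symmetric]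
      by (intro prod.cong refl) (simp add: power_divide power_mult_distrib power2_eq_square)
    then show ?thesis by (simp add: multinomial_sum[OF J])
  qed
  \<comment> \<open>Restoring the constant term adds exactly 1 and completes the index set for the
    multinomial identity.\<close>
  have "(\<Sum>\<alpha>\<in>?S'. (m \<alpha>)\<^sup>2 / F \<alpha>) \<le> (\<Sum>\<alpha>\<in>?S. (m \<alpha>)\<^sup>2 / F \<alpha>)"
    using fin by (intro sum_mono2) (auto simp: less_imp_le[OF F])
  also have "\<dots> = (\<integral>x. (\<integral>x'. (\<Sum>\<alpha>\<in>?S. u \<alpha> x * u \<alpha> x' / F \<alpha>) \<partial>M) \<partial>M)"
  proof -
    have "(\<integral>x'. (\<Sum>\<alpha>\<in>?S. u \<alpha> x * u \<alpha> x' / F \<alpha>) \<partial>M) = (\<Sum>\<alpha>\<in>?S. u \<alpha> x * m \<alpha> / F \<alpha>)" for x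
      unfolding m_def by (subst Bochner_Integration.integral_sum) (simp_all add: u)
    then have "(\<integral>x. (\<integral>x'. (\<Sum>\<alpha>\<in>?S. u \<alpha> x * u \<alpha> x' / F \<alpha>) \<partial>M) \<partial>M) = (\<integral>x. (\<Sum>\<alpha>\<in>?S. u \<alpha> x * m \<alpha> / F \<alpha>) \<partial>M)"
      by simp
    also have "\<dots> = (\<Sum>\<alpha>\<in>?S. m \<alpha> * m \<alpha> / F \<alpha>)"
      unfolding m_def by (subst Bochner_Integration.integral_sum) (simp_all add: u)
    finally show ?thesis by (simp add: power2_eq_square)
  qed
  finally have "(\<Sum>\<alpha>\<in>?S'. (m \<alpha>)\<^sup>2 / F \<alpha>) \<le>
      (\<integral>x. (\<integral>x'. (\<Sum>d\<le>D. (\<Sum>p\<in>J. X x p * X x' p / (\<sigma> p)\<^sup>2) ^ d / fact d) \<partial>M) \<partial>M)"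
    unfolding overlap .
  then have "Q.variance (mp_eval f) * (\<Sum>\<alpha>\<in>?S'. (m \<alpha>)\<^sup>2 / F \<alpha>) \<le> Q.variance (mp_eval f) *
      (\<integral>x. (\<integral>x'. (\<Sum>d\<le>D. (\<Sum>p\<in>J. X x p * X x' p / (\<sigma> p)\<^sup>2) ^ d / fact d) \<partial>M) \<partial>M)"
    by (rule mult_left_mono) (rule Bochner_Integration.integral_nonneg, simp)
  with 1 show ?thesis by (rule order_trans)
qed

end

end

subsection \<open>Moments of the prior\<close>

lemma integrable_power_of_even_moments:
  fixes \<nu> :: "real measure"
  assumes \<nu>: "prob_space \<nu>" and borel: "sets \<nu> = sets borel"
    and fin: "\<And>k. (\<integral>\<^sup>+x. ennreal (x ^ (2 * k)) \<partial>\<nu>) < \<infinity>"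
  shows "integrable \<nu> (\<lambda>x. x ^ k)"
proof -
  interpret prob_space \<nu> by (rule \<nu>)
  note [measurable_cong] = borel
  have "integrable \<nu> (\<lambda>x. x ^ (2 * k))"
    using fin[of k] by (intro integrableI_nonneg) (auto simp: zero_le_even_power')
  then have "integrable \<nu> (\<lambda>x. 1 + x ^ (2 * k))" by simp
  then show ?thesis
  proof (rule Bochner_Integration.integrable_bound)
    have "\<bar>y\<bar> \<le> 1 + y\<^sup>2" for y :: real
    proof -
      have "0 \<le> (\<bar>y\<bar> - 1)\<^sup>2" by simp
      then have "2 * \<bar>y\<bar> \<le> y\<^sup>2 + 1" by (simp add: power2_diff)
      then show ?thesis by simp
    qed
    then have "\<bar>x ^ k\<bar> \<le> 1 + x ^ (2 * k)" for x :: real by (metis power_even_eq)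
    then show "AE x in \<nu>. norm (x ^ k) \<le> norm (1 + x ^ (2 * k))"
      by (intro AE_I2) (simp add: zero_le_even_power')
  qed measurable
qed

lemma odd_moment_symmetric:
  fixes \<nu> :: "real measure"
  assumes borel: "sets \<nu> = sets borel" and sym: "distr \<nu> borel uminus = \<nu>" and k: "odd k"
  shows "(\<integral>x. x ^ k \<partial>\<nu>) = 0"
proof -
  note [measurable_cong] = borel
  have "(\<integral>x. x ^ k \<partial>\<nu>) = (\<integral>x. x ^ k \<partial>distr \<nu> borel uminus)" by (simp only: sym)
  also have "\<dots> = (\<integral>x. (- x) ^ k \<partial>\<nu>)" by (rule integral_distr) measurable
  also have "\<dots> = - (\<integral>x. x ^ k \<partial>\<nu>)" using k by simp
  finally show ?thesis by simp
qed

text \<open>This turns assumptions on the product \<open>x x'\<close> into bounds on squared moments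
  of \<open>\<nu>\<close>, the quantities that occur in replica moments.\<close>

lemma nn_integral_pair_power:
  fixes \<nu> :: "real measure"
  assumes \<nu>: "prob_space \<nu>" and borel: "sets \<nu> = sets borel"
  shows "(\<integral>\<^sup>+\<omega>. ennreal ((case \<omega> of (x, x') \<Rightarrow> x * x') ^ (2 * k)) \<partial>(\<nu> \<Otimes>\<^sub>M \<nu>)) =
    (\<integral>\<^sup>+x. ennreal (x ^ (2 * k)) \<partial>\<nu>)\<^sup>2"
proof -
  interpret prob_space \<nu> by (rule \<nu>)
  note [measurable_cong] = borel
  have "(\<integral>\<^sup>+\<omega>. ennreal ((case \<omega> of (x, x') \<Rightarrow> x * x') ^ (2 * k)) \<partial>(\<nu> \<Otimes>\<^sub>M \<nu>)) =
      (\<integral>\<^sup>+x. \<integral>\<^sup>+x'. ennreal (x ^ (2 * k)) * ennreal (x' ^ (2 * k)) \<partial>\<nu> \<partial>\<nu>)"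
    by (subst nn_integral_fst[symmetric])
       (simp_all add: power_mult_distrib ennreal_mult' zero_le_even_power')
  also have "\<dots> = (\<integral>\<^sup>+x. ennreal (x ^ (2 * k)) * (\<integral>\<^sup>+x'. ennreal (x' ^ (2 * k)) \<partial>\<nu>) \<partial>\<nu>)"
    by (intro nn_integral_cong nn_integral_cmult) measurable
  also have "\<dots> = (\<integral>\<^sup>+x. ennreal (x ^ (2 * k)) \<partial>\<nu>)\<^sup>2"
    unfolding power2_eq_square by (rule nn_integral_multc) measurable
  finally show ?thesis .
qed

lemma ennreal_square_le_imp_finite:
  fixes a :: ennreal assumes "a\<^sup>2 \<le> ennreal b" shows "a < \<infinity>"
  using assms by (cases a) (auto simp: power2_eq_square ennreal_mult_top top_unique)

lemma even_moment_square_le: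
  fixes \<nu> :: "real measure"
  assumes borel: "sets \<nu> = sets borel" and b: "b \<ge> 0"
    and le: "(\<integral>\<^sup>+x. ennreal (x ^ (2 * k)) \<partial>\<nu>)\<^sup>2 \<le> ennreal b"
  shows "(\<integral>x. x ^ (2 * k) \<partial>\<nu>)\<^sup>2 \<le> b"
proof -
  note [measurable_cong] = borel
  have "integrable \<nu> (\<lambda>x. x ^ (2 * k))"
    using ennreal_square_le_imp_finite[OF le]
    by (intro integrableI_nonneg) (auto simp: zero_le_even_power')
  then have "(\<integral>\<^sup>+x. ennreal (x ^ (2 * k)) \<partial>\<nu>) = ennreal (\<integral>x. x ^ (2 * k) \<partial>\<nu>)"
    by (intro nn_integral_eq_integral) (auto simp: zero_le_even_power')
  with le have "ennreal ((\<integral>x. x ^ (2 * k) \<partial>\<nu>)\<^sup>2) \<le> ennreal b"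
    by (simp add: ennreal_power zero_le_even_power')
  then show ?thesis using b by (simp add: ennreal_le_iff)
qed

lemma double_factorial_eq: "(\<Prod>i\<in>{1..k}. 2 * real i - 1) = fact (2 * k) / (2 ^ k * fact k)"
proof (induction k)
  case (Suc k)
  have "(\<Prod>i\<in>{1..Suc k}. 2 * real i - 1) = (2 * real k + 1) * (fact (2 * k) / (2 ^ k * fact k))"
    using Suc by (simp add: prod.nat_ivl_Suc')
  moreover have "fact (2 * Suc k) = (2 * real k + 2) * ((2 * real k + 1) * fact (2 * k))"
    by (simp add: algebra_simps)
  moreover have "2 ^ Suc k * fact (Suc k) = (2 * real k + 2) * (2 ^ k * fact k)"
    by (simp add: algebra_simps)
  ultimately show ?case by (simp del: fact_Suc power_Suc)
qed simp

text \<open>Double factorials are the even Gaussian moments, so the assumption on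
  \<open>x x'\<close> is the claim at even orders; odd moments of \<open>\<nu>\<close> vanish by
  symmetry.\<close>

lemma moments_of_moment_subgaussian:
  fixes \<nu> :: "real measure"
  assumes \<nu>: "prob_space \<nu>" and borel: "sets \<nu> = sets borel" and sym: "distr \<nu> borel uminus = \<nu>"
    and sub: "moment_subgaussian (\<nu> \<Otimes>\<^sub>M \<nu>) (\<lambda>(x, x'). x * x') 1"
  shows "integrable \<nu> (\<lambda>x. x ^ k)"
    and "(\<integral>x. x ^ k \<partial>\<nu>)\<^sup>2 \<le> (\<integral>g. g ^ k \<partial>std_gauss)"
proof -
  interpret prob_space \<nu> by (rule \<nu>)
  have le: "(\<integral>\<^sup>+x. ennreal (x ^ (2 * k)) \<partial>\<nu>)\<^sup>2 \<le> ennreal (\<integral>g. g ^ (2 * k) \<partial>std_gauss)" for k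
  proof (cases "k = 0")
    case True
    then show ?thesis using emeasure_space_1 by (simp add: std_gauss_moment_even[of 0, simplified])
  next
    case False
    then have "(\<integral>\<^sup>+x. ennreal (x ^ (2 * k)) \<partial>\<nu>)\<^sup>2 \<le> ennreal (1 ^ k * (\<Prod>i\<in>{1..k}. 2 * real i - 1))"
      using sub unfolding moment_subgaussian_def nn_integral_pair_power[OF \<nu> borel, symmetric] by auto
    then show ?thesis by (simp only: double_factorial_eq std_gauss_moment_even power_one mult_1_left)
  qed
  show "integrable \<nu> (\<lambda>x. x ^ k)"
    using ennreal_square_le_imp_finite[OF le] by (rule integrable_power_of_even_moments[OF \<nu> borel])
  show "(\<integral>x. x ^ k \<partial>\<nu>)\<^sup>2 \<le> (\<integral>g. g ^ k \<partial>std_gauss)"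
  proof (cases "even k")
    case True
    then obtain j where k: "k = 2 * j" by (rule evenE)
    show ?thesis unfolding k by (rule even_moment_square_le[OF borel std_gauss_moment_nonneg le])
  next
    case False
    then show ?thesis by (simp add: odd_moment_symmetric[OF borel sym] std_gauss_moment_nonneg)
  qed
qed

lemma power_le_fact_mult_exp: "y ^ n \<le> fact n * exp y" if "y \<ge> 0" for y :: real
proof -
  have "(\<Sum>k\<in>{n}. y ^ k /\<^sub>R fact k) \<le> suminf (\<lambda>k. y ^ k /\<^sub>R fact k)"
    using that summable_exp_generic[of y] by (intro sum_le_suminf) auto
  then have "y ^ n /\<^sub>R fact n \<le> exp y" by (simp add: exp_def)
  then show ?thesis by (simp add: field_simps)
qed

lemma subgaussian_even_moment:
  fixes \<nu> :: "real measure"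
  assumes \<nu>: "prob_space \<nu>" and borel: "sets \<nu> = sets borel" and s: "s > 0" and k: "k \<ge> 1"
    and sub: "subgaussian (\<nu> \<Otimes>\<^sub>M \<nu>) (\<lambda>(x, x'). x * x') s"
  shows "(\<integral>\<^sup>+x. ennreal (x ^ (2 * k)) \<partial>\<nu>)\<^sup>2 \<le> ennreal ((2 * exp 1 * s) ^ k * (\<integral>g. g ^ (2 * k) \<partial>std_gauss))"
proof -
  note [measurable_cong] = borel
  let ?z = "\<lambda>\<omega>::real \<times> real. case \<omega> of (x, x') \<Rightarrow> x * x'"
  let ?M = "\<nu> \<Otimes>\<^sub>M \<nu>"
  \<comment> \<open>This \<open>t\<close> minimises
    \<open>exp (s / 2 * t\<^sup>2) / t ^ (2 * k)\<close>, and there the exponential moment is at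
    most \<open>exp k\<close>.\<close>
  define t where "t = sqrt (2 * k / s)"
  have t: "t > 0" "t\<^sup>2 = 2 * k / s" using s k by (auto simp: t_def)
  have mgf: "(\<integral>\<^sup>+\<omega>. ennreal (exp (u * ?z \<omega>)) \<partial>?M) \<le> ennreal (exp k)" if "u\<^sup>2 = t\<^sup>2" for u
  proof -
    have "(\<integral>\<^sup>+\<omega>. ennreal (exp (u * ?z \<omega>)) \<partial>?M) \<le> ennreal (exp (s / 2 * u\<^sup>2))"
      using sub by (simp add: subgaussian_def)
    also have "s / 2 * u\<^sup>2 = k" using s t that by simp
    finally show ?thesis .
  qed
  have pt: "(?z \<omega>) ^ (2 * k) \<le> fact (2 * k) / t ^ (2 * k) * (exp (t * ?z \<omega>) + exp (- t * ?z \<omega>))" for \<omega>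
  proof -
    have "\<bar>t * ?z \<omega>\<bar> ^ (2 * k) \<le> fact (2 * k) * exp \<bar>t * ?z \<omega>\<bar>" by (rule power_le_fact_mult_exp) simp
    also have "exp \<bar>t * ?z \<omega>\<bar> \<le> exp (t * ?z \<omega>) + exp (- t * ?z \<omega>)" by (auto simp: abs_if)
    finally have "(t * ?z \<omega>) ^ (2 * k) \<le> fact (2 * k) * (exp (t * ?z \<omega>) + exp (- t * ?z \<omega>))"
      by (simp add: power_even_abs)
    then show ?thesis using t by (simp add: power_mult_distrib field_simps)
  qed
  have "(\<integral>\<^sup>+x. ennreal (x ^ (2 * k)) \<partial>\<nu>)\<^sup>2 = (\<integral>\<^sup>+\<omega>. ennreal ((?z \<omega>) ^ (2 * k)) \<partial>?M)"
    by (rule nn_integral_pair_power[OF \<nu> borel, symmetric])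
  also have "\<dots> \<le> (\<integral>\<^sup>+\<omega>. ennreal (fact (2 * k) / t ^ (2 * k)) *
      (ennreal (exp (t * ?z \<omega>)) + ennreal (exp (- t * ?z \<omega>))) \<partial>?M)"
    using pt t by (intro nn_integral_mono) (simp add: ennreal_mult'[symmetric] ennreal_plus[symmetric] del: ennreal_plus)
  also have "\<dots> = ennreal (fact (2 * k) / t ^ (2 * k)) *
      ((\<integral>\<^sup>+\<omega>. ennreal (exp (t * ?z \<omega>)) \<partial>?M) + (\<integral>\<^sup>+\<omega>. ennreal (exp (- t * ?z \<omega>)) \<partial>?M))"
    by (subst nn_integral_cmult, measurable, subst nn_integral_add, measurable)
  also have "\<dots> \<le> ennreal (fact (2 * k) / t ^ (2 * k)) * (ennreal (exp k) + ennreal (exp k))"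
    by (intro mult_left_mono add_mono mgf) auto
  also have "\<dots> = ennreal (fact (2 * k) / t ^ (2 * k) * (2 * exp k))"
    using t by (simp add: ennreal_mult'[symmetric] ennreal_plus[symmetric] del: ennreal_plus)
  also have "\<dots> \<le> ennreal ((2 * exp 1 * s) ^ k * (\<integral>g. g ^ (2 * k) \<partial>std_gauss))"
  proof (rule ennreal_leI)
    \<comment> \<open>\<open>k! \<le> k^k\<close> compares the result with the Gaussian moment
      \<open>(2k)! / (2^k k!)\<close>. The factor 2 from the two exponentials is absorbed by
      \<open>2 ^ k\<close>, whence the base \<open>2 * exp 1 * s\<close>.\<close>
    have "fact k \<le> (real k) ^ k" using fact_le_power[of k] by simp
    moreover have "(2 :: real) \<le> 2 ^ k" using k by (simp add: self_le_power)
    ultimately have "2 * fact k \<le> 2 ^ k * (real k) ^ k" by (intro mult_mono) auto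
    then have "2 / (real k) ^ k \<le> 2 ^ k / fact k" using k by (simp add: field_simps)
    then have "fact (2 * k) * (exp 1 * s) ^ k / 2 ^ k * (2 / (real k) ^ k) \<le>
        fact (2 * k) * (exp 1 * s) ^ k / 2 ^ k * (2 ^ k / fact k)"
      using s by (intro mult_left_mono) auto
    also have "\<dots> = (2 * exp 1 * s) ^ k * (fact (2 * k) / (2 ^ k * fact k))"
      by (simp add: power_mult_distrib)
    finally show "fact (2 * k) / t ^ (2 * k) * (2 * exp k) \<le> (2 * exp 1 * s) ^ k * (\<integral>g. g ^ (2 * k) \<partial>std_gauss)"
      unfolding std_gauss_moment_even power_mult[of t 2 k] t(2)
      using s k by (simp add: power_divide power_mult_distrib exp_of_nat_mult[symmetric] field_simps)
  qed
  finally show ?thesis .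
qed

text \<open>The mixture has second moment exactly 1, so order two is the variance assumption. At
  order \<open>2 * j\<close> with \<open>j \<ge> 2\<close> its factor \<open>K ^ (j - 1)\<close>
  must dominate \<open>(2 * exp 1 * s) ^ j\<close>; taking \<open>K\<close> as a square suffices
  because \<open>j \<le> 2 * (j - 1)\<close>.\<close>

lemma moments_of_subgaussian:
  fixes \<nu> :: "real measure"
  assumes \<nu>: "prob_space \<nu>" and borel: "sets \<nu> = sets borel" and sym: "distr \<nu> borel uminus = \<nu>"
    and var: "integrable \<nu> (\<lambda>x. x\<^sup>2)" "(\<integral>x. x\<^sup>2 \<partial>\<nu>) \<le> 1"
    and s: "s > 0" and sub: "subgaussian (\<nu> \<Otimes>\<^sub>M \<nu>) (\<lambda>(x, x'). x * x') s"
  defines "K \<equiv> (max 1 (2 * exp 1 * s))\<^sup>2"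
  shows "K \<ge> 1" and "integrable \<nu> (\<lambda>x. x ^ k)"
    and "(\<integral>x. x ^ k \<partial>\<nu>)\<^sup>2 \<le> ((1 - 1 / K) * 0 ^ k + 1 / K * sqrt K ^ k) * (\<integral>g. g ^ k \<partial>std_gauss)"
proof -
  interpret prob_space \<nu> by (rule \<nu>)
  let ?a = "max 1 (2 * exp 1 * s)"
  show K: "K \<ge> 1" unfolding K_def by (simp add: one_le_power)
  have le: "(\<integral>\<^sup>+x. ennreal (x ^ (2 * k)) \<partial>\<nu>)\<^sup>2 \<le> ennreal ((2 * exp 1 * s) ^ k * (\<integral>g. g ^ (2 * k) \<partial>std_gauss))"
    if "k \<ge> 1" for k using subgaussian_even_moment[OF \<nu> borel s that sub] .
  have "(\<integral>\<^sup>+x. ennreal (x ^ (2 * k)) \<partial>\<nu>) < \<infinity>" for k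
  proof (cases "k = 0")
    case True
    then show ?thesis using emeasure_space_1 by simp
  next
    case False
    then show ?thesis using ennreal_square_le_imp_finite[OF le[of k]] by simp
  qed
  then show "integrable \<nu> (\<lambda>x. x ^ k)" by (rule integrable_power_of_even_moments[OF \<nu> borel])
  show "(\<integral>x. x ^ k \<partial>\<nu>)\<^sup>2 \<le> ((1 - 1 / K) * 0 ^ k + 1 / K * sqrt K ^ k) * (\<integral>g. g ^ k \<partial>std_gauss)"
  proof (cases "even k")
    case False
    then show ?thesis by (simp add: odd_moment_symmetric[OF borel sym] std_gauss_moment_odd)
  next
    case True
    then obtain j where k: "k = 2 * j" by (rule evenE)
    have sK: "sqrt K ^ (2 * j) = K ^ j" using K by (simp add: power_mult)
    consider "j = 0" | "j = 1" | "j \<ge> 2" by linarith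
    then show ?thesis
    proof cases
      case 1
      then show ?thesis using K std_gauss_moment_even[of 0] prob_space by (simp add: k)
    next
      case 2
      have "0 \<le> (\<integral>x. x\<^sup>2 \<partial>\<nu>)" by simp
      then have "(\<integral>x. x\<^sup>2 \<partial>\<nu>)\<^sup>2 \<le> 1" using var(2) by (simp add: power_le_one)
      then show ?thesis using K std_gauss_moment_even[of 1] by (simp add: k 2)
    next
      case 3
      have "(2 * exp 1 * s) ^ j \<le> ?a ^ j" using s by (intro power_mono) auto
      also have "\<dots> \<le> ?a ^ (2 * (j - 1))" using 3 by (intro power_increasing) auto
      also have "\<dots> = K ^ (j - 1)" by (simp add: K_def power_mult)
      also have "\<dots> = 1 / K * K ^ j" using K 3 by (simp add: power_diff)
      finally have *: "(2 * exp 1 * s) ^ j \<le> 1 / K * K ^ j" .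
      have "(\<integral>x. x ^ (2 * j) \<partial>\<nu>)\<^sup>2 \<le> (2 * exp 1 * s) ^ j * (\<integral>g. g ^ (2 * j) \<partial>std_gauss)"
        using 3 s by (intro even_moment_square_le[OF borel _ le] mult_nonneg_nonneg std_gauss_moment_nonneg) auto
      also have "\<dots> \<le> 1 / K * K ^ j * (\<integral>g. g ^ (2 * j) \<partial>std_gauss)"
        by (rule mult_right_mono[OF * std_gauss_moment_nonneg])
      finally show ?thesis using 3 unfolding k sK by (simp add: power_0_left)
    qed
  qed
qed

subsection \<open>The spiked Wigner model\<close>

definition noise_sd :: "ennreal mat \<Rightarrow> nat \<times> nat \<Rightarrow> real" where
  "noise_sd \<Delta> p = sqrt (enn2real (\<Delta> $$ p))"

definition spike :: "real \<Rightarrow> nat \<Rightarrow> (nat \<Rightarrow> real) \<Rightarrow> nat \<times> nat \<Rightarrow> real" where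
  "spike \<beta> N x p = \<beta> / sqrt (real N) * (x (fst p) * x (snd p))"

definition overlap_coeff :: "ennreal mat \<Rightarrow> real \<Rightarrow> nat \<Rightarrow> nat \<times> nat \<Rightarrow> real" where
  "overlap_coeff \<Delta> \<beta> N p = \<beta>\<^sup>2 / N / (noise_sd \<Delta> p)\<^sup>2"

lemma null_model_eq: "null_model \<Delta> = (\<Pi>\<^sub>M p\<in>observed \<Delta>. gauss 0 (noise_sd \<Delta> p))"
  by (simp add: null_model_def gaussian_obs_def noise_sd_def)

lemma spike_overlap:
  assumes "N > 0"
  shows "(\<Sum>p\<in>J. spike \<beta> N x p * spike \<beta> N x' p / (noise_sd \<Delta> p)\<^sup>2) =
    pair_form J (overlap_coeff \<Delta> \<beta> N) (\<lambda>i. x i * x' i)"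
proof -
  have "spike \<beta> N x p * spike \<beta> N x' p = \<beta>\<^sup>2 / N * ((x (fst p) * x' (fst p)) * (x (snd p) * x' (snd p)))" for p
    using assms by (simp add: spike_def power2_eq_square)
  then show ?thesis by (simp add: pair_form_def overlap_coeff_def)
qed

context
  fixes N :: nat and \<Delta> :: "ennreal mat" and \<nu> :: "real measure" and \<beta> :: real
  assumes N: "N \<ge> 1" and profile: "variance_profile N \<Delta>"
    and \<nu>: "prob_space \<nu>" and borel: "sets \<nu> = sets borel"
begin

private abbreviation (input) "J \<equiv> observed \<Delta>"
private abbreviation (input) "\<sigma> \<equiv> noise_sd \<Delta>"
private abbreviation (input) "prior \<equiv> \<Pi>\<^sub>M i\<in>{..<N}. \<nu>"

private lemma J_subset: "J \<subseteq> {..<N} \<times> {..<N}"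
  using profile by (auto simp: observed_def variance_profile_def)

private lemma finite_J: "finite J"
  using J_subset by (rule finite_subset) simp

private lemma sd_pos: "p \<in> J \<Longrightarrow> \<sigma> p > 0"
  using profile
  by (cases p) (auto simp: observed_def variance_profile_def noise_sd_def enn2real_positive_iff less_top)

private lemma prob_space_prior: "prob_space prior"
  by (intro prob_space_PiM \<nu>)

private lemma measurable_component: "i < N \<Longrightarrow> (\<lambda>x. x i) \<in> borel_measurable prior"
  using measurable_component_singleton[of i "{..<N}" "\<lambda>_. \<nu>"] measurable_cong_sets[OF refl borel] by blast

private lemma measurable_spike:
  assumes "p \<in> J" shows "(\<lambda>x. spike \<beta> N x p) \<in> borel_measurable prior"
proof -
  have [measurable]: "(\<lambda>x. x (fst p)) \<in> borel_measurable prior" "(\<lambda>x. x (snd p)) \<in> borel_measurable prior"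
    using J_subset assms by (auto intro!: measurable_component)
  show ?thesis unfolding spike_def by measurable
qed

text \<open>The random matrix is replaced by the vector \<open>x\<close> as latent variable.
  Measurability of the kernel on matrices is the general statement with the identity as signal
  map.\<close>

lemma planted_model_eq:
  "planted_model (spike_law \<nu> \<beta> N) \<Delta> = prior \<bind> (\<lambda>x. \<Pi>\<^sub>M p\<in>J. gauss (spike \<beta> N x p) (\<sigma> p))"
proof -
  let ?S = "\<Pi>\<^sub>M p\<in>{..<N} \<times> {..<N}. borel :: real measure"
  let ?X = "\<lambda>x. \<lambda>(i, j)\<in>{..<N} \<times> {..<N}. \<beta> / sqrt (real N) * (x i * x j)"
  have X: "?X \<in> measurable prior ?S"
  proof (rule measurable_restrict)
    fix p assume "p \<in> {..<N} \<times> {..<N}"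
    then have [measurable]: "(\<lambda>x. x (fst p)) \<in> borel_measurable prior" "(\<lambda>x. x (snd p)) \<in> borel_measurable prior"
      by (auto intro!: measurable_component)
    show "(\<lambda>x. case p of (i, j) \<Rightarrow> \<beta> / sqrt (real N) * (x i * x j)) \<in> borel_measurable prior"
      unfolding split_beta by measurable
  qed
  have kernel: "gaussian_obs \<Delta> \<in> measurable ?S (subprob_algebra (\<Pi>\<^sub>M p\<in>J. gauss 0 (\<sigma> p)))"
  proof -
    have "(\<lambda>z. \<Pi>\<^sub>M p\<in>J. gauss (z p) (\<sigma> p)) \<in>
        measurable (spike_law \<nu> \<beta> N) (subprob_algebra (\<Pi>\<^sub>M p\<in>J. gauss 0 (\<sigma> p)))"
    proof (rule obs_kernel_measurable[OF finite_J sd_pos, where X="\<lambda>z. z"])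
      show "prob_space (spike_law \<nu> \<beta> N)"
        unfolding spike_law_def using prob_space_prior X by (rule prob_space.prob_space_distr)
      show "(\<lambda>z. z p) \<in> borel_measurable (spike_law \<nu> \<beta> N)" if "p \<in> J" for p
        unfolding spike_law_def using that J_subset by auto
    qed
    moreover have "measurable (spike_law \<nu> \<beta> N) L = measurable ?S L" for L :: "(nat \<times> nat \<Rightarrow> real) measure measure"
      by (rule measurable_cong_sets) (simp_all add: spike_law_def)
    moreover have "gaussian_obs \<Delta> = (\<lambda>z. \<Pi>\<^sub>M p\<in>J. gauss (z p) (\<sigma> p))"
      by (simp add: fun_eq_iff gaussian_obs_def noise_sd_def)
    ultimately show ?thesis by simp
  qed
  have "planted_model (spike_law \<nu> \<beta> N) \<Delta> = prior \<bind> (\<lambda>x. gaussian_obs \<Delta> (?X x))"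
    unfolding planted_model_def spike_law_def
    by (rule bind_distr[OF X kernel]) (rule prob_space.not_empty[OF prob_space_prior])
  also have "(\<lambda>x. gaussian_obs \<Delta> (?X x)) = (\<lambda>x. \<Pi>\<^sub>M p\<in>J. gauss (spike \<beta> N x p) (\<sigma> p))"
  proof
    fix x
    show "gaussian_obs \<Delta> (?X x) = (\<Pi>\<^sub>M p\<in>J. gauss (spike \<beta> N x p) (\<sigma> p))"
      unfolding gaussian_obs_def noise_sd_def
    proof (rule PiM_cong[OF refl])
      fix p assume "p \<in> J"
      then have "p \<in> {..<N} \<times> {..<N}" using J_subset by auto
      then have "?X x p = spike \<beta> N x p" by (auto simp: spike_def split_beta)
      then show "gauss (?X x p) (sqrt (enn2real (\<Delta> $$ p))) = gauss (spike \<beta> N x p) (sqrt (enn2real (\<Delta> $$ p)))"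
        by (rule arg_cong)
    qed
  qed
  finally show ?thesis .
qed

lemma planted_model_prob_space:
  "prob_space (planted_model (spike_law \<nu> \<beta> N) \<Delta>) \<and>
    sets (planted_model (spike_law \<nu> \<beta> N) \<Delta>) = sets (null_model \<Delta>)"
  unfolding planted_model_eq null_model_eq
  by (intro conjI prob_space_planted sets_planted finite_J sd_pos prob_space_prior measurable_spike)

lemma overlap_coeff_nonneg: "0 \<le> overlap_coeff \<Delta> \<beta> N p"
  by (simp add: overlap_coeff_def)

private lemma dim_profile: "dim_row \<Delta> = N" "dim_col \<Delta> = N"
  using profile by (auto simp: variance_profile_def)

lemma recip_profile_index:
  assumes "i < N" "j < N"
  shows "recip_profile \<Delta> $$ (i, j) = enn2real (1 / \<Delta> $$ (i, j))"
  using assms by (simp add: recip_profile_def dim_profile)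

lemma recip_profile_sym:
  assumes "i < N" "j < N"
  shows "recip_profile \<Delta> $$ (i, j) = recip_profile \<Delta> $$ (j, i)"
proof -
  have "\<Delta> $$ (i, j) = transpose_mat \<Delta> $$ (i, j)" using profile by (simp add: variance_profile_def)
  also have "\<dots> = \<Delta> $$ (j, i)" using assms by (simp add: dim_profile)
  finally show ?thesis using assms by (simp add: recip_profile_index)
qed

lemma recip_profile_nonneg:
  assumes "i < N" "j < N" shows "0 \<le> recip_profile \<Delta> $$ (i, j)"
  using assms by (simp add: recip_profile_index)

lemma enn2real_recip: "enn2real (1 / v) = 1 / enn2real v" if "0 < v" "v \<noteq> \<infinity>" for v :: ennreal
proof -
  define r where "r = enn2real v"
  have "v < \<infinity>" using that by (simp add: less_top)
  then have r: "v = ennreal r" "0 < r" using that by (simp_all add: r_def enn2real_positive_iff)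
  then have "1 / v = ennreal (1 / r)" using divide_ennreal[of 1 r] by simp
  then show ?thesis using r by simp
qed

text \<open>Each diagonal entry of the profile is counted twice: the overlap sums over \<open>i \<le> j\<close>, while a
  quadratic form counts every off-diagonal pair twice.\<close>

lemma sym_coeff_overlap:
  assumes i: "i < N" and j: "j < N"
  shows "sym_coeff J (overlap_coeff \<Delta> \<beta> N) i j =
    \<beta>\<^sup>2 / N * (recip_profile \<Delta> $$ (i, j) + (if i = j then recip_profile \<Delta> $$ (i, j) else 0))"
proof -
  have *: "(if (i, j) \<in> J then overlap_coeff \<Delta> \<beta> N (i, j) else 0) =
      (if i \<le> j then \<beta>\<^sup>2 / N * recip_profile \<Delta> $$ (i, j) else 0)" if "i < N" "j < N" for i j
  proof (cases "i \<le> j \<and> \<Delta> $$ (i, j) \<noteq> \<infinity>")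
    case True
    then have "(i, j) \<in> J" using that profile by (auto simp: observed_def variance_profile_def)
    moreover have "0 < \<Delta> $$ (i, j)" using that profile by (simp add: variance_profile_def)
    ultimately show ?thesis using True that
      by (simp add: overlap_coeff_def noise_sd_def recip_profile_index enn2real_recip)
  next
    case False
    then have "(i, j) \<notin> J" by (auto simp: observed_def)
    then show ?thesis using False that by (auto simp: recip_profile_index)
  qed
  show ?thesis unfolding sym_coeff_def *[OF i j] *[OF j i] recip_profile_sym[OF j i] by auto
qed

section \<open>Bounds at a fixed size, below the threshold\<close>

context
  fixes B \<epsilon> :: real
  assumes B: "B > 0" and lower: "\<And>i j. i < N \<Longrightarrow> j < N \<Longrightarrow> \<Delta> $$ (i, j) \<ge> ennreal (1 / B)"
    and \<beta>: "\<beta> > 0" and \<epsilon>: "\<epsilon> > 0"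
    and gap: "\<beta>\<^sup>2 / N * (largest_eigenvalue (recip_profile \<Delta>) + B) \<le> 1 - \<epsilon>"
    and int: "\<And>k. integrable \<nu> (\<lambda>x. x ^ k)"
begin

private abbreviation (input) "C \<equiv> 2 * B * \<beta>\<^sup>2"

lemma recip_profile_le: 
  assumes "i < N" "j < N" shows "recip_profile \<Delta> $$ (i, j) \<le> B"
proof (cases "\<Delta> $$ (i, j) = \<infinity>")
  case False
  have pos: "0 < \<Delta> $$ (i, j)" using profile assms by (simp add: variance_profile_def)
  have "1 / B \<le> enn2real (\<Delta> $$ (i, j))"
    using lower[OF assms] B False by (cases "\<Delta> $$ (i, j)") auto
  moreover have "0 < 1 / B" using B by simp
  ultimately have "1 / enn2real (\<Delta> $$ (i, j)) \<le> 1 / (1 / B)"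
    by (intro divide_left_mono mult_pos_pos) linarith+
  then show ?thesis using assms pos False by (simp add: recip_profile_index enn2real_recip)
qed (use assms B in \<open>simp add: recip_profile_index\<close>)

lemma sym_coeff_le:
  assumes "i < N" "j < N"
  shows "sym_coeff J (overlap_coeff \<Delta> \<beta> N) i j \<le> C / N"
proof -
  let ?\<Phi> = "recip_profile \<Delta> $$ (i, j)"
  have "?\<Phi> + (if i = j then ?\<Phi> else 0) \<le> 2 * B"
    using recip_profile_le[OF assms] recip_profile_nonneg[OF assms] B by auto
  then have "\<beta>\<^sup>2 / N * (?\<Phi> + (if i = j then ?\<Phi> else 0)) \<le> \<beta>\<^sup>2 / N * (2 * B)"
    by (intro mult_left_mono) auto
  then show ?thesis unfolding sym_coeff_overlap[OF assms] by (simp add: mult_ac)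
qed

text \<open>The form of the reciprocal profile is controlled by its largest eigenvalue; the extra
  copy of the diagonal contributes at most \<open>B\<close>, which is why \<open>gap\<close> carries
  \<open>+ B\<close>.\<close>

lemma quad_form_sym_coeff_le:
  "quad_form {..<N} (sym_coeff J (overlap_coeff \<Delta> \<beta> N)) x \<le> (1 - \<epsilon>) * (\<Sum>i<N. (x i)\<^sup>2)"
proof -
  let ?\<Phi> = "\<lambda>i j. recip_profile \<Delta> $$ (i, j)"
  let ?S = "\<Sum>i<N. (x i)\<^sup>2"
  have S: "?S \<ge> 0" by (simp add: sum_nonneg)
  have carrier: "recip_profile \<Delta> \<in> carrier_mat N N"
    using profile by (simp add: recip_profile_def variance_profile_def)
  have "transpose_mat (recip_profile \<Delta>) = recip_profile \<Delta>"
    using carrier recip_profile_sym by (intro eq_matI) auto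
  then have top: "quad_form {..<N} ?\<Phi> x \<le> largest_eigenvalue (recip_profile \<Delta>) * ?S"
    using N by (intro quad_form_le_largest_eigenvalue[OF carrier]) auto
  have "quad_form {..<N} (sym_coeff J (overlap_coeff \<Delta> \<beta> N)) x =
      (\<Sum>i<N. \<beta>\<^sup>2 / N * ((\<Sum>j<N. ?\<Phi> i j * x i * x j) + ?\<Phi> i i * (x i)\<^sup>2))"
    unfolding quad_form_def
  proof (rule sum.cong[OF refl])
    fix i assume i: "i \<in> {..<N}"
    have "(\<Sum>j<N. sym_coeff J (overlap_coeff \<Delta> \<beta> N) i j * x i * x j) =
        (\<Sum>j<N. \<beta>\<^sup>2 / N * (?\<Phi> i j * x i * x j + (if i = j then ?\<Phi> i i * (x i)\<^sup>2 else 0)))"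
      using i by (intro sum.cong refl) (auto simp: sym_coeff_overlap algebra_simps power2_eq_square)
    also have "\<dots> = \<beta>\<^sup>2 / N * ((\<Sum>j<N. ?\<Phi> i j * x i * x j) + ?\<Phi> i i * (x i)\<^sup>2)"
      using i unfolding sum_distrib_left[symmetric] sum.distrib by simp
    finally show "(\<Sum>j<N. sym_coeff J (overlap_coeff \<Delta> \<beta> N) i j * x i * x j) =
        \<beta>\<^sup>2 / N * ((\<Sum>j<N. ?\<Phi> i j * x i * x j) + ?\<Phi> i i * (x i)\<^sup>2)" .
  qed
  also have "\<dots> = \<beta>\<^sup>2 / N * (quad_form {..<N} ?\<Phi> x + (\<Sum>i<N. ?\<Phi> i i * (x i)\<^sup>2))"
    unfolding sum_distrib_left[symmetric] sum.distrib quad_form_def ..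
  also have "\<dots> \<le> \<beta>\<^sup>2 / N * (largest_eigenvalue (recip_profile \<Delta>) * ?S + B * ?S)"
  proof (intro mult_left_mono add_mono top)
    show "(\<Sum>i<N. ?\<Phi> i i * (x i)\<^sup>2) \<le> B * ?S"
      unfolding sum_distrib_left using recip_profile_le by (intro sum_mono mult_right_mono) auto
  qed simp
  also have "\<dots> = \<beta>\<^sup>2 / N * (largest_eigenvalue (recip_profile \<Delta>) + B) * ?S"
    by (simp only: distrib_right mult.assoc)
  also have "\<dots> \<le> (1 - \<epsilon>) * ?S" using gap S by (rule mult_right_mono)
  finally show ?thesis .
qed

private lemma C_pos: "C > 0"
  using B \<beta> by simp

private abbreviation (input) "U \<equiv> 1 + C / \<epsilon>"
private abbreviation (input) "rep_moment \<equiv> replica_moment \<nu> {..<N} J (overlap_coeff \<Delta> \<beta> N)"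

lemma replica_moment_nonneg: "0 \<le> rep_moment d"
  unfolding replica_moment_eq(2)[OF finite_lessThan J_subset \<nu> int]
  by (intro sum_nonneg mult_nonneg_nonneg prod_nonneg ballI overlap_coeff_nonneg zero_le_power2)

private abbreviation (input) "overlap \<equiv> \<lambda>x x'. pair_form J (overlap_coeff \<Delta> \<beta> N) (\<lambda>i. x i * x' i)"

lemma integrable_overlap_power: "integrable prior (\<lambda>x'. overlap x x' ^ d)"
  by (rule pair_form_moment(1)[OF finite_lessThan J_subset \<nu> int])

lemma integral_overlap_partial_sum:
  "(\<integral>x. (\<integral>x'. (\<Sum>d\<le>D. overlap x x' ^ d / fact d) \<partial>prior) \<partial>prior) = (\<Sum>d\<le>D. rep_moment d / fact d)"
proof -
  have "(\<integral>x'. (\<Sum>d\<le>D. overlap x x' ^ d / fact d) \<partial>prior) = (\<Sum>d\<le>D. (\<integral>x'. overlap x x' ^ d \<partial>prior) / fact d)" for x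
    by (subst Bochner_Integration.integral_sum) (simp_all only: integrable_divide integrable_overlap_power integral_divide_zero)
  moreover have "(\<integral>x. (\<Sum>d\<le>D. (\<integral>x'. overlap x x' ^ d \<partial>prior) / fact d) \<partial>prior) = (\<Sum>d\<le>D. rep_moment d / fact d)"
    by (subst Bochner_Integration.integral_sum)
       (simp_all only: integrable_divide replica_moment_eq(1)[OF finite_lessThan J_subset \<nu> int]
          integral_divide_zero replica_moment_def)
  ultimately show ?thesis by simp
qed

text \<open>Regrouping the product over pairs by coordinate leaves a product of powers of
  independent entries.\<close>

lemma integrable_spike_monomial: "integrable prior (\<lambda>x. \<Prod>p\<in>J. (spike \<beta> N x p / \<sigma> p) ^ \<alpha> p)"
proof -
  interpret product_prob_space "\<lambda>_. \<nu>" by (rule product_prob_spaceI) (rule \<nu>)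
  let ?k = "\<lambda>i. \<Sum>p\<in>J. (of_bool (fst p = i) + of_bool (snd p = i)) * \<alpha> p"
  have single: "(\<Prod>i<N. y i ^ (of_bool (a = i) * n)) = y a ^ n" if "a < N" for a n and y :: "nat \<Rightarrow> real"
  proof -
    have "(\<Prod>i<N. y i ^ (of_bool (a = i) * n)) = (\<Prod>i<N. if a = i then y i ^ n else 1)"
      by (intro prod.cong) auto
    then show ?thesis using that by simp
  qed
  have "(\<Prod>p\<in>J. (spike \<beta> N x p / \<sigma> p) ^ \<alpha> p) =
      (\<Prod>p\<in>J. (\<beta> / sqrt (real N) / \<sigma> p) ^ \<alpha> p) * (\<Prod>i<N. x i ^ ?k i)" for x
  proof -
    have "(\<Prod>i<N. x i ^ ?k i) = (\<Prod>p\<in>J. \<Prod>i<N. x i ^ ((of_bool (fst p = i) + of_bool (snd p = i)) * \<alpha> p))"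
      unfolding power_sum by (rule prod.swap)
    also have "\<dots> = (\<Prod>p\<in>J. (x (fst p) * x (snd p)) ^ \<alpha> p)"
    proof (rule prod.cong[OF refl])
      fix p assume "p \<in> J"
      then have "fst p < N" "snd p < N" using J_subset by auto
      then show "(\<Prod>i<N. x i ^ ((of_bool (fst p = i) + of_bool (snd p = i)) * \<alpha> p)) = (x (fst p) * x (snd p)) ^ \<alpha> p"
        by (simp only: distrib_right power_add prod.distrib single power_mult_distrib)
    qed
    finally show ?thesis
      by (simp add: prod.distrib[symmetric] spike_def power_mult_distrib[symmetric])
  qed
  moreover have "integrable prior (\<lambda>x. \<Prod>i<N. x i ^ ?k i)"
    by (rule product_integrable_prod[where f="\<lambda>i x. x ^ ?k i"]) (simp_all add: int)
  ultimately show ?thesis by simp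
qed

lemma measurable_overlap: "(\<lambda>(x, x'). overlap x x') \<in> borel_measurable (prior \<Otimes>\<^sub>M prior)"
proof -
  have [measurable]: "(\<lambda>z. fst z i) \<in> borel_measurable (prior \<Otimes>\<^sub>M prior)"
      "(\<lambda>z. snd z i) \<in> borel_measurable (prior \<Otimes>\<^sub>M prior)" if "i < N" for i
    using measurable_compose[OF measurable_fst measurable_component[OF that]]
      measurable_compose[OF measurable_snd measurable_component[OF that]] by auto
  have "fst p < N" "snd p < N" if "p \<in> J" for p using that J_subset by auto
  then show ?thesis unfolding pair_form_def split_beta by measurable
qed

text \<open>Bounding \<open>exp\<close> by \<open>2 cosh\<close> leaves only even powers of the overlap, which are nonnegative, so that
  monotone convergence applies.\<close>

lemma nn_integral_exp_overlap_le:
  assumes le: "\<And>D. (\<Sum>d\<le>D. rep_moment d / fact d) \<le> K"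
  shows "(\<integral>\<^sup>+x. \<integral>\<^sup>+x'. ennreal (exp (overlap x x')) \<partial>prior \<partial>prior) \<le> ennreal (2 * K)"
proof -
  interpret prob_space prior by (rule prob_space_prior)
  note [measurable] = measurable_overlap
  define a where "a n w = (if even n then 2 * (w ^ n / fact n) else 0)" for n and w :: real
  have a0: "0 \<le> a n w" for n w by (simp add: a_def zero_le_even_power)
  have a_meas [measurable]: "a n \<in> borel_measurable borel" for n unfolding a_def by (cases "even n") auto
  have meas1 [measurable]: "(\<lambda>x'. overlap x x') \<in> borel_measurable prior" if "x \<in> space prior" for x
    using measurable_Pair2[OF measurable_overlap that] by simp
  have exp_le: "ennreal (exp w) \<le> suminf (\<lambda>n. ennreal (a n w))" for w
  proof -
    have "(\<lambda>n. a n w) = (\<lambda>n. 2 * (if even n then w ^ n /\<^sub>R fact n else 0))"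
      by (auto simp: a_def fun_eq_iff divide_inverse mult_ac)
    then have "(\<lambda>n. a n w) sums (2 * cosh w)" using cosh_converges[of w] by (simp only: sums_mult)
    then have "suminf (\<lambda>n. ennreal (a n w)) = ennreal (2 * cosh w)"
      using a0 by (intro suminf_ennreal_eq)
    moreover have "exp w \<le> 2 * cosh w" by (simp add: cosh_def)
    ultimately show ?thesis by (simp add: ennreal_leI)
  qed
  have inner: "(\<integral>\<^sup>+x'. ennreal (a n (overlap x x')) \<partial>prior) = ennreal (\<integral>x'. a n (overlap x x') \<partial>prior)" for n x
  proof (rule nn_integral_eq_integral)
    show "integrable prior (\<lambda>x'. a n (overlap x x'))"
      using integrable_overlap_power[of x n] by (cases "even n") (simp_all add: a_def)
  qed (simp add: a0)
  have summand: "(\<integral>\<^sup>+x. \<integral>\<^sup>+x'. ennreal (a n (overlap x x')) \<partial>prior \<partial>prior) \<le> ennreal (2 * (rep_moment n / fact n))" for n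
  proof (cases "even n")
    case True
    have eq: "(\<integral>x'. a n (overlap x x') \<partial>prior) = 2 * ((\<integral>x'. overlap x x' ^ n \<partial>prior) / fact n)" for x
      using True by (simp add: a_def)
    have "(\<integral>\<^sup>+x. ennreal (2 * ((\<integral>x'. overlap x x' ^ n \<partial>prior) / fact n)) \<partial>prior) =
        ennreal (\<integral>x. 2 * ((\<integral>x'. overlap x x' ^ n \<partial>prior) / fact n) \<partial>prior)"
    proof (rule nn_integral_eq_integral)
      show "AE x in prior. 0 \<le> 2 * ((\<integral>x'. overlap x x' ^ n \<partial>prior) / fact n)"
        using True by (intro AE_I2) (simp add: Bochner_Integration.integral_nonneg zero_le_even_power)
    qed (use replica_moment_eq(1)[OF finite_lessThan J_subset \<nu> int, of "overlap_coeff \<Delta> \<beta> N" n] in simp)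
    then show ?thesis unfolding inner eq by (simp add: replica_moment_def)
  qed (simp add: a_def)
  have "(\<integral>\<^sup>+x. \<integral>\<^sup>+x'. ennreal (exp (overlap x x')) \<partial>prior \<partial>prior) \<le>
      (\<integral>\<^sup>+x. \<integral>\<^sup>+x'. suminf (\<lambda>n. ennreal (a n (overlap x x'))) \<partial>prior \<partial>prior)"
    by (intro nn_integral_mono exp_le)
  also have "\<dots> = (\<integral>\<^sup>+x. suminf (\<lambda>n. \<integral>\<^sup>+x'. ennreal (a n (overlap x x')) \<partial>prior) \<partial>prior)"
    by (intro nn_integral_cong nn_integral_suminf) measurable
  also have "\<dots> = suminf (\<lambda>n. \<integral>\<^sup>+x. \<integral>\<^sup>+x'. ennreal (a n (overlap x x')) \<partial>prior \<partial>prior)"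
  proof (rule nn_integral_suminf)
    fix n
    have "(\<lambda>x. \<integral>x'. a n (overlap x x') \<partial>prior) \<in> borel_measurable prior"
      by measurable
    then show "(\<lambda>x. \<integral>\<^sup>+x'. ennreal (a n (overlap x x')) \<partial>prior) \<in> borel_measurable prior"
      unfolding inner by measurable
  qed
  also have "\<dots> \<le> suminf (\<lambda>n. ennreal (2 * (rep_moment n / fact n)))"
    by (intro suminf_le summand) auto
  also have "\<dots> \<le> ennreal (2 * K)"
  proof (rule suminf_le_const)
    fix n
    have "(\<Sum>d<n. ennreal (2 * (rep_moment d / fact d))) = ennreal (\<Sum>d<n. 2 * (rep_moment d / fact d))"
      using replica_moment_nonneg by (intro sum_ennreal) auto
    also have "(\<Sum>d<n. 2 * (rep_moment d / fact d)) \<le> 2 * (\<Sum>d\<le>n. rep_moment d / fact d)"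
      unfolding sum_distrib_left using replica_moment_nonneg by (intro sum_mono2) auto
    also have "\<dots> \<le> 2 * K" using le[of n] by simp
    finally show "(\<Sum>d<n. ennreal (2 * (rep_moment d / fact d))) \<le> ennreal (2 * K)"
      by (simp add: ennreal_leI)
  qed auto
  finally show ?thesis .
qed

text \<open>Of the constant 4, one factor 2 comes from the Gaussian partial sums and the other from
  bounding \<open>exp\<close> by \<open>2 cosh\<close>.\<close>

lemma second_moment_le:
  assumes dom: "\<And>k. (\<integral>x. x ^ k \<partial>\<nu>)\<^sup>2 \<le> (\<integral>g. g ^ k \<partial>std_gauss)" and large: "2 * C * U \<le> N"
  shows "(\<integral>\<^sup>+y. likelihood_ratio J \<sigma> prior (spike \<beta> N) y ^ 2 \<partial>null_model \<Delta>) \<le> ennreal (4 * exp (C * U))"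
proof -
  have "(\<Sum>d\<le>D. rep_moment d / fact d) \<le> 2 * exp (C * U)" for D
    by (rule replica_partial_sum_le_moment_subgaussian)
       (use N J_subset overlap_coeff_nonneg sym_coeff_le quad_form_sym_coeff_le C_pos \<epsilon> \<nu> int dom large in auto)
  then have "(\<integral>\<^sup>+x. \<integral>\<^sup>+x'. ennreal (exp (overlap x x')) \<partial>prior \<partial>prior) \<le> ennreal (2 * (2 * exp (C * U)))"
    by (rule nn_integral_exp_overlap_le)
  moreover have "(\<integral>\<^sup>+y. likelihood_ratio J \<sigma> prior (spike \<beta> N) y ^ 2 \<partial>null_model \<Delta>) =
      (\<integral>\<^sup>+x. \<integral>\<^sup>+x'. ennreal (exp (overlap x x')) \<partial>prior \<partial>prior)"
    unfolding null_model_eq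
    using nn_integral_likelihood_ratio_square[OF finite_J sd_pos prob_space_prior measurable_spike] spike_overlap N
    by simp
  ultimately show ?thesis by simp
qed

lemma statistical_bounds:
  assumes dom: "\<And>k. (\<integral>x. x ^ k \<partial>\<nu>)\<^sup>2 \<le> (\<integral>g. g ^ k \<partial>std_gauss)" and large: "2 * C * U \<le> N"
  defines "K \<equiv> 4 * exp (C * U)" and "P \<equiv> planted_model (spike_law \<nu> \<beta> N) \<Delta>" and "Q \<equiv> null_model \<Delta>"
  shows "chi_square P Q \<le> ennreal (K + 1)"
    and "square_integrable Q f \<Longrightarrow> square_integrable P f \<Longrightarrow>
      prob_space.expectation P f - prob_space.expectation Q f \<le> sqrt K * sqrt (prob_space.variance Q f)"
    and "S \<in> sets Q \<Longrightarrow> (measure P S)\<^sup>2 \<le> K * measure Q S"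
proof -
  have K: "0 \<le> K" by (simp add: K_def)
  note second = second_moment_le[OF dom large, folded K_def, unfolded null_model_eq]
  note facts = finite_J sd_pos prob_space_prior measurable_spike K second
  show "chi_square P Q \<le> ennreal (K + 1)"
    unfolding P_def Q_def planted_model_eq null_model_eq by (rule chi_square_le[OF facts])
  show "square_integrable Q f \<Longrightarrow> square_integrable P f \<Longrightarrow>
      prob_space.expectation P f - prob_space.expectation Q f \<le> sqrt K * sqrt (prob_space.variance Q f)"
    unfolding P_def Q_def planted_model_eq null_model_eq by (rule expectation_gap_le[OF facts])
  show "S \<in> sets Q \<Longrightarrow> (measure P S)\<^sup>2 \<le> K * measure Q S"
    unfolding P_def Q_def planted_model_eq null_model_eq by (rule measure_planted_square_le[OF facts])
qed

lemma computational_bound: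
  fixes f :: "(nat \<times> nat) mpolynomial" and K :: real
  assumes f: "mp_vars f \<subseteq> J" "mp_degree f \<le> D"
    and fP: "square_integrable (planted_model (spike_law \<nu> \<beta> N) \<Delta>) (mp_eval f)"
    and K: "K \<ge> 1"
    and dom: "\<And>k. (\<integral>x. x ^ k \<partial>\<nu>)\<^sup>2 \<le> ((1 - 1 / K) * 0 ^ k + 1 / K * sqrt K ^ k) * (\<integral>g. g ^ k \<partial>std_gauss)"
    and large: "4 * K * C * U \<le> N"
  defines "P \<equiv> planted_model (spike_law \<nu> \<beta> N) \<Delta>" and "Q \<equiv> null_model \<Delta>"
    and "R \<equiv> 2 * exp (2 * K * C * U) + (4 * K * C + 1) ^ D * (2 * exp 1) * (N * exp (- (N / (16 * K * C * U\<^sup>2))))"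
  shows "(prob_space.expectation P (mp_eval f) - prob_space.expectation Q (mp_eval f))\<^sup>2
    \<le> prob_space.variance Q (mp_eval f) * R"
proof -
  have "(prob_space.expectation P (mp_eval f) - prob_space.expectation Q (mp_eval f))\<^sup>2 \<le>
      prob_space.variance Q (mp_eval f) *
      (\<integral>x. (\<integral>x'. (\<Sum>d\<le>D. (\<Sum>p\<in>J. spike \<beta> N x p * spike \<beta> N x' p / (\<sigma> p)\<^sup>2) ^ d / fact d) \<partial>prior) \<partial>prior)"
    unfolding P_def Q_def planted_model_eq null_model_eq
    by (rule low_degree_gap_le[OF finite_J sd_pos prob_space_prior measurable_spike integrable_spike_monomial f
          fP[unfolded planted_model_eq]])
  also have "(\<integral>x. (\<integral>x'. (\<Sum>d\<le>D. (\<Sum>p\<in>J. spike \<beta> N x p * spike \<beta> N x' p / (\<sigma> p)\<^sup>2) ^ d / fact d) \<partial>prior) \<partial>prior) =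
      (\<Sum>d\<le>D. rep_moment d / fact d)"
    using N integral_overlap_partial_sum[of D] by (simp only: spike_overlap)
  also have "prob_space.variance Q (mp_eval f) * (\<Sum>d\<le>D. rep_moment d / fact d) \<le> prob_space.variance Q (mp_eval f) * R"
  proof (rule mult_left_mono)
    show "(\<Sum>d\<le>D. rep_moment d / fact d) \<le> R"
      unfolding R_def
      by (rule replica_partial_sum_le_subgaussian[OF _ J_subset overlap_coeff_nonneg sym_coeff_le
            quad_form_sym_coeff_le C_pos \<epsilon> \<nu> int K dom large]) (use N in auto)
  qed (rule Bochner_Integration.integral_nonneg, simp)
  finally show ?thesis .
qed

end

end

subsection \<open>Asymptotics\<close>

text \<open>Separation is contradicted at the constant \<open>K + 1\<close>, which is positive even
  for \<open>K = 0\<close>. Its strict inequality also fails when both variances vanish.\<close>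

lemma not_strong_separation:
  assumes K: "K \<ge> 0"
    and le: "\<forall>\<^sub>F N in sequentially. prob_space.expectation (P N) (f N) - prob_space.expectation (Q N) (f N) \<le>
      K * sqrt (prob_space.variance (Q N) (f N))"
  shows "\<not> strong_separation P Q f"
proof
  let ?V = "\<lambda>M N. sqrt (prob_space.variance (M N) (f N))"
  assume "strong_separation P Q f"
  then have "\<forall>\<^sub>F N in sequentially. prob_space.expectation (P N) (f N) - prob_space.expectation (Q N) (f N) >
      (K + 1) * (?V Q N + ?V P N)"
    using K unfolding strong_separation_def by auto
  with le have "\<forall>\<^sub>F N in sequentially. False"
  proof eventually_elim
    case (elim N)
    have "0 \<le> ?V Q N" "0 \<le> ?V P N" by (simp_all add: Bochner_Integration.integral_nonneg)
    then have "K * ?V Q N \<le> (K + 1) * (?V Q N + ?V P N)"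
      using K by (intro mult_mono) auto
    with elim show False by linarith
  qed
  then show False by simp
qed

text \<open>If both error probabilities tend to 0, the event \<open>t N y = 1\<close> has planted
  probability tending to 1 and null probability tending to 0, against the square inequality.\<close>

lemma not_strong_detection:
  assumes PQ: "\<forall>\<^sub>F N in sequentially. prob_space (P N) \<and> sets (P N) = sets (Q N) \<and>
      (\<forall>A\<in>sets (Q N). (measure (P N) A)\<^sup>2 \<le> K * measure (Q N) A)"
  shows "\<not> strong_detection P Q t"
proof
  assume t: "strong_detection P Q t"
  define p where "p N = measure (P N) {y \<in> space (P N). t N y = 0}" for N
  define q where "q N = measure (Q N) {y \<in> space (Q N). t N y = 1}" for N
  have pq: "(\<lambda>N. p N + q N) \<longlonglongrightarrow> 0" using t by (simp add: strong_detection_def p_def q_def)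
  have p: "p \<longlonglongrightarrow> 0" and q: "q \<longlonglongrightarrow> 0"
    by (rule tendsto_sandwich[OF _ _ tendsto_const pq]; simp add: p_def q_def)+
  have "\<forall>\<^sub>F N in sequentially. (1 - p N)\<^sup>2 \<le> K * q N"
    using PQ eventually_ge_at_top[of 1]
  proof eventually_elim
    case (elim N)
    then interpret prob_space "P N" by simp
    have space: "space (P N) = space (Q N)" using elim by (intro sets_eq_imp_space_eq) simp
    have tN [measurable]: "t N \<in> measurable (P N) (count_space {0, 1})"
      using t elim by (simp add: strong_detection_def)
    have S: "{y \<in> space (P N). t N y = 1} \<in> sets (P N)"
      using measurable_sets[of "t N" "P N" "count_space {0, 1}" "{1}"]
      by (simp add: vimage_def Int_def conj_commute)
    have "t N y \<in> {0, 1}" if "y \<in> space (P N)" for y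
      using measurable_space[OF tN that] by simp
    then have "{y \<in> space (P N). t N y = 0} = space (P N) - {y \<in> space (P N). t N y = 1}" by auto
    then have "1 - p N = measure (P N) {y \<in> space (P N). t N y = 1}"
      using prob_compl[OF S] by (simp add: p_def)
    then show ?case using elim S by (simp add: q_def space)
  qed
  then have "(1 - 0)\<^sup>2 \<le> K * 0"
    by (intro tendsto_le[OF sequentially_bot tendsto_mult[OF tendsto_const q]
          tendsto_power[OF tendsto_diff[OF tendsto_const p]]])
  then show False by simp
qed

text \<open>Half of the decay rate absorbs \<open>a ^ D N\<close>, whose exponent is sublinear in
  \<open>N\<close>; the other half absorbs the factor \<open>N\<close>.\<close>

lemma power_exp_decay_bounded:
  fixes D :: "nat \<Rightarrow> nat" and a \<gamma> :: real
  assumes a: "a \<ge> 1" and \<gamma>: "\<gamma> > 0" and D: "(\<lambda>N. real (D N) / real N) \<longlonglongrightarrow> 0"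
  shows "\<forall>\<^sub>F N in sequentially. a ^ D N * (real N * exp (- (\<gamma> * N))) \<le> 2 / \<gamma>"
proof -
  have "(\<lambda>N. real (D N) / real N * ln a) \<longlonglongrightarrow> 0 * ln a" by (intro tendsto_mult D tendsto_const)
  then have "\<forall>\<^sub>F N in sequentially. real (D N) / real N * ln a < \<gamma> / 2"
    using \<gamma> by (intro order_tendstoD(2)) auto
  then show ?thesis using eventually_gt_at_top[of 0]
  proof eventually_elim
    case (elim N)
    then have "real (D N) * ln a \<le> \<gamma> / 2 * N" by (simp add: field_simps)
    then have "exp (real (D N) * ln a) \<le> exp (\<gamma> / 2 * N)" by simp
    moreover have "exp (real (D N) * ln a) = a ^ D N" using a by (simp add: exp_of_nat_mult)
    ultimately have "a ^ D N * (N * exp (- (\<gamma> * N))) \<le> exp (\<gamma> / 2 * N) * (N * exp (- (\<gamma> * N)))"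
      by (intro mult_right_mono) auto
    also have "\<dots> = N * exp (- (\<gamma> / 2 * N))" by (simp add: exp_add[symmetric] algebra_simps)
    also have "\<dots> \<le> 2 / \<gamma>"
    proof -
      have "\<gamma> / 2 * N \<le> exp (\<gamma> / 2 * N)" using exp_ge_add_one_self[of "\<gamma> / 2 * N"] by linarith
      then have "\<gamma> / 2 * N * exp (- (\<gamma> / 2 * N)) \<le> 1" by (simp add: exp_minus field_simps)
      then show ?thesis using \<gamma> by (simp add: field_simps)
    qed
    finally show ?case .
  qed
qed

text \<open>Multiplication by \<open>(l N / N) ^ 3\<close>, which converges to
  \<open>\<mu> ^ 3\<close>, cancels the cube in the denominator and leaves
  \<open>D N / N\<close>.\<close>

lemma degree_sublinear:
  fixes D :: "nat \<Rightarrow> nat" and l :: "nat \<Rightarrow> real"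
  assumes l: "(\<lambda>N. l N / real N) \<longlonglongrightarrow> \<mu>" "\<mu> > 0"
    and D: "(\<lambda>N. real (D N) * (real N)\<^sup>2 / l N ^ 3) \<longlonglongrightarrow> 0"
  shows "(\<lambda>N. real (D N) / real N) \<longlonglongrightarrow> 0"
proof -
  have "(\<lambda>N. real (D N) * (real N)\<^sup>2 / l N ^ 3 * (l N / real N) ^ 3) \<longlonglongrightarrow> 0 * \<mu> ^ 3"
    by (intro tendsto_mult tendsto_power l D)
  moreover have "\<forall>\<^sub>F N in sequentially. real (D N) * (real N)\<^sup>2 / l N ^ 3 * (l N / real N) ^ 3 = real (D N) / real N"
    using order_tendstoD(1)[OF l] eventually_gt_at_top[of 0]
    by eventually_elim (auto simp: field_simps power2_eq_square power3_eq_cube)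
  ultimately show ?thesis by (simp add: tendsto_cong)
qed

lemma spectral_gap_eventually:
  fixes l :: "nat \<Rightarrow> real"
  assumes l: "(\<lambda>N. l N / real N) \<longlonglongrightarrow> \<mu>" and less: "\<beta>\<^sup>2 * \<mu> < 1 - \<epsilon>"
  shows "\<forall>\<^sub>F N in sequentially. \<beta>\<^sup>2 / real N * (l N + B) \<le> 1 - \<epsilon>"
proof -
  have "(\<lambda>N. \<beta>\<^sup>2 * (l N / real N) + \<beta>\<^sup>2 * B * (1 / real N)) \<longlonglongrightarrow> \<beta>\<^sup>2 * \<mu> + \<beta>\<^sup>2 * B * 0"
    by (intro tendsto_add tendsto_mult tendsto_const l lim_1_over_n)
  then have "\<forall>\<^sub>F N in sequentially. \<beta>\<^sup>2 * (l N / real N) + \<beta>\<^sup>2 * B * (1 / real N) < 1 - \<epsilon>"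
    using less by (intro order_tendstoD(2)) auto
  then show ?thesis by eventually_elim (simp add: algebra_simps add_divide_distrib)
qed

theorem theorem1p11:
  fixes \<Delta> :: "nat \<Rightarrow> ennreal mat"
    and \<nu> :: "real measure"
    and \<beta> \<mu>\<^sub>1 \<beta>\<^sub>s :: real
    and \<P> \<Q> :: "nat \<Rightarrow> (nat \<times> nat \<Rightarrow> real) measure"
  assumes profile: "\<And>N. N \<ge> 1 \<Longrightarrow> variance_profile N (\<Delta> N)"
    and limit: "(\<lambda>N. largest_eigenvalue (recip_profile (\<Delta> N)) / real N) \<longlonglongrightarrow> \<mu>\<^sub>1"
    and limit_pos: "\<mu>\<^sub>1 > 0"
    and threshold: "\<beta>\<^sub>s = 1 / sqrt \<mu>\<^sub>1"
    and nu_prob: "prob_space \<nu>"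
    and nu_borel: "sets \<nu> = sets borel"
    and beta_pos: "\<beta> > 0"
    and P_def: "\<And>N. \<P> N = planted_model (spike_law \<nu> \<beta> N) (\<Delta> N)"
    and Q_def: "\<And>N. \<Q> N = null_model (\<Delta> N)"
  shows
    "(\<forall>D :: nat \<Rightarrow> nat.
        integrable \<nu> (\<lambda>x. x) \<and> prob_space.expectation \<nu> (\<lambda>x. x) = 0 \<and>
        integrable \<nu> (\<lambda>x. x\<^sup>2) \<and> prob_space.expectation \<nu> (\<lambda>x. x\<^sup>2) \<le> 1 \<and>
        distr \<nu> borel uminus = \<nu> \<and>
        (\<exists>s>0. subgaussian (\<nu> \<Otimes>\<^sub>M \<nu>) (\<lambda>(x, x'). x * x') s) \<and>
        (\<exists>B>0. \<forall>N\<ge>1. \<forall>i<N. \<forall>j<N. \<Delta> N $$ (i, j) \<ge> ennreal (1 / B)) \<and>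
        (\<lambda>N. real (D N) * (real N)\<^sup>2 / largest_eigenvalue (recip_profile (\<Delta> N)) ^ 3) \<longlonglongrightarrow> 0 \<and>
        \<beta> < \<beta>\<^sub>s
      \<longrightarrow> \<not> (\<exists>f :: nat \<Rightarrow> (nat \<times> nat) mpolynomial.
               (\<forall>N\<ge>1. mp_vars (f N) \<subseteq> observed (\<Delta> N) \<and> mp_degree (f N) \<le> D N) \<and>
               strong_separation \<P> \<Q> (\<lambda>N. mp_eval (f N))))
     \<and>
     (integrable \<nu> (\<lambda>x. x) \<and> prob_space.expectation \<nu> (\<lambda>x. x) = 0 \<and>
      integrable \<nu> (\<lambda>x. x\<^sup>2) \<and> prob_space.expectation \<nu> (\<lambda>x. x\<^sup>2) \<le> 1 \<and>
      distr \<nu> borel uminus = \<nu> \<and>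
      (\<exists>B>0. \<forall>N\<ge>1. \<forall>i<N. \<forall>j<N. \<Delta> N $$ (i, j) \<ge> ennreal (1 / B)) \<and>
      moment_subgaussian (\<nu> \<Otimes>\<^sub>M \<nu>) (\<lambda>(x, x'). x * x') 1 \<and>
      \<beta> < \<beta>\<^sub>s
      \<longrightarrow> \<not> (\<exists>f. strong_separation \<P> \<Q> f) \<and>
          \<not> (\<exists>t. strong_detection \<P> \<Q> t) \<and>
          (\<exists>K :: real. \<forall>\<^sub>F N in sequentially. chi_square (\<P> N) (\<Q> N) \<le> ennreal K))"
proof -
  \<comment> \<open>Half the distance of \<open>\<beta>\<^sup>2 * \<mu>\<^sub>1\<close> from 1; the
    other half is room for the approach to the limit and for the doubled diagonal.\<close>
  define \<epsilon> where "\<epsilon> = (1 - \<beta>\<^sup>2 * \<mu>\<^sub>1) / 2"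
  have \<epsilon>: "\<epsilon> > 0" "\<beta>\<^sup>2 * \<mu>\<^sub>1 < 1 - \<epsilon>" if "\<beta> < \<beta>\<^sub>s"
  proof -
    have "\<beta> * sqrt \<mu>\<^sub>1 < 1" using that threshold limit_pos by (simp add: field_simps)
    then have "(\<beta> * sqrt \<mu>\<^sub>1)\<^sup>2 < 1\<^sup>2" using beta_pos limit_pos by (intro power_strict_mono) auto
    then have "\<beta>\<^sup>2 * \<mu>\<^sub>1 < 1" using limit_pos by (simp add: power_mult_distrib)
    then show "\<epsilon> > 0" "\<beta>\<^sup>2 * \<mu>\<^sub>1 < 1 - \<epsilon>" by (simp_all add: \<epsilon>_def field_simps)
  qed
  let ?C = "\<lambda>B. 2 * B * \<beta>\<^sup>2" and ?U = "\<lambda>B. 1 + 2 * B * \<beta>\<^sup>2 / \<epsilon>"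
  have eventually_large: "\<forall>\<^sub>F N in sequentially. N \<ge> 1 \<and> a \<le> real N" for a
    using eventually_ge_at_top[of 1] eventually_ge_at_top[of "nat \<lceil>a\<rceil>"]
    by eventually_elim (auto simp: nat_ceiling_le_eq)
  show ?thesis
  proof (intro conjI allI impI; elim conjE exE)
    fix D :: "nat \<Rightarrow> nat" and s B :: real
    assume var: "integrable \<nu> (\<lambda>x. x\<^sup>2)" "prob_space.expectation \<nu> (\<lambda>x. x\<^sup>2) \<le> 1"
      and sym: "distr \<nu> borel uminus = \<nu>"
      and s: "0 < s" and sub: "subgaussian (\<nu> \<Otimes>\<^sub>M \<nu>) (\<lambda>(x, x'). x * x') s"
      and B: "0 < B" and lower: "\<forall>N\<ge>1. \<forall>i<N. \<forall>j<N. ennreal (1 / B) \<le> \<Delta> N $$ (i, j)"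
      and D: "(\<lambda>N. real (D N) * (real N)\<^sup>2 / largest_eigenvalue (recip_profile (\<Delta> N)) ^ 3) \<longlonglongrightarrow> 0"
      and \<beta>: "\<beta> < \<beta>\<^sub>s"
    define K where "K = (max 1 (2 * exp 1 * s))\<^sup>2"
    note mom = moments_of_subgaussian[OF nu_prob nu_borel sym var s sub, folded K_def]
    let ?C = "?C B" and ?U = "?U B"
    have C: "?C > 0" and U: "?U > 0" using B beta_pos \<epsilon>(1)[OF \<beta>] by (auto intro!: add_pos_pos)
    \<comment> \<open>The decay rate per unit of \<open>N\<close> of the exceptional masks.\<close>
    define \<gamma> where "\<gamma> = 1 / (16 * K * ?C * ?U\<^sup>2)"
    have \<gamma>: "\<gamma> > 0" unfolding \<gamma>_def using mom(1) C U B beta_pos by (intro divide_pos_pos mult_pos_pos) auto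
    \<comment> \<open>A bound on the degree-\<open>D\<close> advantage that is free of
      \<open>N\<close>: the contribution of the exceptional masks is eventually at most
      \<open>2 * exp 1 * (2 / \<gamma>)\<close>.\<close>
    define R where "R = 2 * exp (2 * K * ?C * ?U) + 2 * exp 1 * (2 / \<gamma>)"
    have R: "R \<ge> 0" unfolding R_def using \<gamma> by simp
    show "\<not> (\<exists>f :: nat \<Rightarrow> (nat \<times> nat) mpolynomial.
        (\<forall>N\<ge>1. mp_vars (f N) \<subseteq> observed (\<Delta> N) \<and> mp_degree (f N) \<le> D N) \<and>
        strong_separation \<P> \<Q> (\<lambda>N. mp_eval (f N)))"
    proof (rule notI, elim exE conjE)
      fix f :: "nat \<Rightarrow> (nat \<times> nat) mpolynomial"
      assume f: "\<forall>N\<ge>1. mp_vars (f N) \<subseteq> observed (\<Delta> N) \<and> mp_degree (f N) \<le> D N"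
        and sep: "strong_separation \<P> \<Q> (\<lambda>N. mp_eval (f N))"
      have decay: "\<forall>\<^sub>F N in sequentially. (4 * K * ?C + 1) ^ D N * (real N * exp (- (\<gamma> * N))) \<le> 2 / \<gamma>"
        using mom(1) C \<gamma> by (intro power_exp_decay_bounded degree_sublinear[OF limit limit_pos D]) auto
      have "\<forall>\<^sub>F N in sequentially.
          prob_space.expectation (\<P> N) (mp_eval (f N)) - prob_space.expectation (\<Q> N) (mp_eval (f N)) \<le>
          sqrt R * sqrt (prob_space.variance (\<Q> N) (mp_eval (f N)))"
        using eventually_large[of "4 * K * ?C * ?U"] decay
          spectral_gap_eventually[OF limit \<epsilon>(2)[OF \<beta>], of B]
      proof eventually_elim
        case (elim N)
        let ?gap = "prob_space.expectation (\<P> N) (mp_eval (f N)) - prob_space.expectation (\<Q> N) (mp_eval (f N))"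
        let ?V = "prob_space.variance (\<Q> N) (mp_eval (f N))"
        have N: "1 \<le> N" and large: "4 * K * ?C * ?U \<le> N" using elim(1) by auto
        have fN: "mp_vars (f N) \<subseteq> observed (\<Delta> N)" "mp_degree (f N) \<le> D N" using f N by auto
        have fP: "square_integrable (planted_model (spike_law \<nu> \<beta> N) (\<Delta> N)) (mp_eval (f N))"
          using sep N unfolding strong_separation_def P_def by auto
        have lowerN: "ennreal (1 / B) \<le> \<Delta> N $$ (i, j)" if "i < N" "j < N" for i j
          using lower N that by auto
        have V: "?V \<ge> 0" by (simp add: Bochner_Integration.integral_nonneg)
        have "N / (16 * K * ?C * ?U\<^sup>2) = \<gamma> * N" by (simp add: \<gamma>_def)
        then have "?gap\<^sup>2 \<le> ?V * (2 * exp (2 * K * ?C * ?U) +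
            (4 * K * ?C + 1) ^ D N * (2 * exp 1) * (N * exp (- (\<gamma> * N))))"
          using computational_bound[OF N profile[OF N] nu_prob nu_borel B lowerN beta_pos \<epsilon>(1)[OF \<beta>] elim(3)
              mom(2) fN fP mom(1,3) large]
          by (simp only: P_def Q_def)
        also have "\<dots> = ?V * (2 * exp (2 * K * ?C * ?U) +
            2 * exp 1 * ((4 * K * ?C + 1) ^ D N * (N * exp (- (\<gamma> * N)))))"
          by (simp only: mult_ac)
        also have "\<dots> \<le> ?V * R"
          unfolding R_def by (intro mult_left_mono add_left_mono elim(2) V) auto
        finally have "?gap\<^sup>2 \<le> R * ?V" by (simp only: mult.commute)
        then have "?gap \<le> sqrt (R * ?V)" by (rule real_le_rsqrt)
        then show ?case by (simp only: real_sqrt_mult)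
      qed
      then show False using sep not_strong_separation[of "sqrt R"] R by fastforce
    qed
  next
    fix B :: real
    assume sym: "distr \<nu> borel uminus = \<nu>"
      and B: "0 < B" and lower: "\<forall>N\<ge>1. \<forall>i<N. \<forall>j<N. ennreal (1 / B) \<le> \<Delta> N $$ (i, j)"
      and sub: "moment_subgaussian (\<nu> \<Otimes>\<^sub>M \<nu>) (\<lambda>(x, x'). x * x') 1"
      and \<beta>: "\<beta> < \<beta>\<^sub>s"
    note mom = moments_of_moment_subgaussian[OF nu_prob nu_borel sym sub]
    define K where "K = 4 * exp (?C B * ?U B)"
    have K: "K \<ge> 0" by (simp add: K_def)
    have bounds: "\<forall>\<^sub>F N in sequentially. N \<ge> 1 \<and> chi_square (\<P> N) (\<Q> N) \<le> ennreal (K + 1) \<and>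
        (\<forall>f. square_integrable (\<Q> N) f \<longrightarrow> square_integrable (\<P> N) f \<longrightarrow>
          prob_space.expectation (\<P> N) f - prob_space.expectation (\<Q> N) f \<le>
            sqrt K * sqrt (prob_space.variance (\<Q> N) f)) \<and>
        (\<forall>A\<in>sets (\<Q> N). (measure (\<P> N) A)\<^sup>2 \<le> K * measure (\<Q> N) A)"
      using eventually_large[of "2 * ?C B * ?U B"] spectral_gap_eventually[OF limit \<epsilon>(2)[OF \<beta>], of B]
    proof eventually_elim
      case (elim N)
      have N: "1 \<le> N" and large: "2 * ?C B * ?U B \<le> N" using elim(1) by auto
      have lowerN: "ennreal (1 / B) \<le> \<Delta> N $$ (i, j)" if "i < N" "j < N" for i j
        using lower N that by auto
      note b = statistical_bounds[OF N profile[OF N] nu_prob nu_borel B lowerN beta_pos \<epsilon>(1)[OF \<beta>] elim(2)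
          mom large, folded K_def P_def Q_def]
      show ?case using N b by blast
    qed
    show "\<not> (\<exists>f. strong_separation \<P> \<Q> f)"
    proof (rule notI, elim exE)
      fix f assume sep: "strong_separation \<P> \<Q> f"
      have "\<forall>\<^sub>F N in sequentially. prob_space.expectation (\<P> N) (f N) - prob_space.expectation (\<Q> N) (f N) \<le>
          sqrt K * sqrt (prob_space.variance (\<Q> N) (f N))"
        using bounds by eventually_elim (use sep in \<open>auto simp: strong_separation_def\<close>)
      then show False using sep not_strong_separation[of "sqrt K" \<P> f \<Q>] K by simp
    qed
    show "\<not> (\<exists>t. strong_detection \<P> \<Q> t)"
    proof -
      have "\<forall>\<^sub>F N in sequentially. prob_space (\<P> N) \<and> sets (\<P> N) = sets (\<Q> N) \<and>
          (\<forall>A\<in>sets (\<Q> N). (measure (\<P> N) A)\<^sup>2 \<le> K * measure (\<Q> N) A)"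
        using bounds
      proof eventually_elim
        case (elim N)
        then show ?case
          using planted_model_prob_space[OF _ profile nu_prob nu_borel, of N \<beta>] by (simp add: P_def Q_def)
      qed
      then show ?thesis using not_strong_detection by blast
    qed
    show "\<exists>K. \<forall>\<^sub>F N in sequentially. chi_square (\<P> N) (\<Q> N) \<le> ennreal K"
      by (rule exI[of _ "K + 1"]) (use bounds in \<open>auto elim: eventually_mono\<close>)
  qed
qed

end
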